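(* Let $k$ be a field, let $A_1,\dots,A_n$ be non-empty disjoint finite sets of cardinalities $\alpha_1,\dots,\alpha_n$, and let $A=\bigcup_iA_i$. Let $\mathfrak j\subseteq k[x_1,\dots,x_n]$ be an Artin monomial ideal containing $\mathfrak c=(x_1^{\alpha_1},\dots,x_n^{\alpha_n})$, and let $J\subseteq k[A]$ be a polarization of $\mathfrak j$. Let $C=(m(A_1),\dots,m(A_n))\subseteq k[A]$ where $m(A_i)=\prod_{a\in A_i}a$. Let $K$ be the ideal linked to $J$ by $C$, and let $\mathfrak k$ be the ideal linked to $\mathfrak j$ by $\mathfrak c$. Then $K$ is a polarization of $\mathfrak k$.
   Context: $k[A]$ is the polynomial ring with variables the elements of $A$. Linkage: two ideals $J,K$ containing $C$ are linked by $C$ if the heights of $J$, $K$ and $C$ are all equal (so equal to $n$) and $K=(C:J)$, $J=(C:K)$; similarly for ideals in $k[x_1,\dots,x_n]$ with $\mathfrak c$ in place of $C$. An Artin monomial ideal is a monomial ideal containing a power of each variable. Polarization: Let $V'\to V$ be a surjection of finite sets with $|V'|=|V|+1$ and let $v_1\ne v_2$ in $V'$ be the two elements with the same image. A monomial ideal $J'\subseteq k[V']$ is a simple separation of a monomial ideal $J\subseteq k[V]$ if (i) $J$ is the image of $J'$ under $k[V']\to k[V]$; (ii) both $x_{v_1},x_{v_2}$ occur in some minimal generators of $J'$; (iii) $x_{v_1}-x_{v_2}$ is a non-zero divisor in $k[V']/J'$. A proper separation is obtained by a succession of simple separations; a separation is the extension of a proper separation to a polynomial ring with possibly more variables (equivalently,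 it is obtained by a sequence of simple separations in which (ii) is not required). A polarization is a squarefree separation. Polarizations in $k[A]$ of ideals in $k[x_1,\dots,x_n]$ are with respect to the map $A\to\{x_1,\dots,x_n\}$ sending the elements of $A_i$ to $x_i$: the ideal in $k[A]$ is squarefree, maps onto the ideal in $k[x_1,\dots,x_n]$, and the successive variable differences within the sets $A_i$ form a regular sequence for the quotient ring. *)

theory Defs
  imports "HOL-Library.Poly_Mapping" "HOL-Library.Extended_Nat" "HOL-Library.Disjoint_Sets"
    "HOL-Algebra.QuotRing"
begin

section \<open>Height, linkage and regular sequences in a commutative ring\<close>

definition prime_height :: "('r, 'm) ring_scheme \<Rightarrow> 'r set \<Rightarrow> enat" where
  "prime_height R P =
     Sup {enat m | m. \<exists>Q :: nat \<Rightarrow> 'r set.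
            (\<forall>i\<le>m. primeideal (Q i) R) \<and> (\<forall>i<m. Q i \<subset> Q (Suc i)) \<and> Q m = P}"

text \<open>The unit ideal has height \<open>\<infinity>\<close> (infimum over the empty set).\<close>

definition ideal_height :: "('r, 'm) ring_scheme \<Rightarrow> 'r set \<Rightarrow> enat" where
  "ideal_height R I = Inf {prime_height R P | P. primeideal P R \<and> I \<subseteq> P}"

definition colon_ideal :: "('r, 'm) ring_scheme \<Rightarrow> 'r set \<Rightarrow> 'r set \<Rightarrow> 'r set" where
  "colon_ideal R I J = {r \<in> carrier R. \<forall>x\<in>J. r \<otimes>\<^bsub>R\<^esub> x \<in> I}"

definition linked :: "('r, 'm) ring_scheme \<Rightarrow> 'r set \<Rightarrow> 'r set \<Rightarrow> 'r set \<Rightarrow> bool" where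
  "linked R C J K \<longleftrightarrow>
     ideal C R \<and> ideal J R \<and> ideal K R \<and> C \<subseteq> J \<and> C \<subseteq> K \<and>
     ideal_height R J = ideal_height R C \<and> ideal_height R K = ideal_height R C \<and>
     K = colon_ideal R C J \<and> J = colon_ideal R C K"

text \<open>\<open>fs\<close> is a regular sequence for \<open>R/I\<close>, spelled out in \<open>R\<close>: each \<open>fs ! i\<close> is a non-zero
  divisor modulo \<open>I + (fs ! 0, \<dots>, fs ! (i-1))\<close>, and \<open>I + (fs) \<noteq> R\<close>.\<close>

definition regular_sequence :: "('r, 'm) ring_scheme \<Rightarrow> 'r set \<Rightarrow> 'r list \<Rightarrow> bool" where
  "regular_sequence R I fs \<longleftrightarrow>
     set fs \<subseteq> carrier R \<and>
     (\<forall>i < length fs. \<forall>g \<in> carrier R.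
        g \<otimes>\<^bsub>R\<^esub> fs ! i \<in> I <+>\<^bsub>R\<^esub> Idl\<^bsub>R\<^esub> (set (take i fs)) \<longrightarrow>
        g \<in> I <+>\<^bsub>R\<^esub> Idl\<^bsub>R\<^esub> (set (take i fs))) \<and>
     I <+>\<^bsub>R\<^esub> Idl\<^bsub>R\<^esub> (set fs) \<noteq> carrier R"

section \<open>Polynomial rings\<close>

text \<open>Monomials are finitely supported exponent vectors, polynomials finitely supported
  functions on monomials. The ring \<open>k[V]\<close> consists of the polynomials in which only variables
  from \<open>V\<close> occur.\<close>

type_synonym ('v, 'k) mpoly = "('v \<Rightarrow>\<^sub>0 nat) \<Rightarrow>\<^sub>0 'k"

definition mpoly_ring :: "'v set \<Rightarrow> ('v, 'k::field) mpoly ring" where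
  "mpoly_ring V =
     \<lparr>carrier = {p. \<forall>m \<in> Poly_Mapping.keys p. Poly_Mapping.keys m \<subseteq> V},
      mult = (*), one = 1, zero = 0, add = (+)\<rparr>"

definition monomial :: "('v \<Rightarrow>\<^sub>0 nat) \<Rightarrow> ('v, 'k::field) mpoly" where
  "monomial m = Poly_Mapping.single m 1"

definition var :: "'v \<Rightarrow> ('v, 'k::field) mpoly" where
  "var v = monomial (Poly_Mapping.single v 1)"

text \<open>The \<open>k\<close>-algebra map \<open>k[V'] \<rightarrow> k[V]\<close> induced by a map of variables \<open>V' \<rightarrow> V\<close>.\<close>

definition push_exponent :: "('v \<Rightarrow> 'w) \<Rightarrow> ('v \<Rightarrow>\<^sub>0 nat) \<Rightarrow> ('w \<Rightarrow>\<^sub>0 nat)" where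
  "push_exponent f m =
     (\<Sum>v \<in> Poly_Mapping.keys m. Poly_Mapping.single (f v) (Poly_Mapping.lookup m v))"

definition rename_vars :: "('v \<Rightarrow> 'w) \<Rightarrow> ('v, 'k::field) mpoly \<Rightarrow> ('w, 'k) mpoly" where
  "rename_vars f p =
     (\<Sum>m \<in> Poly_Mapping.keys p.
        Poly_Mapping.single (push_exponent f m) (Poly_Mapping.lookup p m))"

lemma mpoly_ring_cring: "cring (mpoly_ring V :: ('v, 'k::field) mpoly ring)"
proof (intro cringI abelian_groupI comm_monoidI)
  let ?R = "mpoly_ring V :: ('v, 'k) mpoly ring"
  have add: "p + q \<in> carrier ?R" if "p \<in> carrier ?R" "q \<in> carrier ?R" for p q
    using that Poly_Mapping.keys_add[of p q] by (fastforce simp: mpoly_ring_def)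
  show "x \<oplus>\<^bsub>?R\<^esub> y \<in> carrier ?R" if "x \<in> carrier ?R" "y \<in> carrier ?R" for x y
    using add[OF that] by (simp add: mpoly_ring_def)
  have mult: "p * q \<in> carrier ?R" if p: "p \<in> carrier ?R" and q: "q \<in> carrier ?R" for p q
  proof -
    have "Poly_Mapping.keys m \<subseteq> V" if m: "m \<in> Poly_Mapping.keys (p * q)" for m
    proof -
      obtain a b where ab: "a \<in> Poly_Mapping.keys p" "b \<in> Poly_Mapping.keys q" "m = a + b"
        using m keys_mult[of p q] by blast
      then show ?thesis
        using p q Poly_Mapping.keys_add[of a b] by (fastforce simp: mpoly_ring_def)
    qed
    then show ?thesis by (simp add: mpoly_ring_def)
  qed
  show "x \<otimes>\<^bsub>?R\<^esub> y \<in> carrier ?R" if "x \<in> carrier ?R" "y \<in> carrier ?R" for x y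
    using mult[OF that] by (simp add: mpoly_ring_def)
  show "\<exists>y\<in>carrier ?R. y \<oplus>\<^bsub>?R\<^esub> x = \<zero>\<^bsub>?R\<^esub>" if "x \<in> carrier ?R" for x
    using that by (intro bexI[of _ "- x"]) (auto simp: mpoly_ring_def)
qed (auto simp: mpoly_ring_def algebra_simps)

section \<open>Monomial ideals and polarizations\<close>

definition monomial_ideal :: "'v set \<Rightarrow> ('v, 'k::field) mpoly set \<Rightarrow> bool" where
  "monomial_ideal V I \<longleftrightarrow>
     (\<exists>M. (\<forall>m\<in>M. Poly_Mapping.keys m \<subseteq> V) \<and> I = Idl\<^bsub>mpoly_ring V\<^esub> (monomial ` M))"

definition squarefree_monomial_ideal :: "'v set \<Rightarrow> ('v, 'k::field) mpoly set \<Rightarrow> bool" where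
  "squarefree_monomial_ideal V I \<longleftrightarrow>
     (\<exists>M. (\<forall>m\<in>M. Poly_Mapping.keys m \<subseteq> V \<and> (\<forall>v. Poly_Mapping.lookup m v \<le> 1)) \<and>
          I = Idl\<^bsub>mpoly_ring V\<^esub> (monomial ` M))"

definition artin_monomial_ideal :: "'v set \<Rightarrow> ('v, 'k::field) mpoly set \<Rightarrow> bool" where
  "artin_monomial_ideal V I \<longleftrightarrow> monomial_ideal V I \<and> (\<forall>v\<in>V. \<exists>d. var v ^ d \<in> I)"

definition successive_differences :: "'v list \<Rightarrow> ('v, 'k::field) mpoly list" where
  "successive_differences vs = map2 (\<lambda>v w. var v - var w) vs (tl vs)"

text \<open>\<open>J \<subseteq> k[V]\<close> is a polarization of \<open>I \<subseteq> k[x\<^sub>1, \<dots>, x\<^sub>n]\<close> with respect to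
  \<open>\<pi> : V \<rightarrow> {1, \<dots>, n}\<close>. Here \<open>vs i\<close> enumerates the fibre over \<open>i\<close>. As \<open>J\<close> is graded and the
  differences are linear forms, regularity does not depend on the enumerations.\<close>

definition polarization ::
    "nat \<Rightarrow> 'v set \<Rightarrow> ('v \<Rightarrow> nat) \<Rightarrow> ('v, 'k::field) mpoly set \<Rightarrow> (nat, 'k) mpoly set \<Rightarrow> bool" where
  "polarization n V \<pi> J I \<longleftrightarrow>
     squarefree_monomial_ideal V J \<and>
     rename_vars \<pi> ` J = I \<and>
     (\<exists>vs :: nat \<Rightarrow> 'v list.
        (\<forall>i\<in>{1..n}. distinct (vs i) \<and> set (vs i) = {v \<in> V. \<pi> v = i}) \<and>
        regular_sequence (mpoly_ring V) J
          (concat (map (\<lambda>i. successive_differences (vs i)) [1..<Suc n])))"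

end

theory Submission
  imports Defs
begin

text \<open>
Let \<open>S = k[V]\<close>, let \<open>T \<subseteq> S\<close> be the subalgebra generated by the differences of variables in a
common block, and let \<open>\<Theta>\<close> be an ideal generated by an initial segment of the successive
differences.
Duality over \<open>T\<close> replaces the theory of Cohen-Macaulay and Gorenstein rings. The ring \<open>S/C\<close> is
\<open>T\<close>-free, and it carries a \<open>T\<close>-valued residue, an iterated divided difference, for which initial and
final partial products of the blocks are dual bases. In particular the differences are regular on
\<open>S/C\<close>. Since they are regular on \<open>S/J\<close> as well, \<open>S/J\<close> is \<open>T\<close>-free on the lifts of the standard
monomials of \<open>\<jj>\<close>. So if \<open>g J \<subseteq> C + \<Theta>\<close>, the functional \<open>f \<mapsto> residue (g f)\<close>, which kills \<open>J\<close> only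
modulo \<open>\<Theta>\<close>, agrees modulo \<open>\<Theta>\<close> with a \<open>T\<close>-linear functional killing \<open>J\<close>. The latter is of the form
\<open>f \<mapsto> residue (h f)\<close> with \<open>h \<in> K = (C : J)\<close>, whence \<open>K + \<Theta> = ((C + \<Theta>) : J)\<close>. Regularity
on \<open>S/C\<close> thus passes to \<open>S/K\<close>, and with all differences in \<open>\<Theta>\<close> the image of \<open>K\<close> is \<open>(\<cc> : \<jj>)\<close>.
The height condition only serves to exclude \<open>K = S\<close>.
\<close>

section \<open>Polynomial rings\<close>

text \<open>The obstacle is that colon ideals need not commute with passing to a quotient. That the
  image of \<open>K\<close> lies in (\<cc> : \<jj>) is immediate; the difficulty is to lift a
  multiplier of \<open>J\<close> into \<open>C\<close> modulo \<Theta> to a multiplier into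
  \<open>C\<close> itself. Freeness does this, because a linear map on a free module may be
  prescribed on a basis. The residue is the classical one in one variable, applied block by block.
  Let y_i be the first variable of block i. Then S = T[y_1, ..., y_n], each v in the block is y_i -
  t_v with t_v in T, and the block product is the monic polynomial in y_i with roots t_v. The
  divided difference at all the t_v reads off the coefficient of y_i^(\<alpha>_i - 1) in the
  remainder modulo this polynomial, and the dual bases consist of Newton polynomials for the nodes
  in the two opposite orders. For S/J, spanning comes from an induction on the degree, independence
  from regularity. Excluding K = S needs an upper bound on the height of \<open>C\<close>; it is
  obtained by bounding all chains of primes in k[V].\<close>

abbreviation keys where "keys \<equiv> Poly_Mapping.keys"
abbreviation lookup where "lookup \<equiv> Poly_Mapping.lookup"
abbreviation single where "single \<equiv> Poly_Mapping.single"

definition polys :: "'v set \<Rightarrow> ('v, 'k::field) mpoly set" where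
  "polys V = {p. \<forall>m \<in> keys p. keys m \<subseteq> V}"

definition const :: "'k \<Rightarrow> ('v, 'k::field) mpoly" where
  "const c = single 0 c"

lemma mpoly_ring_simps [simp]:
  "carrier (mpoly_ring V) = polys V"
  "mult (mpoly_ring V) = (*)"
  "one (mpoly_ring V) = 1"
  "zero (mpoly_ring V) = 0"
  "add (mpoly_ring V) = (+)"
  by (simp_all add: mpoly_ring_def polys_def)

lemma const_0 [simp]: "const 0 = 0" and const_1 [simp]: "const 1 = 1"
  by (simp_all add: const_def)

lemma const_add: "const (a + b) = const a + const b"
  by (simp add: const_def single_add)

lemma const_mult: "const (a * b) = const a * const b"
  by (simp add: const_def mult_single)

lemma const_uminus: "const (- a) = - const a"
  by (simp add: const_def single_uminus)

lemma single_conv_const_monomial: "single m c = const c * monomial m"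
  by (simp add: const_def monomial_def mult_single)

lemma monomial_0 [simp]: "monomial 0 = 1"
  by (simp add: monomial_def)

lemma monomial_add: "monomial (a + b) = monomial a * monomial b"
  by (simp add: monomial_def mult_single)

lemma monomial_sum: "finite X \<Longrightarrow> monomial (\<Sum>x\<in>X. f x) = (\<Prod>x\<in>X. monomial (f x))"
  by (induction X rule: finite_induct) (simp_all add: monomial_add)

lemma var_power: "var v ^ k = monomial (single v k)"
  by (induction k) (simp_all add: var_def monomial_add[symmetric] single_add[symmetric])

lemma keys_monomial [simp]: "keys (monomial m :: ('v, 'k::field) mpoly) = {m}"
  by (simp add: monomial_def)

lemma polys_0 [simp]: "0 \<in> polys V" and polys_1 [simp]: "1 \<in> polys V"
  and polys_const [simp]: "const c \<in> polys V"
  by (auto simp: polys_def const_def)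

lemma polys_uminus [simp]: "p \<in> polys V \<Longrightarrow> - p \<in> polys V"
  by (simp add: polys_def in_keys_iff)

lemma polys_add [simp]: "p \<in> polys V \<Longrightarrow> q \<in> polys V \<Longrightarrow> p + q \<in> polys V"
  using Poly_Mapping.keys_add[of p q] by (fastforce simp: polys_def)

lemma polys_diff [simp]: "p \<in> polys V \<Longrightarrow> q \<in> polys V \<Longrightarrow> p - q \<in> polys V"
  using polys_add[of p V "- q"] by simp

lemma polys_mult [simp]: "p \<in> polys V \<Longrightarrow> q \<in> polys V \<Longrightarrow> p * q \<in> polys V"
  using monoid.m_closed[OF cring.axioms(2)[OF mpoly_ring_cring, THEN comm_monoid.axioms(1)], of p V q] by simp

lemma polys_sum [simp]: "(\<And>x. x \<in> X \<Longrightarrow> f x \<in> polys V) \<Longrightarrow> (\<Sum>x\<in>X. f x) \<in> polys V"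
  by (induction X rule: infinite_finite_induct) auto

lemma polys_prod [simp]: "(\<And>x. x \<in> X \<Longrightarrow> f x \<in> polys V) \<Longrightarrow> (\<Prod>x\<in>X. f x) \<in> polys V"
  by (induction X rule: infinite_finite_induct) auto

lemma polys_power [simp]: "p \<in> polys V \<Longrightarrow> p ^ k \<in> polys V"
  by (induction k) auto

lemma polys_prod_list [simp]: "(\<And>x. x \<in> set xs \<Longrightarrow> f x \<in> polys V) \<Longrightarrow> (\<Prod>x\<leftarrow>xs. f x) \<in> polys V"
  by (induction xs) auto

lemma polys_monomial [simp]: "monomial m \<in> (polys V :: ('v, 'k::field) mpoly set) \<longleftrightarrow> keys m \<subseteq> V"
  by (simp add: polys_def)

lemma polys_var [simp]: "var v \<in> (polys V :: ('v, 'k::field) mpoly set) \<longleftrightarrow> v \<in> V"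
  by (simp add: var_def)

lemma polys_mono: "p \<in> polys V \<Longrightarrow> V \<subseteq> W \<Longrightarrow> p \<in> polys W"
  by (auto simp: polys_def)

lemma polys_UNIV [simp]: "p \<in> polys UNIV"
  by (simp add: polys_def)

lemma mpoly_eq_sum_monomials: "p = (\<Sum>m\<in>keys p. const (lookup p m) * monomial m)"
proof (rule poly_mapping_eqI)
  fix k
  have "lookup (\<Sum>m\<in>keys p. single m (lookup p m)) k = (\<Sum>m\<in>keys p. if m = k then lookup p k else 0)"
    by (simp add: lookup_sum lookup_single when_def)
  also have "\<dots> = lookup p k"
    by (simp add: in_keys_iff)
  finally show "lookup p k = lookup (\<Sum>m\<in>keys p. const (lookup p m) * monomial m) k"
    by (simp add: single_conv_const_monomial)
qed

definition total_degree :: "('v \<Rightarrow>\<^sub>0 nat) \<Rightarrow> nat" where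
  "total_degree m = (\<Sum>v\<in>keys m. lookup m v)"

lemma total_degree_superset: "finite U \<Longrightarrow> keys m \<subseteq> U \<Longrightarrow> total_degree m = (\<Sum>v\<in>U. lookup m v)"
  unfolding total_degree_def by (rule sum.mono_neutral_left) (auto simp: in_keys_iff)

lemma total_degree_0 [simp]: "total_degree 0 = 0"
  by (simp add: total_degree_def)

lemma total_degree_single [simp]: "total_degree (single v k) = k"
  by (simp add: total_degree_def)

lemma total_degree_add: "total_degree (a + b) = total_degree a + total_degree b"
proof -
  let ?U = "keys a \<union> keys b"
  have "keys (a + b) \<subseteq> ?U" by (rule Poly_Mapping.keys_add)
  then have "total_degree (a + b) = (\<Sum>v\<in>?U. lookup (a + b) v)"
    by (intro total_degree_superset) auto
  then show ?thesis
    by (simp add: total_degree_superset[of ?U a] total_degree_superset[of ?U b] lookup_add sum.distrib)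
qed

lemma exponent_split: "v \<in> keys m \<Longrightarrow> \<exists>m'. m = single v (1 :: nat) + m'"
  by (rule exI[of _ "m - single v 1"], rule poly_mapping_eqI)
     (auto simp: lookup_add lookup_minus lookup_single when_def in_keys_iff)

lemma keys_add_nat: "keys (a + b) = keys a \<union> keys (b :: 'v \<Rightarrow>\<^sub>0 nat)"
  by (auto simp: in_keys_iff lookup_add)

lemma exponent_induct [consumes 1, case_names zero add]:
  assumes "keys m \<subseteq> V" "P 0"
    and "\<And>v m. v \<in> V \<Longrightarrow> keys m \<subseteq> V \<Longrightarrow> P m \<Longrightarrow> P (single v 1 + m)"
  shows "P (m :: 'v \<Rightarrow>\<^sub>0 nat)"
  using assms(1)
proof (induction "total_degree m" arbitrary: m)
  case 0
  then have "m = 0" by (auto simp: total_degree_def in_keys_iff intro!: poly_mapping_eqI)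
  then show ?case using assms(2) by simp
next
  case (Suc d)
  then have "keys m \<noteq> {}" by (auto simp: total_degree_def)
  then obtain v where v: "v \<in> keys m" by blast
  from exponent_split[OF v] obtain m' where m': "m = single v 1 + m'" ..
  have "total_degree m' = d" "keys m' \<subseteq> V" "v \<in> V"
    using Suc.hyps(2) Suc.prems by (simp_all add: m' total_degree_add keys_add_nat)
  then show ?case using Suc.hyps(1)[of m'] assms(3) m' by simp
qed

lemma polys_induct_monomial [consumes 1, case_names monomial add]:
  assumes p: "p \<in> polys V"
    and m: "\<And>c m. keys m \<subseteq> V \<Longrightarrow> P (const c * monomial m)"
    and a: "\<And>p q. p \<in> polys V \<Longrightarrow> q \<in> polys V \<Longrightarrow> P p \<Longrightarrow> P q \<Longrightarrow> P (p + q)"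
  shows "P (p :: ('v, 'k::field) mpoly)"
proof -
  have "P (\<Sum>m\<in>X. const (lookup p m) * monomial m)" if "finite X" "\<forall>m\<in>X. keys m \<subseteq> V" for X
    using that
  proof (induction X rule: finite_induct)
    case empty
    then show ?case using m[of 0 0] by simp
  next
    case (insert k X)
    have "P (\<Sum>m\<in>X. const (lookup p m) * monomial m)"
      using insert by simp
    moreover have "(\<Sum>m\<in>X. const (lookup p m) * monomial m) \<in> polys V"
      using insert.prems by (intro polys_sum polys_mult) simp_all
    ultimately have "P (const (lookup p k) * monomial k + (\<Sum>m\<in>X. const (lookup p m) * monomial m))"
      using insert.prems by (intro a[OF _ _ m]) simp_all
    then show ?case using insert by simp
  qed
  from this[of "keys p"] show ?thesis
    using p mpoly_eq_sum_monomials[of p] by (simp add: polys_def)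
qed

text \<open>Multiplying by one variable at a time reduces statements about substitutions and divided
  differences to their behaviour on constants, sums and a single product rule.\<close>

lemma polys_induct [consumes 1, case_names const add var]:
  assumes p: "p \<in> polys V"
    and c: "\<And>c. P (const c)"
    and a: "\<And>p q. p \<in> polys V \<Longrightarrow> q \<in> polys V \<Longrightarrow> P p \<Longrightarrow> P q \<Longrightarrow> P (p + q)"
    and v: "\<And>v p. v \<in> V \<Longrightarrow> p \<in> polys V \<Longrightarrow> P p \<Longrightarrow> P (var v * p)"
  shows "P (p :: ('v, 'k::field) mpoly)"
  using p
proof (induction p rule: polys_induct_monomial)
  case (monomial b m)
  then show ?case
  proof (induction m rule: exponent_induct)
    case zero
    then show ?case using c by simp
  next
    case (add w m)
    then have "P (var w * (const b * monomial m))"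
      using v[of w "const b * monomial m"] by simp
    then show ?case by (simp add: monomial_add var_def mult_ac)
  qed
qed (rule a)

lemma lookup_monomial_mult_add [simp]:
  "lookup (monomial a * p) (a + m) = lookup (p :: ('v, 'k::field) mpoly) m"
  using polys_UNIV[of p]
proof (induction p rule: polys_induct_monomial)
  case (monomial c k)
  have "monomial a * (const c * monomial k) = single (a + k) c" "const c * monomial k = single k c"
    by (simp_all add: const_def monomial_def mult_single)
  then show ?case by (simp add: lookup_single)
qed (simp add: lookup_add distrib_left)

lemma keys_monomial_mult:
  "keys (monomial a * p) = (+) a ` keys (p :: ('v, 'k::field) mpoly)"
proof
  show "keys (monomial a * p) \<subseteq> (+) a ` keys p"
    using Poly_Mapping.keys_mult[of "monomial a" p] by auto
qed (auto simp: in_keys_iff)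

text \<open>Multiplication by a monomial merely translates exponents. Differences of variables are
  later reduced to this case by a change of coordinates.\<close>

lemma monomial_mult_cancel: "monomial a * p = monomial a * q \<longleftrightarrow> p = (q :: ('v, 'k::field) mpoly)"
proof
  assume "monomial a * p = monomial a * q"
  then show "p = q"
    using lookup_monomial_mult_add[of a p] lookup_monomial_mult_add[of a q]
    by (intro poly_mapping_eqI) simp
qed simp

lemma var_mult_cancel [simp]: "var v * p = var v * q \<longleftrightarrow> p = (q :: ('v, 'k::field) mpoly)"
  by (simp add: var_def monomial_mult_cancel)

lemma polys_var_mult_cancel:
  "var v * p \<in> polys V \<Longrightarrow> p \<in> polys V"
  by (simp add: polys_def var_def keys_monomial_mult keys_add_nat del: One_nat_def)

section \<open>Substitution homomorphisms\<close>

definition subst_monomial :: "('v \<Rightarrow> ('w, 'k::field) mpoly) \<Rightarrow> ('v \<Rightarrow>\<^sub>0 nat) \<Rightarrow> ('w, 'k) mpoly" where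
  "subst_monomial g m = (\<Prod>v\<in>keys m. g v ^ lookup m v)"

definition subst :: "('v \<Rightarrow> ('w, 'k::field) mpoly) \<Rightarrow> ('v, 'k) mpoly \<Rightarrow> ('w, 'k) mpoly" where
  "subst g p = (\<Sum>m\<in>keys p. const (lookup p m) * subst_monomial g m)"

lemma subst_monomial_superset:
  "finite U \<Longrightarrow> keys m \<subseteq> U \<Longrightarrow> subst_monomial g m = (\<Prod>v\<in>U. g v ^ lookup m v)"
  unfolding subst_monomial_def by (rule prod.mono_neutral_left) (auto simp: in_keys_iff)

lemma subst_monomial_add: "subst_monomial g (a + b) = subst_monomial g a * subst_monomial g b"
proof -
  let ?U = "keys a \<union> keys b"
  have "subst_monomial g (a + b) = (\<Prod>v\<in>?U. g v ^ lookup (a + b) v)"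
    by (intro subst_monomial_superset) (auto simp: keys_add_nat)
  then show ?thesis
    by (simp add: subst_monomial_superset[of ?U a] subst_monomial_superset[of ?U b]
        lookup_add power_add prod.distrib)
qed

lemma subst_superset:
  "finite U \<Longrightarrow> keys p \<subseteq> U \<Longrightarrow> subst g p = (\<Sum>m\<in>U. const (lookup p m) * subst_monomial g m)"
  unfolding subst_def by (rule sum.mono_neutral_left) (auto simp: in_keys_iff)

lemma subst_add [simp]: "subst g (p + q) = subst g p + subst g q"
proof -
  let ?U = "keys p \<union> keys q"
  have "subst g (p + q) = (\<Sum>m\<in>?U. const (lookup (p + q) m) * subst_monomial g m)"
    using Poly_Mapping.keys_add[of p q] by (intro subst_superset) auto
  then show ?thesis
    by (simp add: subst_superset[of ?U p] subst_superset[of ?U q] lookup_add const_add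
        distrib_right sum.distrib)
qed

lemma subst_const_monomial: "subst g (const c * monomial m) = const c * subst_monomial g m"
proof (cases "c = 0")
  case False
  then have "keys (single m c) = {m}" by simp
  then show ?thesis by (simp add: subst_def single_conv_const_monomial[symmetric])
qed (simp add: subst_def)

lemma subst_monomial_0 [simp]: "subst_monomial g 0 = 1"
  by (simp add: subst_monomial_def)

lemma subst_const [simp]: "subst g (const c) = const c"
  using subst_const_monomial[of g c 0] by simp

lemma subst_monomial [simp]: "subst g (monomial m) = subst_monomial g m"
  using subst_const_monomial[of g 1 m] by simp

lemma subst_var [simp]: "subst g (var v) = g v"
  by (simp add: var_def subst_monomial_def)

lemma subst_0 [simp]: "subst g 0 = 0" and subst_1 [simp]: "subst g 1 = 1"
  using subst_const[of g 0] subst_const[of g 1] by simp_all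

lemma subst_mult [simp]: "subst g (p * q) = subst g p * subst g q"
  using polys_UNIV[of p]
proof (induction p rule: polys_induct_monomial)
  case (monomial c m)
  show ?case
    using polys_UNIV[of q]
  proof (induction q rule: polys_induct_monomial)
    case (monomial d k)
    have "const c * monomial m * (const d * monomial k) = const (c * d) * monomial (m + k)"
      by (simp add: const_mult monomial_add)
    then show ?case
      by (simp only: subst_const_monomial subst_monomial_add) (simp add: const_mult)
  qed (simp add: distrib_left)
qed (simp add: distrib_right)

lemma subst_uminus [simp]: "subst g (- p) = - subst g p"
  using subst_add[of g p "- p"] by (simp add: add_eq_0_iff del: subst_add)

lemma subst_diff [simp]: "subst g (p - q) = subst g p - subst g q"
  using subst_add[of g p "- q"] by simp

lemma subst_sum [simp]: "subst g (\<Sum>x\<in>X. f x) = (\<Sum>x\<in>X. subst g (f x))"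
  by (induction X rule: infinite_finite_induct) auto

lemma subst_subst: "subst g (subst h p) = subst (\<lambda>v. subst g (h v)) p"
  using polys_UNIV[of p] by (induction p rule: polys_induct) auto

lemma subst_cong: "p \<in> polys V \<Longrightarrow> (\<And>v. v \<in> V \<Longrightarrow> g v = h v) \<Longrightarrow> subst g p = subst h p"
  by (induction p rule: polys_induct) auto

lemma subst_id [simp]: "subst var p = p"
  using polys_UNIV[of p] by (induction p rule: polys_induct) auto

lemma subst_polys: "p \<in> polys V \<Longrightarrow> (\<And>v. v \<in> V \<Longrightarrow> g v \<in> polys W) \<Longrightarrow> subst g p \<in> polys W"
  by (induction p rule: polys_induct) auto

lemma rename_vars_eq_subst: "rename_vars f p = subst (\<lambda>v. var (f v)) p"
  unfolding rename_vars_def subst_def push_exponent_def subst_monomial_def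
  by (intro sum.cong refl)
     (simp add: single_conv_const_monomial monomial_sum var_power)

lemma subst_var_monomial: "subst_monomial (\<lambda>v. var (f v)) m = monomial (push_exponent f m)"
  by (simp add: subst_monomial_def push_exponent_def monomial_sum var_power)

lemma monomial_inj: "(monomial a :: ('v, 'k::field) mpoly) = monomial b \<longleftrightarrow> a = b"
  by (metis keys_monomial singleton_inject)

lemma push_exponent_add:
  fixes f :: "'v \<Rightarrow> 'w"
  shows "push_exponent f (a + b) = push_exponent f a + push_exponent f b"
  \<comment> \<open>The identity of exponents is read off from the multiplicativity of substitution
    on monomials; any field of coefficients serves, here \<open>rat\<close>.\<close>
  using subst_monomial_add[of "\<lambda>v. var (f v) :: ('w, rat) mpoly" a b]
  by (simp add: subst_var_monomial monomial_add[symmetric] monomial_inj)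

lemma push_exponent_single [simp]: "push_exponent f (single v k) = single (f v) k"
  by (simp add: push_exponent_def)

lemma push_exponent_0 [simp]: "push_exponent f 0 = 0"
  by (simp add: push_exponent_def)

section \<open>Ideals of polynomial rings\<close>

lemma ring_mpoly_ring: "ring (mpoly_ring V :: ('v, 'k::field) mpoly ring)"
  using mpoly_ring_cring by (rule cring.axioms(1))

lemma ideal_mpoly_ringI:
  assumes "I \<subseteq> polys V" "0 \<in> I"
    and "\<And>x y. x \<in> I \<Longrightarrow> y \<in> I \<Longrightarrow> x + y \<in> I"
    and mult: "\<And>r x. r \<in> polys V \<Longrightarrow> x \<in> I \<Longrightarrow> r * x \<in> I"
  shows "ideal I (mpoly_ring V :: ('v, 'k::field) mpoly ring)"
proof -
  interpret cring "mpoly_ring V :: ('v, 'k) mpoly ring" by (rule mpoly_ring_cring)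
  have neg: "- x \<in> I" if "x \<in> I" for x
    using mult[of "- 1" x] that by simp
  have multr: "x * r \<in> I" if "r \<in> polys V" "x \<in> I" for r x
    using mult[OF that] by (simp add: mult.commute)
  have "inv\<^bsub>add_monoid (mpoly_ring V)\<^esub> x \<in> I" if "x \<in> I" for x
  proof -
    have "inv\<^bsub>add_monoid (mpoly_ring V)\<^esub> x = - x"
      using assms(1) that by (intro add.inv_equality[of "- x" x, unfolded a_inv_def]) auto
    then show ?thesis using neg that by simp
  qed
  then show ?thesis
    using assms multr by (intro idealI subgroup.intro ring_axioms) auto
qed

context
  fixes I :: "('v, 'k::field) mpoly set" and V
  assumes I: "ideal I (mpoly_ring V)"
begin

lemma ideal_subset_polys: "x \<in> I \<Longrightarrow> x \<in> polys V"
  using ideal.Icarr[OF I] by simp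

lemma ideal_zero: "0 \<in> I"
  using additive_subgroup.zero_closed[OF ideal.axioms(1)[OF I]] by simp

lemma ideal_add: "x \<in> I \<Longrightarrow> y \<in> I \<Longrightarrow> x + y \<in> I"
  using additive_subgroup.a_closed[OF ideal.axioms(1)[OF I], of x y] by simp

lemma ideal_mult: "r \<in> polys V \<Longrightarrow> x \<in> I \<Longrightarrow> r * x \<in> I"
  using ideal.I_l_closed[OF I, of x r] by simp

lemma ideal_mult_right: "r \<in> polys V \<Longrightarrow> x \<in> I \<Longrightarrow> x * r \<in> I"
  using ideal_mult[of r x] by (simp add: mult.commute)

lemma ideal_uminus: "x \<in> I \<Longrightarrow> - x \<in> I"
  using ideal_mult[of "- 1" x] by simp

lemma ideal_diff: "x \<in> I \<Longrightarrow> y \<in> I \<Longrightarrow> x - y \<in> I"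
  using ideal_add[of x "- y"] ideal_uminus by simp

lemma ideal_sum: "(\<And>i. i \<in> X \<Longrightarrow> f i \<in> I) \<Longrightarrow> (\<Sum>i\<in>X. f i) \<in> I"
  by (induction X rule: infinite_finite_induct) (auto simp: ideal_zero ideal_add)

end

lemma Idl_ideal: "X \<subseteq> polys V \<Longrightarrow> ideal (Idl\<^bsub>mpoly_ring V\<^esub> X) (mpoly_ring V :: ('v, 'k::field) mpoly ring)"
  using ring.genideal_ideal[OF ring_mpoly_ring] by simp

lemma Idl_generator: "X \<subseteq> polys V \<Longrightarrow> x \<in> X \<Longrightarrow> x \<in> Idl\<^bsub>(mpoly_ring V :: ('v, 'k::field) mpoly ring)\<^esub> X"
  using ring.genideal_self[OF ring_mpoly_ring, of X V] by auto

lemma Idl_minimal: "ideal I (mpoly_ring V) \<Longrightarrow> X \<subseteq> I \<Longrightarrow> Idl\<^bsub>(mpoly_ring V :: ('v, 'k::field) mpoly ring)\<^esub> X \<subseteq> I"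
  by (rule ring.genideal_minimal[OF ring_mpoly_ring])

lemma mem_ideal_sum:
  "x \<in> I <+>\<^bsub>mpoly_ring V\<^esub> J \<longleftrightarrow> (\<exists>a\<in>I. \<exists>b\<in>J. x = a + (b :: ('v, 'k::field) mpoly))"
  by (auto simp: set_add_def')

lemma ideal_sum_ideal:
  "ideal I (mpoly_ring V) \<Longrightarrow> ideal J (mpoly_ring V) \<Longrightarrow>
    ideal (I <+>\<^bsub>mpoly_ring V\<^esub> J) (mpoly_ring V :: ('v, 'k::field) mpoly ring)"
  by (rule ring.add_ideals[OF ring_mpoly_ring])

lemma subst_kernel_ideal: "ideal {p \<in> polys V. subst g p = 0} (mpoly_ring V :: ('v, 'k::field) mpoly ring)"
  by (rule ideal_mpoly_ringI) auto

lemma subst_preimage_ideal: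
  assumes "ideal I (mpoly_ring W)" "\<And>v. v \<in> V \<Longrightarrow> g v \<in> polys W"
  shows "ideal {p \<in> polys V. subst g p \<in> I} (mpoly_ring V :: ('v, 'k::field) mpoly ring)"
  using assms
  by (intro ideal_mpoly_ringI)
     (auto simp: ideal_zero[OF assms(1)] ideal_add[OF assms(1)] ideal_mult[OF assms(1)] subst_polys)

text \<open>Each variable is congruent to its image, and congruence modulo an ideal respects sums
  and products. This identifies kernels of substitutions.\<close>

lemma diff_subst_mem_ideal:
  assumes I: "ideal I (mpoly_ring V)" and p: "p \<in> polys V"
    and g: "\<And>v. v \<in> V \<Longrightarrow> g v \<in> polys V \<and> var v - g v \<in> I"
  shows "p - subst g p \<in> I"
  using p
proof (induction p rule: polys_induct)
  case (const c)
  show ?case using ideal_zero[OF I] by simp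
next
  case (add p q)
  have "p + q - subst g (p + q) = (p - subst g p) + (q - subst g q)" by simp
  then show ?case using add ideal_add[OF I] by metis
next
  case (var v p)
  have "var v * p - subst g (var v * p) = p * (var v - g v) + g v * (p - subst g p)"
    by (simp add: algebra_simps)
  then show ?case
    using var g ideal_add[OF I] ideal_mult[OF I] by metis
qed

subsection \<open>Monomial ideals\<close>

text \<open>The polynomials satisfying the divisibility condition form an ideal containing the
  generators; conversely each of their terms is a multiple of a generator. Membership can thus be
  tested on single monomials.\<close>

lemma mem_Idl_monomials:
  assumes M: "\<forall>m\<in>M. keys m \<subseteq> V"
  shows "p \<in> Idl\<^bsub>(mpoly_ring V :: ('v, 'k::field) mpoly ring)\<^esub> (monomial ` M) \<longleftrightarrow>
    p \<in> polys V \<and> (\<forall>k\<in>keys p. \<exists>m\<in>M. \<exists>m'. k = m + m')"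
    (is "_ \<in> ?I \<longleftrightarrow> _ \<and> ?Q p")
proof -
  have sub: "monomial ` M \<subseteq> (polys V :: ('v, 'k) mpoly set)" using M by auto
  note I = Idl_ideal[OF sub]
  have "ideal {p \<in> polys V. ?Q p} (mpoly_ring V :: ('v, 'k) mpoly ring)"
  proof (rule ideal_mpoly_ringI)
    fix x y :: "('v, 'k) mpoly" assume "x \<in> {p \<in> polys V. ?Q p}" "y \<in> {p \<in> polys V. ?Q p}"
    then show "x + y \<in> {p \<in> polys V. ?Q p}"
      using Poly_Mapping.keys_add[of x y] by auto
  next
    fix r x :: "('v, 'k) mpoly" assume r: "r \<in> polys V" and x: "x \<in> {p \<in> polys V. ?Q p}"
    have "?Q (r * x)"
    proof
      fix k assume "k \<in> keys (r * x)"
      then obtain a b where ab: "k = a + b" "b \<in> keys x" using keys_mult[of r x] by blast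
      then obtain m m' where "m \<in> M" "b = m + m'" using x by blast
      then show "\<exists>m\<in>M. \<exists>m'. k = m + m'"
        using ab by (intro bexI[of _ m] exI[of _ "a + m'"]) (auto simp: ac_simps)
    qed
    then show "r * x \<in> {p \<in> polys V. ?Q p}" using r x by simp
  qed auto
  moreover have "monomial ` M \<subseteq> {p \<in> (polys V :: ('v, 'k) mpoly set). ?Q p}"
    using M by (auto intro!: exI[of _ 0])
  ultimately have "?I \<subseteq> {p \<in> polys V. ?Q p}" by (rule Idl_minimal)
  moreover have "p \<in> ?I" if p: "p \<in> polys V" "?Q p"
  proof -
    have "const (lookup p k) * monomial k \<in> ?I" if k: "k \<in> keys p" for k
    proof -
      obtain m m' where m: "m \<in> M" "k = m + m'" using p k by blast
      have "keys k \<subseteq> V" using p(1) k by (auto simp: polys_def)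
      then have "keys m' \<subseteq> V" by (simp add: m(2) keys_add_nat)
      then have "(const (lookup p k) * monomial m') * monomial m \<in> ?I"
        using m sub by (intro ideal_mult[OF I] Idl_generator[OF sub]) auto
      then show ?thesis by (simp add: m(2) monomial_add mult_ac)
    qed
    then show ?thesis
      using ideal_sum[OF I, of "keys p" "\<lambda>k. const (lookup p k) * monomial k"]
        mpoly_eq_sum_monomials[of p] by simp
  qed
  ultimately show ?thesis by blast
qed

lemma monomial_ideal_ideal: "monomial_ideal V I \<Longrightarrow> ideal I (mpoly_ring V)"
  unfolding monomial_ideal_def by (auto intro!: Idl_ideal)

lemma monomial_ideal_mem_iff:
  assumes "monomial_ideal V I"
  shows "p \<in> I \<longleftrightarrow> p \<in> polys V \<and> (\<forall>k\<in>keys p. monomial k \<in> I)"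
proof -
  obtain M where M: "\<forall>m\<in>M. keys m \<subseteq> V" and I: "I = Idl\<^bsub>mpoly_ring V\<^esub> (monomial ` M)"
    using assms by (auto simp: monomial_ideal_def)
  show ?thesis
    unfolding I mem_Idl_monomials[OF M] by (auto simp: polys_def)
qed

lemma squarefree_monomial_idealD: "squarefree_monomial_ideal V I \<Longrightarrow> monomial_ideal V I"
  unfolding squarefree_monomial_ideal_def monomial_ideal_def by blast

section \<open>Differences of variables\<close>

text \<open>The coordinate change taking \<open>a\<close> to \<open>a + b\<close> turns the
  difference into a variable, which cancels; the inverse change recovers \<open>p\<close>.\<close>

lemma var_diff_mult_eq_0:
  fixes p :: "('v, 'k::field) mpoly"
  assumes "a \<noteq> b" "(var a - var b) * p = 0"
  shows "p = 0"
proof -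
  let ?s = "subst (var(a := var a + var b)) :: ('v, 'k) mpoly \<Rightarrow> _"
  let ?t = "subst (var(a := var a - var b)) :: ('v, 'k) mpoly \<Rightarrow> _"
  have "?s ((var a - var b) * p) = var a * ?s p"
    using assms(1) by simp
  then have "var a * ?s p = var a * 0" using assms(2) by simp
  then have "?s p = 0" by (simp only: var_mult_cancel)
  then have "?t (?s p) = 0" by simp
  moreover have "?t (?s p) = subst var p"
    unfolding subst_subst using assms(1) by (intro subst_cong[of _ UNIV]) auto
  ultimately show ?thesis by simp
qed

abbreviation pair_diff :: "'v \<times> 'v \<Rightarrow> ('v, 'k::field) mpoly" where
  "pair_diff e \<equiv> var (fst e) - var (snd e)"

text \<open>From left to right, the second component of each pair has not occurred before: the pairs
  are the edges of a forest in the order of its growth, and identifying the ends of an edge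
  eliminates a new variable.\<close>

fun fresh_pairs :: "('v \<times> 'v) list \<Rightarrow> bool" where
  "fresh_pairs [] \<longleftrightarrow> True"
| "fresh_pairs (e # ps) \<longleftrightarrow> snd e \<noteq> fst e \<and> fst e \<notin> snd ` set ps \<and> snd e \<notin> snd ` set ps \<and> fresh_pairs ps"

lemma fresh_pairs_append:
  "fresh_pairs (ps @ qs) \<longleftrightarrow>
    fresh_pairs ps \<and> fresh_pairs qs \<and> (fst ` set ps \<union> snd ` set ps) \<inter> snd ` set qs = {}"
  by (induction ps) auto

lemma snd_zip_tl: "snd ` set (zip xs (tl xs)) \<subseteq> set (tl xs)"
  by (auto dest: set_zip_rightD)

lemma fresh_pairs_zip_tl: "distinct xs \<Longrightarrow> fresh_pairs (zip xs (tl xs))"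
proof (induction xs)
  case (Cons x xs)
  show ?case
  proof (cases xs)
    case (Cons y ys)
    then show ?thesis
      using Cons.IH Cons.prems snd_zip_tl[of xs] by auto
  qed simp
qed simp

lemma fresh_pairs_concat:
  assumes "distinct is" "\<And>i. i \<in> set is \<Longrightarrow> distinct (vs i)"
    and "\<And>i j. i \<in> set is \<Longrightarrow> j \<in> set is \<Longrightarrow> i \<noteq> j \<Longrightarrow> set (vs i) \<inter> set (vs j) = {}"
  shows "fresh_pairs (concat (map (\<lambda>i. zip (vs i) (tl (vs i))) is))"
  using assms
proof (induction "is")
  case (Cons i "is")
  let ?qs = "concat (map (\<lambda>i. zip (vs i) (tl (vs i))) is)"
  have "set (vs i) \<inter> snd ` set ?qs = {}"
  proof (intro equals0I)
    fix w assume w: "w \<in> set (vs i) \<inter> snd ` set ?qs"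
    then obtain j where j: "j \<in> set is" "w \<in> set (tl (vs j))"
      using snd_zip_tl by fastforce
    then have "w \<in> set (vs j)" by (metis list.sel(2) list.set_sel(2))
    then show False using w j(1) Cons.prems by auto
  qed
  moreover have "fst ` set (zip (vs i) (tl (vs i))) \<union> snd ` set (zip (vs i) (tl (vs i))) \<subseteq> set (vs i)"
    by (auto dest: set_zip_leftD set_zip_rightD) (metis list.sel(2) list.set_sel(2) set_zip_rightD)
  ultimately show ?case
    using Cons fresh_pairs_zip_tl[of "vs i"] by (simp add: fresh_pairs_append) blast
qed simp

lemma pair_diffs_polys:
  "set ps \<subseteq> V \<times> V \<Longrightarrow> pair_diff ` set ps \<subseteq> (polys V :: ('v, 'k::field) mpoly set)"
  by auto

lemma Idl_mono: "X \<subseteq> Y \<Longrightarrow> Y \<subseteq> polys V \<Longrightarrow> 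
  Idl\<^bsub>(mpoly_ring V :: ('v, 'k::field) mpoly ring)\<^esub> X \<subseteq> Idl\<^bsub>mpoly_ring V\<^esub> Y"
  using Idl_generator[of Y V] by (intro Idl_minimal Idl_ideal) auto

text \<open>\<open>f\<close> sends a variable to the root of its tree in the forest of pairs, so it
  presents \<open>k[V]\<close> modulo the differences as a polynomial ring. The last two clauses
  ensure that a further fresh pair has distinct representatives.\<close>

lemma pair_representatives:
  fixes ps :: "('v \<times> 'v) list"
  assumes "fresh_pairs ps" "set ps \<subseteq> V \<times> V"
  shows "\<exists>f. (\<forall>v\<in>V. f v \<in> V \<and>
                var v - var (f v) \<in> Idl\<^bsub>(mpoly_ring V :: ('v, 'k::field) mpoly ring)\<^esub> (pair_diff ` set ps)) \<and>
             (\<forall>e\<in>set ps. f (fst e) = f (snd e)) \<and>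
             (\<forall>v. v \<notin> snd ` set ps \<longrightarrow> f v = v) \<and> (\<forall>v. f v = v \<or> f v \<in> fst ` set ps)"
  using assms
proof (induction ps rule: rev_induct)
  case Nil
  have "ideal (Idl\<^bsub>(mpoly_ring V :: ('v, 'k) mpoly ring)\<^esub> {}) (mpoly_ring V)"
    by (rule Idl_ideal) simp
  then show ?case by (intro exI[of _ id]) (auto simp: ideal_zero)
next
  case (snoc e ps)
  obtain v w where e: "e = (v, w)" by force
  let ?I = "Idl\<^bsub>(mpoly_ring V :: ('v, 'k) mpoly ring)\<^esub> (pair_diff ` set ps)"
  let ?I' = "Idl\<^bsub>(mpoly_ring V :: ('v, 'k) mpoly ring)\<^esub> (pair_diff ` set (ps @ [e]))"
  have I': "ideal ?I' (mpoly_ring V)"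
    by (intro Idl_ideal pair_diffs_polys snoc.prems)
  have sub: "?I \<subseteq> ?I'"
    by (rule Idl_mono[OF _ pair_diffs_polys[OF snoc.prems(2)]]) auto
  have fr: "fresh_pairs ps" "w \<noteq> v" "w \<notin> fst ` set ps" "w \<notin> snd ` set ps"
    using snoc.prems(1) by (auto simp: fresh_pairs_append e)
  have V: "v \<in> V" "w \<in> V" "set ps \<subseteq> V \<times> V" using snoc.prems(2) by (auto simp: e)
  obtain f where f: "\<And>v. v \<in> V \<Longrightarrow> f v \<in> V" "\<And>v. v \<in> V \<Longrightarrow> var v - var (f v) \<in> ?I"
    "\<And>e. e \<in> set ps \<Longrightarrow> f (fst e) = f (snd e)"
    "\<And>v. v \<notin> snd ` set ps \<Longrightarrow> f v = v" "\<And>v. f v = v \<or> f v \<in> fst ` set ps"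
    using snoc.IH[OF fr(1) V(3)] by blast
  have "(var v - var (f v)) - (var v - var w) \<in> ?I'"
  proof (rule ideal_diff[OF I'])
    show "var v - var (f v) \<in> ?I'" using f(2)[OF V(1)] sub by blast
    have "pair_diff e \<in> ?I'" by (rule Idl_generator[OF pair_diffs_polys[OF snoc.prems(2)]]) simp
    then show "var v - var w \<in> ?I'" by (simp add: e)
  qed
  then have "var w - var (f v) \<in> ?I'" by simp
  moreover have "(f(w := f v)) u = u \<or> (f(w := f v)) u \<in> fst ` set (ps @ [e])" for u
    using f(5)[of u] f(5)[of v] by (cases "u = w") (auto simp: e)
  ultimately show ?case
    using f V fr sub
    by (intro exI[of _ "f(w := f v)"] conjI ballI allI impI)
       (auto simp: e subset_iff image_iff simp del: insert_iff)
qed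

text \<open>Substituting representatives has the ideal of the earlier differences as its kernel, and
  it sends the new difference to a difference of two distinct variables.\<close>

lemma var_diff_regular_mod_pair_diffs:
  fixes g :: "('v, 'k::field) mpoly"
  assumes fr: "fresh_pairs (ps @ [e])" and V: "set (ps @ [e]) \<subseteq> V \<times> V" and g: "g \<in> polys V"
    and mem: "g * pair_diff e \<in> Idl\<^bsub>mpoly_ring V\<^esub> (pair_diff ` set ps)" (is "_ \<in> ?I")
  shows "g \<in> Idl\<^bsub>mpoly_ring V\<^esub> (pair_diff ` set ps)"
proof -
  have V': "set ps \<subseteq> V \<times> V" "fresh_pairs ps"
    using V fr by (auto simp: fresh_pairs_append)
  obtain f where f: "\<And>v. v \<in> V \<Longrightarrow> f v \<in> V" "\<And>v. v \<in> V \<Longrightarrow> var v - var (f v) \<in> ?I"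
    "\<And>e. e \<in> set ps \<Longrightarrow> f (fst e) = f (snd e)"
    "\<And>v. v \<notin> snd ` set ps \<Longrightarrow> f v = v" "\<And>v. f v = v \<or> f v \<in> fst ` set ps"
    using pair_representatives[OF V'(2,1), where ?'k = 'k] by blast
  let ?s = "subst (\<lambda>v. var (f v)) :: ('v, 'k) mpoly \<Rightarrow> _"
  have I: "ideal ?I (mpoly_ring V)" by (intro Idl_ideal pair_diffs_polys V')
  have "?I \<subseteq> {p \<in> polys V. ?s p = 0}"
    using V' f(3) by (intro Idl_minimal subst_kernel_ideal) auto
  then have "?s (g * pair_diff e) = 0" using mem by blast
  then have zero: "(var (f (fst e)) - var (f (snd e))) * ?s g = 0" by (simp add: mult.commute)
  have "f (fst e) \<noteq> f (snd e)"
  proof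
    have ne: "snd e \<notin> fst ` set ps" "snd e \<notin> snd ` set ps" "snd e \<noteq> fst e"
      using fr by (auto simp: fresh_pairs_append)
    assume "f (fst e) = f (snd e)"
    then have eq: "f (fst e) = snd e" using f(4)[OF ne(2)] by simp
    from f(5)[of "fst e"] show False unfolding eq using ne by blast
  qed
  then have "?s g = 0" using zero by (rule var_diff_mult_eq_0)
  moreover have "g - ?s g \<in> ?I"
    using f by (intro diff_subst_mem_ideal[OF I g]) auto
  ultimately show ?thesis by simp
qed

section \<open>Divided differences\<close>

definition shift :: "'v set \<Rightarrow> 'v \<Rightarrow> ('v, 'k::field) mpoly \<Rightarrow> ('v, 'k) mpoly" where
  "shift A a = subst (\<lambda>v. if v \<in> A then var v - var a else var v)"

lemma shift_hom:
  "shift A a (f + g) = shift A a f + shift A a g" "shift A a (f - g) = shift A a f - shift A a g"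
  "shift A a (f * g) = shift A a f * shift A a g" "shift A a (const c) = const c"
  "shift A a 0 = 0" "shift A a 1 = 1"
  "shift A a (var v) = (if v \<in> A then var v - var a else var v)"
  by (simp_all add: shift_def)

text \<open>For \<open>a\<close> in \<open>A\<close> and v = y - t_v on \<open>A\<close>, this is
  (f(y) - f(t_a)) / (y - t_a), since \<open>var a\<close> is y - t_a. It is unique because a
  variable cancels.\<close>

definition shift_quotient :: "'v set \<Rightarrow> 'v \<Rightarrow> ('v, 'k::field) mpoly \<Rightarrow> ('v, 'k) mpoly" where
  "shift_quotient A a f = (THE g. f = shift A a f + var a * g)"

lemma shift_quotient_eqI: "f = shift A a f + var a * g \<Longrightarrow> shift_quotient A a f = g"
  unfolding shift_quotient_def
  by (rule the_equality) (assumption, metis add_left_cancel var_mult_cancel)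

lemma shift_quotient: "f = shift A a f + var a * shift_quotient A a (f :: ('v, 'k::field) mpoly)"
proof -
  have "\<exists>g. f = shift A a f + var a * g"
    using polys_UNIV[of f]
  proof (induction f rule: polys_induct)
    case (const c)
    show ?case by (intro exI[of _ 0]) (simp add: shift_hom)
  next
    case (add p q)
    then obtain g h where "p = shift A a p + var a * g" "q = shift A a q + var a * h" by blast
    then have "p + q = (shift A a p + var a * g) + (shift A a q + var a * h)" by simp
    also have "\<dots> = shift A a (p + q) + var a * (g + h)"
      by (simp only: shift_hom distrib_left ac_simps)
    finally have "p + q = shift A a (p + q) + var a * (g + h)" .
    then show ?case ..
  next
    case (var v p)
    then obtain g where g: "p = shift A a p + var a * g" by blast
    show ?case
    proof (cases "v \<in> A")
      case True
      have "var v * (shift A a p + var a * g) = shift A a (var v * p) + var a * (shift A a p + var v * g)"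
        using True by (simp add: shift_hom algebra_simps)
      then show ?thesis using g by metis
    next
      case False
      have "var v * (shift A a p + var a * g) = shift A a (var v * p) + var a * (var v * g)"
        using False by (simp add: shift_hom algebra_simps)
      then show ?thesis using g by metis
    qed
  qed
  then show ?thesis using shift_quotient_eqI by metis
qed

lemma shift_quotient_0 [simp]: "shift_quotient A a 0 = 0"
  by (rule shift_quotient_eqI) (simp add: shift_hom)

lemma shift_quotient_1 [simp]: "shift_quotient A a 1 = 0"
  by (rule shift_quotient_eqI) (simp add: shift_hom)

lemma shift_quotient_add:
  "shift_quotient A a (f + g) = shift_quotient A a f + shift_quotient A a g"
proof (rule shift_quotient_eqI)
  have "f + g = (shift A a f + var a * shift_quotient A a f) + (shift A a g + var a * shift_quotient A a g)"
    using shift_quotient[of f A a] shift_quotient[of g A a] by simp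
  also have "\<dots> = shift A a (f + g) + var a * (shift_quotient A a f + shift_quotient A a g)"
    by (simp only: shift_hom distrib_left ac_simps)
  finally show "f + g = shift A a (f + g) + var a * (shift_quotient A a f + shift_quotient A a g)" .
qed

lemma shift_quotient_mult:
  assumes "shift A a t = t"
  shows "shift_quotient A a (t * f) = t * shift_quotient A a f"
proof (rule shift_quotient_eqI)
  have "t * f = t * (shift A a f + var a * shift_quotient A a f)"
    using shift_quotient[of f A a] by simp
  also have "\<dots> = shift A a t * shift A a f + var a * (t * shift_quotient A a f)"
    unfolding assms by (simp only: distrib_left mult_ac)
  also have "shift A a t * shift A a f = shift A a (t * f)"
    by (simp only: shift_hom)
  finally show "t * f = shift A a (t * f) + var a * (t * shift_quotient A a f)" .
qed

text \<open>The Leibniz rule for divided differences: for \<open>a\<close> in \<open>A\<close>,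
  \<open>var v - var a\<close> is the value of \<open>var v\<close> at y = t_a. For
  \<open>v = a\<close> the factor is simply removed.\<close>

lemma shift_quotient_var_mult:
  assumes "v \<in> A"
  shows "shift_quotient A a (var v * f) = f + (var v - var a) * shift_quotient A a f"
proof (rule shift_quotient_eqI)
  have eq: "var a * shift_quotient A a f = f - shift A a f"
    using shift_quotient[of f A a] by (simp add: algebra_simps)
  have "shift A a (var v * f) + var a * (f + (var v - var a) * shift_quotient A a f) =
      (var v - var a) * shift A a f + var a * f + (var v - var a) * (var a * shift_quotient A a f)"
    using assms by (simp add: shift_hom algebra_simps)
  also have "\<dots> = var v * f"
    unfolding eq by (simp add: algebra_simps)
  finally show "var v * f = shift A a (var v * f) + var a * (f + (var v - var a) * shift_quotient A a f)" ..
qed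

lemma shift_polys: "f \<in> polys V \<Longrightarrow> a \<in> V \<Longrightarrow> shift A a f \<in> polys V"
  unfolding shift_def by (rule subst_polys) auto

lemma shift_quotient_polys: "f \<in> polys V \<Longrightarrow> a \<in> V \<Longrightarrow> shift_quotient A a f \<in> polys V"
proof -
  assume f: "f \<in> polys V" "a \<in> V"
  have "var a * shift_quotient A a f = f - shift A a f"
    using shift_quotient[of f A a] by (simp add: algebra_simps)
  then show ?thesis using f shift_polys polys_diff polys_var_mult_cancel by metis
qed

text \<open>If the elements of \<open>A\<close> are written as \<open>v = y - t\<^sub>v\<close>, then \<open>shift A a\<close> is the evaluation
  of a polynomial in \<open>y\<close> at \<open>y = t\<^sub>a\<close>, and \<open>divided_difference A L\<close> is its divided difference at the
  points \<open>t\<^sub>a\<close> for \<open>a\<close> in \<open>L\<close>.\<close>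

fun divided_difference :: "'v set \<Rightarrow> 'v list \<Rightarrow> ('v, 'k::field) mpoly \<Rightarrow> ('v, 'k) mpoly" where
  "divided_difference A [] f = 0"
| "divided_difference A [a] f = shift A a f"
| "divided_difference A (a # b # L) f = divided_difference A (b # L) (shift_quotient A a f)"

lemma divided_difference_Cons:
  "L \<noteq> [] \<Longrightarrow> divided_difference A (a # L) f = divided_difference A L (shift_quotient A a f)"
  by (cases L) auto

lemma divided_difference_add:
  "divided_difference A L (f + g) = divided_difference A L f + divided_difference A L g"
  by (induction A L f arbitrary: g rule: divided_difference.induct)
     (simp_all add: shift_quotient_add, simp add: shift_hom)

text \<open>These polynomials do not involve y and act as scalars for the divided difference.
  Examples are differences of elements of \<open>A\<close> and polynomials in variables outside
  \<open>A\<close>.\<close>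

definition shift_invariant :: "'v set \<Rightarrow> ('v, 'k::field) mpoly \<Rightarrow> bool" where
  "shift_invariant A t \<longleftrightarrow> (\<forall>a\<in>A. shift A a t = t)"

lemma divided_difference_mult:
  "shift_invariant A t \<Longrightarrow> set L \<subseteq> A \<Longrightarrow> divided_difference A L (t * f) = t * divided_difference A L f"
proof (induction A L f rule: divided_difference.induct)
  case (2 A a f)
  then show ?case by (simp add: shift_hom shift_invariant_def)
next
  case (3 A a b L f)
  have "shift_quotient A a (t * f) = t * shift_quotient A a f"
    using 3 by (intro shift_quotient_mult) (auto simp: shift_invariant_def)
  then show ?case using 3 by simp
qed simp

lemma divided_difference_polys:
  "f \<in> polys V \<Longrightarrow> set L \<subseteq> V \<Longrightarrow> divided_difference A L f \<in> polys V"
  by (induction A L f rule: divided_difference.induct) (auto simp: shift_polys shift_quotient_polys)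

lemma divided_difference_0 [simp]: "divided_difference A L 0 = 0"
  by (induction A L "0 :: ('a, 'b) mpoly" rule: divided_difference.induct) (auto simp: shift_def)

abbreviation var_prod :: "'v list \<Rightarrow> ('v, 'k::field) mpoly" where
  "var_prod vs \<equiv> (\<Prod>v\<leftarrow>vs. var v)"

text \<open>The Leibniz rule with \<open>v = a\<close> shows that the quotient of
  \<open>var a * f\<close> at the node of \<open>a\<close> is \<open>f\<close>, so every leading
  factor uses up its own node.\<close>

lemma divided_difference_take:
  "k < length L \<Longrightarrow> set L \<subseteq> A \<Longrightarrow>
    divided_difference A L (var_prod (take k L) * f) = divided_difference A (drop k L) f"
proof (induction L arbitrary: k)
  case (Cons a L)
  show ?case
  proof (cases k)
    case (Suc j)
    then have "L \<noteq> []" using Cons.prems by auto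
    then show ?thesis
      using Cons Suc by (simp add: divided_difference_Cons shift_quotient_var_mult mult.assoc)
  qed simp
qed simp

text \<open>All nodes but the last are used up, and evaluation at the last one kills the remaining
  factor. This is the source of the vanishing of the residue on \<open>C\<close>.\<close>

lemma divided_difference_var_prod_mult:
  assumes "set L \<subseteq> A"
  shows "divided_difference A L (var_prod L * f) = 0"
proof (cases L rule: rev_cases)
  case (snoc M a)
  then have "divided_difference A L (var_prod (take (length M) L) * (var a * f)) =
      divided_difference A [a] (var a * f)"
    using divided_difference_take[of "length M" L A "var a * f"] assms by simp
  also have "\<dots> = 0" using assms snoc by (simp add: shift_hom)
  finally show ?thesis by (simp add: snoc mult.assoc)
qed simp

text \<open>A product of variables of \<open>A\<close> is monic in y, and a divided difference at l
  nodes reads off the coefficient of y^(l-1) as long as the degree is below l.\<close>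

lemma divided_difference_var_prod:
  assumes "set L \<subseteq> A" "set M \<subseteq> A" "length M < length L"
  shows "divided_difference A L (var_prod M :: ('v, 'k::field) mpoly) = (if Suc (length M) = length L then 1 else 0)"
  using assms
proof (induction L arbitrary: M)
  case (Cons a L)
  show ?case
  proof (cases "L = []")
    case True
    then show ?thesis using Cons.prems by (simp add: shift_hom)
  next
    case False
    show ?thesis
      using Cons.prems(2,3)
    proof (induction M)
      case Nil
      then show ?case using False by (simp add: divided_difference_Cons)
    next
      case (Cons v M)
      have "shift A b (var v - var a) = var v - var a" for b
        using Cons.prems \<open>set (a # L) \<subseteq> A\<close> by (simp add: shift_hom)
      then have inv: "shift_invariant A (var v - var a :: ('v, 'k) mpoly)"
        unfolding shift_invariant_def by blast
      \<comment> \<open>The Leibniz rule leaves one summand with a node and a factor less, and one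
        with only a factor less, whose coefficient \<open>var v - var a\<close> is a scalar.\<close>
      have "divided_difference A (a # L) (var_prod (v # M) :: ('v, 'k) mpoly) =
          divided_difference A L (var_prod M) +
          (var v - var a) * divided_difference A (a # L) (var_prod M)"
        using False Cons.prems \<open>set (a # L) \<subseteq> A\<close>
        by (simp add: divided_difference_Cons shift_quotient_var_mult divided_difference_add
            divided_difference_mult[OF inv])
      then show ?case
        using Cons.prems Cons.IH \<open>set (a # L) \<subseteq> A\<close>
          \<open>\<And>M. set L \<subseteq> A \<Longrightarrow> set M \<subseteq> A \<Longrightarrow> length M < length L \<Longrightarrow> _ M\<close>[of M]
        by simp
    qed
  qed
qed simp

text \<open>For \<open>j \<le> k\<close> the first product uses up \<open>j\<close> nodes, leaving
  length L - k - 1 factors on length L - j nodes, which is the critical number exactly for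
  \<open>j = k\<close>. For \<open>j > k\<close> the two products together contain all of
  \<open>L\<close>.\<close>

lemma divided_difference_dual:
  assumes "set L \<subseteq> A" "j < length L" "k < length L"
  shows "divided_difference A L (var_prod (take j L) * var_prod (drop (Suc k) L) :: ('v, 'k::field) mpoly) = (if j = k then 1 else 0)"
proof (cases "j \<le> k")
  case True
  then show ?thesis
    using assms set_drop_subset[of j L] set_drop_subset[of "Suc k" L]
    by (auto simp: divided_difference_take intro!: divided_difference_var_prod[THEN trans])
next
  case False
  then have "take j L = take (Suc k) L @ drop (Suc k) (take j L)"
    by (metis Suc_leI append_take_drop_id linorder_not_le min.absorb1 take_take)
  then have j: "(var_prod (take j L) :: ('v, 'k) mpoly) = var_prod (take (Suc k) L) * var_prod (drop (Suc k) (take j L))"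
    by (metis map_append prod_list.append)
  have L: "(var_prod L :: ('v, 'k) mpoly) = var_prod (take (Suc k) L) * var_prod (drop (Suc k) L)"
    by (metis append_take_drop_id map_append prod_list.append)
  have "var_prod (take j L) * var_prod (drop (Suc k) L) = (var_prod L :: ('v, 'k) mpoly) * var_prod (drop (Suc k) (take j L))"
    by (subst j, subst L) (simp only: mult_ac)
  then show ?thesis using False assms by (simp add: divided_difference_var_prod_mult)
qed

lemma polys_shift_invariant:
  assumes "t \<in> polys W" "W \<inter> A = {}"
  shows "shift_invariant A t"
proof -
  have "shift A a t = subst var t" for a
    unfolding shift_def using assms(2) by (intro subst_cong[OF assms(1)]) auto
  then show ?thesis by (simp add: shift_invariant_def)
qed

section \<open>The complete intersection of block products\<close>

lemma var_prod_polys: "set L \<subseteq> W \<Longrightarrow> var_prod L \<in> polys W"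
  by (rule polys_prod_list) auto

inductive_set submodule_span :: "('v, 'k::field) mpoly set \<Rightarrow> ('v, 'k) mpoly set \<Rightarrow> ('v, 'k) mpoly set"
  for T G where
  zero: "0 \<in> submodule_span T G"
| gen: "g \<in> G \<Longrightarrow> g \<in> submodule_span T G"
| add: "x \<in> submodule_span T G \<Longrightarrow> y \<in> submodule_span T G \<Longrightarrow> x + y \<in> submodule_span T G"
| scale: "t \<in> T \<Longrightarrow> x \<in> submodule_span T G \<Longrightarrow> t * x \<in> submodule_span T G"

locale variable_blocks =
  fixes V :: "'v set" and n :: nat and \<pi> :: "'v \<Rightarrow> nat" and vs :: "nat \<Rightarrow> 'v list"
    and C :: "('v, 'k::field) mpoly set"
  assumes C_eq: "C = Idl\<^bsub>mpoly_ring V\<^esub> ((\<lambda>i. var_prod (vs i)) ` {1..n})"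
    and distinct_vs: "i \<in> {1..n} \<Longrightarrow> distinct (vs i)"
    and set_vs: "i \<in> {1..n} \<Longrightarrow> set (vs i) = {v \<in> V. \<pi> v = i}"
    and vs_nonempty: "i \<in> {1..n} \<Longrightarrow> vs i \<noteq> []"
    and \<pi>_range: "v \<in> V \<Longrightarrow> \<pi> v \<in> {1..n}"
begin

definition base :: "nat \<Rightarrow> 'v" where "base i = hd (vs i)"

text \<open>The retraction of S onto T, namely evaluation at y_i = 0 in every block. With T as its
  set of fixed points, closure under the ring operations is immediate.\<close>

definition collapse :: "('v, 'k) mpoly \<Rightarrow> ('v, 'k) mpoly" where
  "collapse = subst (\<lambda>v. if v \<in> V then var v - var (base (\<pi> v)) else var v)"

text \<open>The \<open>k\<close>-subalgebra generated by the differences \<open>v - w\<close> within the blocks.\<close>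

definition T :: "('v, 'k) mpoly set" where
  "T = {t \<in> polys V. collapse t = t}"

lemma base_mem: "i \<in> {1..n} \<Longrightarrow> base i \<in> set (vs i)"
  unfolding base_def using vs_nonempty by simp

lemma base_V: "i \<in> {1..n} \<Longrightarrow> base i \<in> V" and \<pi>_base: "i \<in> {1..n} \<Longrightarrow> \<pi> (base i) = i"
  using base_mem set_vs by auto

lemma vs_subset: "i \<in> {1..n} \<Longrightarrow> set (vs i) \<subseteq> V"
  using set_vs by auto

lemma collapse_hom:
  "collapse (f + g) = collapse f + collapse g" "collapse (f * g) = collapse f * collapse g"
  "collapse (f - g) = collapse f - collapse g" "collapse (const c) = const c"
  "collapse 0 = 0" "collapse 1 = 1"
  by (simp_all add: collapse_def)

lemma collapse_polys: "f \<in> polys V \<Longrightarrow> collapse f \<in> polys V"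
  unfolding collapse_def by (rule subst_polys) (use base_V \<pi>_range in auto)

lemma collapse_collapse: "f \<in> polys V \<Longrightarrow> collapse (collapse f) = collapse f"
  unfolding collapse_def subst_subst
  by (rule subst_cong) (auto simp: base_V \<pi>_base \<pi>_range[simplified] \<pi>_range)

lemma collapse_T: "f \<in> polys V \<Longrightarrow> collapse f \<in> T"
  by (simp add: T_def collapse_polys collapse_collapse)

lemma T_polys: "t \<in> T \<Longrightarrow> t \<in> polys V"
  by (simp add: T_def)

lemma T_closed:
  "const c \<in> T" "0 \<in> T" "1 \<in> T" "s \<in> T \<Longrightarrow> t \<in> T \<Longrightarrow> s + t \<in> T"
  "s \<in> T \<Longrightarrow> t \<in> T \<Longrightarrow> s - t \<in> T" "s \<in> T \<Longrightarrow> t \<in> T \<Longrightarrow> s * t \<in> T"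
  by (simp_all add: T_def collapse_hom)

lemma T_uminus: "t \<in> T \<Longrightarrow> - t \<in> T"
  using T_closed(5)[OF T_closed(2), of t] by simp

lemma T_sum: "(\<And>x. x \<in> X \<Longrightarrow> f x \<in> T) \<Longrightarrow> (\<Sum>x\<in>X. f x) \<in> T"
  by (induction X rule: infinite_finite_induct) (auto simp: T_closed)

lemma var_diff_T: "v \<in> V \<Longrightarrow> w \<in> V \<Longrightarrow> \<pi> v = \<pi> w \<Longrightarrow> var v - var w \<in> T"
  by (simp add: T_def collapse_def)

lemma collapse_shift_invariant:
  assumes i: "i \<in> {1..n}" and f: "f \<in> polys V"
  shows "shift_invariant (set (vs i)) (collapse f)"
  unfolding shift_invariant_def
proof
  fix a assume "a \<in> set (vs i)"
  show "shift (set (vs i)) a (collapse f) = collapse f"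
    unfolding shift_def collapse_def subst_subst
    by (rule subst_cong[OF f])
       (use i base_V \<pi>_base \<pi>_range in \<open>auto simp: set_vs\<close>)
qed

lemma T_shift_invariant: "i \<in> {1..n} \<Longrightarrow> t \<in> T \<Longrightarrow> shift_invariant (set (vs i)) t"
  using collapse_shift_invariant[of i t] by (simp add: T_def)

definition \<alpha> :: "nat \<Rightarrow> nat" where "\<alpha> i = length (vs i)"

lemma \<alpha>_pos: "i \<in> {1..n} \<Longrightarrow> 0 < \<alpha> i"
  using vs_nonempty by (simp add: \<alpha>_def)

lemma C_generators_polys: "(\<lambda>i. var_prod (vs i)) ` {1..n} \<subseteq> (polys V :: ('v, 'k) mpoly set)"
  by (rule image_subsetI) (rule var_prod_polys[OF vs_subset])

lemma C_ideal: "ideal C (mpoly_ring V)"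
  unfolding C_eq by (rule Idl_ideal[OF C_generators_polys])

lemma C_generator: "i \<in> {1..n} \<Longrightarrow> f \<in> polys V \<Longrightarrow> var_prod (vs i) * f \<in> C"
  by (rule ideal_mult_right[OF C_ideal])
     (simp, unfold C_eq, rule Idl_generator[OF C_generators_polys], rule imageI)

primrec block_residue :: "nat list \<Rightarrow> ('v, 'k) mpoly \<Rightarrow> ('v, 'k) mpoly" where
  "block_residue [] f = f"
| "block_residue (i # is) f = block_residue is (divided_difference (set (vs i)) (vs i) f)"

lemma block_residue_add: "block_residue is (f + g) = block_residue is f + block_residue is g"
  by (induction "is" arbitrary: f g) (simp_all add: divided_difference_add)

lemma block_residue_mult:
  "(\<And>i. i \<in> set is \<Longrightarrow> shift_invariant (set (vs i)) t) \<Longrightarrow> block_residue is (t * f) = t * block_residue is f"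
  by (induction "is" arbitrary: f) (simp_all add: divided_difference_mult)

lemma block_residue_0: "block_residue is 0 = 0"
  by (induction "is") simp_all

lemma block_residue_polys:
  "set is \<subseteq> {1..n} \<Longrightarrow> f \<in> polys V \<Longrightarrow> block_residue is f \<in> polys V"
  by (induction "is" arbitrary: f) (use vs_subset in \<open>auto intro!: divided_difference_polys\<close>)

lemma block_disjoint: "i \<in> {1..n} \<Longrightarrow> j \<in> {1..n} \<Longrightarrow> i \<noteq> j \<Longrightarrow> set (vs i) \<inter> set (vs j) = {}"
  using set_vs by auto

text \<open>The divided differences of other blocks treat the product of block \<open>i\<close> as a
  scalar, so it survives until its own block kills it.\<close>

lemma block_residue_var_prod:
  "set is \<subseteq> {1..n} \<Longrightarrow> i \<in> set is \<Longrightarrow> block_residue is (var_prod (vs i) * f) = 0"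
proof (induction "is" arbitrary: f)
  case (Cons j "is")
  show ?case
  proof (cases "j = i")
    case True
    then show ?thesis by (simp add: divided_difference_var_prod_mult block_residue_0)
  next
    case False
    have "i \<in> {1..n}" "j \<in> {1..n}" using Cons.prems by auto
    then have "shift_invariant (set (vs j)) (var_prod (vs i) :: ('v, 'k) mpoly)"
      using False block_disjoint[of i j]
      by (intro polys_shift_invariant[where W = "set (vs i)"] polys_prod_list) auto
    then show ?thesis using False Cons by (simp add: divided_difference_mult)
  qed
qed simp

text \<open>The factors from the remaining blocks are scalars for the block being processed, so the
  residue of such a product factors over the blocks.\<close>

lemma block_residue_prod:
  assumes "distinct is" "set is \<subseteq> {1..n}"
    and "\<And>i. i \<in> set is \<Longrightarrow> b i \<in> polys (set (vs i))"
    and "\<And>i. i \<in> set is \<Longrightarrow> divided_difference (set (vs i)) (vs i) (b i) = const (c i)"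
  shows "block_residue is (\<Prod>i\<in>set is. b i) = const (\<Prod>i\<in>set is. c i)"
  using assms
proof (induction "is")
  case (Cons j "is")
  let ?p = "\<Prod>i\<in>set is. b i"
  have "b i \<in> polys (\<Union>i\<in>set is. set (vs i))" if "i \<in> set is" for i
    using Cons.prems(3)[of i] that by (auto intro: polys_mono)
  then have "?p \<in> polys (\<Union>i\<in>set is. set (vs i))" by (rule polys_prod)
  moreover have "set (vs i) \<inter> set (vs j) = {}" if "i \<in> set is" for i
    by (rule block_disjoint) (use Cons.prems(1,2) that in auto)
  then have "(\<Union>i\<in>set is. set (vs i)) \<inter> set (vs j) = {}" by blast
  ultimately have inv: "shift_invariant (set (vs j)) ?p" by (rule polys_shift_invariant)
  have "block_residue (j # is) (\<Prod>i\<in>set (j # is). b i) =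
      block_residue is (divided_difference (set (vs j)) (vs j) (?p * b j))"
    using Cons.prems(1) by (simp add: mult.commute)
  also have "\<dots> = block_residue is (const (c j) * ?p)"
    unfolding divided_difference_mult[OF inv subset_refl]
    using Cons.prems(4)[of j] by (simp add: mult.commute)
  also have "\<dots> = const (c j) * block_residue is ?p"
    by (rule block_residue_mult) (auto simp: shift_invariant_def shift_hom)
  finally show ?case using Cons by (simp add: const_mult)
qed simp

text \<open>The final \<open>collapse\<close> places the value in \<open>T\<close> by construction;
  being multiplicative and the identity on \<open>T\<close>, it preserves
  \<open>T\<close>-linearity.\<close>

definition residue :: "('v, 'k) mpoly \<Rightarrow> ('v, 'k) mpoly" where
  "residue f = collapse (block_residue [1..<Suc n] f)"

lemma residue_add: "residue (f + g) = residue f + residue g"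
  by (simp add: residue_def block_residue_add collapse_hom)

lemma residue_mult: "t \<in> T \<Longrightarrow> residue (t * f) = t * residue f"
proof -
  assume t: "t \<in> T"
  have "block_residue [1..<Suc n] (t * f) = t * block_residue [1..<Suc n] f"
    using t by (intro block_residue_mult T_shift_invariant) auto
  then show ?thesis using t by (simp add: residue_def collapse_hom T_def)
qed

lemma residue_T: "f \<in> polys V \<Longrightarrow> residue f \<in> T"
  unfolding residue_def by (intro collapse_T block_residue_polys) auto

lemma residue_uminus: "residue (- f) = - residue f"
  using residue_mult[OF T_uminus[OF T_closed(3)], of f] by simp

lemma residue_diff: "residue (f - g) = residue f - residue g"
  using residue_add[of f "- g"] by (simp add: residue_uminus)

lemma residue_0 [simp]: "residue 0 = 0"
  by (simp add: residue_def block_residue_0 collapse_hom)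

lemma residue_sum: "residue (\<Sum>x\<in>X. f x) = (\<Sum>x\<in>X. residue (f x))"
  by (induction X rule: infinite_finite_induct) (simp_all add: residue_add)

text \<open>The residue is linear only over \<open>T\<close>. Demanding that all multiples vanish
  gives an ideal of S, so that only the generators of \<open>C\<close> remain to be tested.\<close>

lemma residue_kernel_ideal: "ideal {f \<in> polys V. \<forall>g\<in>polys V. residue (f * g) = 0} (mpoly_ring V)"
proof (rule ideal_mpoly_ringI)
  fix r x :: "('v, 'k) mpoly"
  assume "r \<in> polys V" "x \<in> {f \<in> polys V. \<forall>g\<in>polys V. residue (f * g) = 0}"
  then show "r * x \<in> {f \<in> polys V. \<forall>g\<in>polys V. residue (f * g) = 0}"
    by (auto simp: mult.assoc mult.left_commute[of r x])
qed (auto simp: distrib_right residue_add)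

lemma residue_C: "f \<in> C \<Longrightarrow> residue f = 0"
proof -
  assume f: "f \<in> C"
  have "C \<subseteq> {f \<in> polys V. \<forall>g\<in>polys V. residue (f * g) = 0}"
    unfolding C_eq
  proof (intro Idl_minimal residue_kernel_ideal image_subsetI)
    fix i assume "i \<in> {1..n}"
    then show "var_prod (vs i) \<in> {f \<in> polys V. \<forall>g\<in>polys V. residue (f * g) = 0}"
      using C_generators_polys block_residue_var_prod[of "[1..<Suc n]" i]
      by (auto simp: residue_def collapse_hom atLeastLessThanSuc_atLeastAtMost simp del: upt_Suc)
  qed
  with f have "f \<in> {f \<in> polys V. \<forall>g\<in>polys V. residue (f * g) = 0}" ..
  then have "\<forall>g\<in>polys V. residue (f * g) = 0" by simp
  from this[rule_format, OF polys_1] show ?thesis by simp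
qed

definition E :: "(nat \<Rightarrow> nat) set" where
  "E = (\<Pi>\<^sub>E i\<in>{1..n}. {..<\<alpha> i})"

text \<open>The two families are bases of \<open>S/C\<close> over \<open>T\<close>, dual to each other with respect to the residue.\<close>

definition N :: "(nat \<Rightarrow> nat) \<Rightarrow> ('v, 'k) mpoly" where
  "N e = (\<Prod>i\<in>{1..n}. var_prod (take (e i) (vs i)))"

definition H :: "(nat \<Rightarrow> nat) \<Rightarrow> ('v, 'k) mpoly" where
  "H e = (\<Prod>i\<in>{1..n}. var_prod (drop (Suc (e i)) (vs i)))"

lemma finite_E: "finite E"
  by (simp add: E_def finite_PiE)

lemma N_polys: "N e \<in> polys V" and H_polys: "H e \<in> polys V"
  unfolding N_def H_def
  by (intro polys_prod var_prod_polys;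
      meson order_trans set_take_subset set_drop_subset vs_subset)+

lemma residue_dual:
  assumes e: "e \<in> E" "e' \<in> E"
  shows "residue (N e * H e') = (if e = e' then 1 else 0)"
proof -
  let ?b = "\<lambda>i. var_prod (take (e i) (vs i)) * var_prod (drop (Suc (e' i)) (vs i)) :: ('v, 'k) mpoly"
  let ?c = "\<lambda>i. if e i = e' i then 1 else 0 :: 'k"
  have "block_residue [1..<Suc n] (\<Prod>i\<in>set [1..<Suc n]. ?b i) = const (\<Prod>i\<in>set [1..<Suc n]. ?c i)"
  proof (rule block_residue_prod)
    fix i assume "i \<in> set [1..<Suc n]"
    then have i: "i \<in> {1..n}" by auto
    show "?b i \<in> polys (set (vs i))"
      by (intro polys_mult var_prod_polys set_take_subset set_drop_subset)
    have "e i < length (vs i)" "e' i < length (vs i)"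
      using e i by (auto simp: E_def \<alpha>_def)
    then show "divided_difference (set (vs i)) (vs i) (?b i) = const (?c i)"
      using divided_difference_dual[of "vs i" "set (vs i)" "e i" "e' i", where ?'k = 'k]
      by (cases "e i = e' i") simp_all
  qed auto
  moreover have set: "set [1..<Suc n] = {1..n}" by auto
  moreover have "(\<Prod>i\<in>{1..n}. ?c i) = (if e = e' then 1 else 0)"
  proof (cases "e = e'")
    case False
    then obtain i where "i \<in> {1..n}" "e i \<noteq> e' i"
      using e unfolding E_def by (metis PiE_ext)
    then show ?thesis using False by (auto intro!: prod_zero)
  qed simp
  ultimately have "block_residue [1..<Suc n] (N e * H e') = const (if e = e' then 1 else 0)"
    unfolding N_def H_def by (simp only: set prod.distrib)
  then show ?thesis by (simp add: residue_def collapse_hom split: if_splits)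
qed

lemma submodule_span_eq_polys:
  assumes G: "G \<subseteq> polys V" and C: "C \<subseteq> G" and one: "1 \<in> submodule_span T G"
    and var: "\<And>v g. v \<in> V \<Longrightarrow> g \<in> G \<Longrightarrow> var v * g \<in> submodule_span T G"
    and f: "f \<in> polys V"
  shows "f \<in> submodule_span T G"
proof -
  have closed: "var v * x \<in> submodule_span T G" if "v \<in> V" "x \<in> submodule_span T G" for v x
    using that(2)
  proof (induction rule: submodule_span.induct)
    case (scale t x)
    then have "t * (var v * x) \<in> submodule_span T G" by (auto intro: submodule_span.scale)
    then show ?case by (simp only: mult.left_commute[of "var v" t x])
  qed (auto simp: var that(1) submodule_span.zero distrib_left intro: submodule_span.add)
  show ?thesis
    using f
  proof (induction f rule: polys_induct)
    case (const c)
    then show ?case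
      using submodule_span.scale[OF T_closed(1) one] by simp
  qed (auto simp: closed intro: submodule_span.add)
qed

text \<open>Since \<open>var v * g = var a * g + (var v - var a) * g\<close>, all variables of a
  block act alike up to \<open>T\<close>. Hence one well-chosen variable \<open>a\<close> per factor
  suffices: it has to lead to another factor of the family or complete the block product.\<close>

lemma block_family_spans:
  fixes F :: "nat \<Rightarrow> nat \<Rightarrow> ('v, 'k) mpoly"
  assumes F: "\<And>i k. i \<in> {1..n} \<Longrightarrow> F i k \<in> polys V"
    and one: "\<And>i. i \<in> {1..n} \<Longrightarrow> \<exists>k<\<alpha> i. F i k = 1"
    and step: "\<And>i k. i \<in> {1..n} \<Longrightarrow> k < \<alpha> i \<Longrightarrow>
      \<exists>a\<in>set (vs i). var a * F i k = var_prod (vs i) \<or> (\<exists>l<\<alpha> i. var a * F i k = F i l)"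
    and f: "f \<in> polys V"
  shows "f \<in> submodule_span T ((\<lambda>e. \<Prod>i\<in>{1..n}. F i (e i)) ` E \<union> C)" (is "_ \<in> submodule_span T ?G")
proof (rule submodule_span_eq_polys[OF _ _ _ _ f])
  show "?G \<subseteq> polys V"
    using F ideal_subset_polys[OF C_ideal] by (auto intro!: polys_prod)
  show "C \<subseteq> ?G" by simp
  obtain e where e: "\<And>i. i \<in> {1..n} \<Longrightarrow> e i < \<alpha> i \<and> F i (e i) = 1" using one by metis
  have eq: "1 = (\<Prod>i\<in>{1..n}. F i (restrict e {1..n} i))"
    using e by (intro prod.neutral[symmetric]) auto
  have "restrict e {1..n} \<in> E" using e by (auto simp: E_def)
  with eq have "1 \<in> ?G" by (intro UnI1 image_eqI)
  then show "1 \<in> submodule_span T ?G" by (rule submodule_span.gen)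
next
  fix v g assume v: "v \<in> V" and g: "g \<in> ?G"
  show "var v * g \<in> submodule_span T ?G"
  proof (cases "g \<in> C")
    case True
    then have "var v * g \<in> C" using v ideal_mult[OF C_ideal, of "var v" g] by simp
    then show ?thesis by (intro submodule_span.gen) simp
  next
    case False
    then obtain e where e: "e \<in> E" "g = (\<Prod>i\<in>{1..n}. F i (e i))" using g by auto
    define i where "i = \<pi> v"
    have i: "i \<in> {1..n}" using v \<pi>_range by (simp add: i_def)
    then have "e i < \<alpha> i" using e by (auto simp: E_def)
    then obtain a where a: "a \<in> set (vs i)"
      "var a * F i (e i) = var_prod (vs i) \<or> (\<exists>l<\<alpha> i. var a * F i (e i) = F i l)"
      using step[OF i] by blast
    let ?r = "\<Prod>j\<in>{1..n} - {i}. F j (e j)"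
    have g': "g = F i (e i) * ?r" using i e by (simp add: prod.remove)
    have "var a * g \<in> ?G"
      using a(2)
    proof
      assume "var a * F i (e i) = var_prod (vs i)"
      then have "var a * g = var_prod (vs i) * ?r" by (simp add: g' mult.assoc[symmetric])
      moreover have "?r \<in> polys V" by (intro polys_prod F) auto
      ultimately show ?thesis using C_generator[OF i, of ?r] by simp
    next
      assume "\<exists>l<\<alpha> i. var a * F i (e i) = F i l"
      then obtain l where l: "l < \<alpha> i" "var a * F i (e i) = F i l" by blast
      have "(\<Prod>j\<in>{1..n}. F j ((e(i := l)) j)) = F i l * (\<Prod>j\<in>{1..n} - {i}. F j ((e(i := l)) j))"
        using i by (subst prod.remove[of _ i]) auto
      also have "(\<Prod>j\<in>{1..n} - {i}. F j ((e(i := l)) j)) = ?r" by (rule prod.cong) auto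
      finally have "var a * g = (\<Prod>j\<in>{1..n}. F j ((e(i := l)) j))"
        using l(2) by (simp only: g' mult.assoc[symmetric])
      moreover have "e(i := l) \<in> E" using e(1) i l(1) by (auto simp: E_def PiE_def extensional_def)
      ultimately show ?thesis by blast
    qed
    moreover have "g \<in> ?G" by (rule g)
    moreover have "var v - var a \<in> T" using a(1) i v by (intro var_diff_T) (auto simp: set_vs i_def)
    ultimately have "var a * g + (var v - var a) * g \<in> submodule_span T ?G"
      by (intro submodule_span.add submodule_span.scale submodule_span.gen)
    then show ?thesis by (simp add: algebra_simps)
  qed
qed

text \<open>The difference is \<open>T\<close>-linear in \<open>f\<close>, so it suffices to look at
  generators: on \<open>C\<close> the residues vanish, and on \<open>P\<close> duality makes the sum
  collapse.\<close>

lemma dual_expansion: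
  assumes span: "f \<in> submodule_span T (P ` E \<union> C)"
    and P: "\<And>e. P e \<in> polys V" and Q: "\<And>e. Q e \<in> polys V"
    and dual: "\<And>e e'. e \<in> E \<Longrightarrow> e' \<in> E \<Longrightarrow> residue (P e * Q e') = (if e = e' then 1 else 0)"
  shows "f - (\<Sum>e\<in>E. residue (f * Q e) * P e) \<in> C"
  using span
proof (induction rule: submodule_span.induct)
  case zero
  show ?case by (simp add: ideal_zero[OF C_ideal])
next
  case (gen g)
  then show ?case
  proof
    assume "g \<in> C"
    moreover from this have "residue (g * Q e) = 0" for e
      by (intro residue_C ideal_mult_right[OF C_ideal] Q)
    ultimately show ?thesis by simp
  next
    assume "g \<in> P ` E"
    then obtain e where e: "e \<in> E" "g = P e" by blast
    have "(\<Sum>e'\<in>E. residue (g * Q e') * P e') = (\<Sum>e'\<in>E. if e = e' then P e' else 0)"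
      using e dual by (intro sum.cong) auto
    also have "\<dots> = g" using e finite_E by simp
    finally show ?thesis by (simp add: ideal_zero[OF C_ideal])
  qed
next
  case (add x y)
  have eq: "x + y - (\<Sum>e\<in>E. residue ((x + y) * Q e) * P e) =
      (x - (\<Sum>e\<in>E. residue (x * Q e) * P e)) + (y - (\<Sum>e\<in>E. residue (y * Q e) * P e))"
    by (simp add: distrib_right residue_add sum.distrib)
  show ?case unfolding eq by (rule ideal_add[OF C_ideal add.IH])
next
  case (scale t x)
  have eq: "t * x - (\<Sum>e\<in>E. residue (t * x * Q e) * P e) = t * (x - (\<Sum>e\<in>E. residue (x * Q e) * P e))"
    using scale(1) by (simp add: mult.assoc residue_mult sum_distrib_left right_diff_distrib)
  show ?case unfolding eq by (rule ideal_mult[OF C_ideal T_polys[OF scale.hyps(1)] scale.IH])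
qed

lemma N_expansion: "f \<in> polys V \<Longrightarrow> f - (\<Sum>e\<in>E. residue (f * H e) * N e) \<in> C"
proof (rule dual_expansion[OF _ N_polys H_polys residue_dual])
  assume f: "f \<in> polys V"
  have "f \<in> submodule_span T ((\<lambda>e. \<Prod>i\<in>{1..n}. var_prod (take (e i) (vs i))) ` E \<union> C)"
  proof (rule block_family_spans[OF _ _ _ f])
    fix i assume i: "i \<in> {1..n}"
    show "var_prod (take k (vs i)) \<in> polys V" for k
      using vs_subset[OF i] by (intro var_prod_polys) (auto dest: in_set_takeD)
    show "\<exists>k<\<alpha> i. var_prod (take k (vs i)) = (1 :: ('v, 'k) mpoly)"
      using \<alpha>_pos[OF i] by (intro exI[of _ 0]) simp
    fix k assume k: "k < \<alpha> i"
    \<comment> \<open>The next variable lengthens an initial product by one factor; from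
      \<open>k = \<alpha> i - 1\<close> it reaches the block product.\<close>
    have eq: "var (vs i ! k) * var_prod (take k (vs i)) = (var_prod (take (Suc k) (vs i)) :: ('v, 'k) mpoly)"
      using k by (simp add: \<alpha>_def take_Suc_conv_app_nth mult.commute)
    show "\<exists>a\<in>set (vs i). var a * var_prod (take k (vs i)) = (var_prod (vs i) :: ('v, 'k) mpoly) \<or>
      (\<exists>l<\<alpha> i. var a * var_prod (take k (vs i)) = (var_prod (take l (vs i)) :: ('v, 'k) mpoly))"
    proof (intro bexI[of _ "vs i ! k"])
      show "vs i ! k \<in> set (vs i)" using k by (simp add: \<alpha>_def)
    qed (use k eq in \<open>cases "Suc k = \<alpha> i"; auto simp: \<alpha>_def intro!: exI[of _ "Suc k"]\<close>)
  qed
  then show "f \<in> submodule_span T (N ` E \<union> C)" by (simp add: N_def[abs_def])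
qed

lemma H_expansion: "f \<in> polys V \<Longrightarrow> f - (\<Sum>e\<in>E. residue (f * N e) * H e) \<in> C"
proof (rule dual_expansion[OF _ H_polys N_polys])
  show "residue (H e * N e') = (if e = e' then 1 else 0)" if "e \<in> E" "e' \<in> E" for e e'
    using residue_dual[OF that(2,1)] by (auto simp: mult.commute)
  assume f: "f \<in> polys V"
  have "f \<in> submodule_span T ((\<lambda>e. \<Prod>i\<in>{1..n}. var_prod (drop (Suc (e i)) (vs i))) ` E \<union> C)"
  proof (rule block_family_spans[OF _ _ _ f])
    fix i assume i: "i \<in> {1..n}"
    show "var_prod (drop (Suc k) (vs i)) \<in> polys V" for k
      using vs_subset[OF i] by (intro var_prod_polys) (auto dest: in_set_dropD)
    show "\<exists>k<\<alpha> i. var_prod (drop (Suc k) (vs i)) = (1 :: ('v, 'k) mpoly)"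
      using \<alpha>_pos[OF i] by (intro exI[of _ "\<alpha> i - 1"]) (simp add: \<alpha>_def)
    fix k assume k: "k < \<alpha> i"
    \<comment> \<open>The variable just before a final product lengthens it to the left; from
      \<open>k = 0\<close> it reaches the block product.\<close>
    have eq: "var (vs i ! k) * var_prod (drop (Suc k) (vs i)) = (var_prod (drop k (vs i)) :: ('v, 'k) mpoly)"
      using k by (simp add: \<alpha>_def Cons_nth_drop_Suc[symmetric])
    show "\<exists>a\<in>set (vs i). var a * var_prod (drop (Suc k) (vs i)) = (var_prod (vs i) :: ('v, 'k) mpoly) \<or>
      (\<exists>l<\<alpha> i. var a * var_prod (drop (Suc k) (vs i)) = (var_prod (drop (Suc l) (vs i)) :: ('v, 'k) mpoly))"
    proof (intro bexI[of _ "vs i ! k"])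
      show "vs i ! k \<in> set (vs i)" using k by (simp add: \<alpha>_def)
    qed (use k eq in \<open>cases k; auto simp: \<alpha>_def intro!: exI[of _ "k - 1"]\<close>)
  qed
  then show "f \<in> submodule_span T (H ` E \<union> C)" by (simp add: H_def[abs_def])
qed

end

section \<open>Regular sequences and freeness\<close>

text \<open>The polynomials in \<open>\<theta>s\<close> over \<open>k\<close>; \<open>d\<close> bounds the depth of the expansion
  \<open>t = t' + \<theta> s\<close> along which the coefficients are shown to vanish.\<close>

fun poly_combinations :: "('v, 'k::field) mpoly list \<Rightarrow> nat \<Rightarrow> ('v, 'k) mpoly set" where
  "poly_combinations [] d = range const"
| "poly_combinations (\<theta> # \<theta>s) 0 = range const"
| "poly_combinations (\<theta> # \<theta>s) (Suc d) =
     {t + \<theta> * s | t s. t \<in> poly_combinations \<theta>s (Suc d) \<and> s \<in> poly_combinations (\<theta> # \<theta>s) d}"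

lemma poly_combinations_0: "poly_combinations \<theta>s 0 = range const"
  by (cases \<theta>s) auto

lemma poly_combinations_SucI:
  "t \<in> poly_combinations \<theta>s (Suc d) \<Longrightarrow> s \<in> poly_combinations (\<theta> # \<theta>s) d \<Longrightarrow>
    t + \<theta> * s \<in> poly_combinations (\<theta> # \<theta>s) (Suc d)"
  by auto

lemma poly_combinations_SucE:
  assumes "x \<in> poly_combinations (\<theta> # \<theta>s) (Suc d)"
  obtains t s where "x = t + \<theta> * s" "t \<in> poly_combinations \<theta>s (Suc d)" "s \<in> poly_combinations (\<theta> # \<theta>s) d"
  using assms by auto

lemma poly_combinations_const: "const c \<in> poly_combinations \<theta>s d"
proof (induction \<theta>s d arbitrary: c rule: poly_combinations.induct)
  case (3 \<theta> \<theta>s d)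
  have "const c + \<theta> * const 0 \<in> poly_combinations (\<theta> # \<theta>s) (Suc d)"
    using 3 unfolding poly_combinations.simps by blast
  then show ?case by simp
qed auto

lemma poly_combinations_zero: "0 \<in> poly_combinations \<theta>s d"
  using poly_combinations_const[of 0] by simp

lemma poly_combinations_add:
  "x \<in> poly_combinations \<theta>s d \<Longrightarrow> y \<in> poly_combinations \<theta>s d \<Longrightarrow> x + y \<in> poly_combinations \<theta>s d"
proof (induction \<theta>s d arbitrary: x y rule: poly_combinations.induct)
  case (3 \<theta> \<theta>s d)
  obtain s t s' t' where *: "x = t + \<theta> * s" "y = t' + \<theta> * s'"
    "t \<in> poly_combinations \<theta>s (Suc d)" "t' \<in> poly_combinations \<theta>s (Suc d)"
    "s \<in> poly_combinations (\<theta> # \<theta>s) d" "s' \<in> poly_combinations (\<theta> # \<theta>s) d"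
    using 3(3,4) by auto
  have "x + y = (t + t') + \<theta> * (s + s')" by (simp add: * algebra_simps)
  moreover have "t + t' \<in> poly_combinations \<theta>s (Suc d)" "s + s' \<in> poly_combinations (\<theta> # \<theta>s) d"
    using 3(1,2) * by blast+
  ultimately show ?case unfolding poly_combinations.simps by blast
qed (auto simp: const_add[symmetric])

lemma poly_combinations_Suc: "poly_combinations \<theta>s d \<subseteq> poly_combinations \<theta>s (Suc d)"
proof (induction \<theta>s d rule: poly_combinations.induct)
  case (2 \<theta> \<theta>s)
  then show ?case using poly_combinations_const[of _ "\<theta> # \<theta>s" "Suc 0"] by auto
next
  case (3 \<theta> \<theta>s d)
  show ?case
  proof
    fix x assume "x \<in> poly_combinations (\<theta> # \<theta>s) (Suc d)"
    then obtain t s where *: "x = t + \<theta> * s"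
      "t \<in> poly_combinations \<theta>s (Suc d)" "s \<in> poly_combinations (\<theta> # \<theta>s) d"
      by (rule poly_combinations_SucE)
    show "x \<in> poly_combinations (\<theta> # \<theta>s) (Suc (Suc d))"
      unfolding *(1) using 3 *(2,3) by (intro poly_combinations_SucI) blast+
  qed
qed simp

lemma poly_combinations_mono: "d \<le> d' \<Longrightarrow> poly_combinations \<theta>s d \<subseteq> poly_combinations \<theta>s d'"
  by (induction rule: dec_induct) (use poly_combinations_Suc in blast)+

lemma poly_combinations_scale:
  "x \<in> poly_combinations \<theta>s d \<Longrightarrow> const c * x \<in> poly_combinations \<theta>s d"
proof (induction \<theta>s d arbitrary: x rule: poly_combinations.induct)
  case (3 \<theta> \<theta>s d)
  obtain s t where *: "x = t + \<theta> * s"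
    "t \<in> poly_combinations \<theta>s (Suc d)" "s \<in> poly_combinations (\<theta> # \<theta>s) d"
    using 3(3) by auto
  have "const c * x = const c * t + \<theta> * (const c * s)" by (simp add: * algebra_simps)
  moreover have "const c * t \<in> poly_combinations \<theta>s (Suc d)" "const c * s \<in> poly_combinations (\<theta> # \<theta>s) d"
    using 3(1,2) * by blast+
  ultimately show ?case unfolding poly_combinations.simps by blast
qed (auto simp: const_mult[symmetric])

lemma poly_combinations_generator_mult:
  "\<theta> \<in> set \<theta>s \<Longrightarrow> x \<in> poly_combinations \<theta>s d \<Longrightarrow> \<theta> * x \<in> poly_combinations \<theta>s (Suc d)"
proof (induction \<theta>s arbitrary: x d)
  case (Cons \<eta> \<theta>s)
  show ?case
  proof (cases "\<theta> = \<eta>")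
    case True
    have "0 + \<eta> * x \<in> poly_combinations (\<eta> # \<theta>s) (Suc d)"
      by (rule poly_combinations_SucI[OF poly_combinations_zero Cons.prems(2)])
    then show ?thesis by (simp add: True)
  next
    case False
    then have \<theta>: "\<theta> \<in> set \<theta>s" using Cons.prems by simp
    show ?thesis
      using Cons.prems(2)
    proof (induction d arbitrary: x)
      case 0
      then have "x \<in> poly_combinations \<theta>s 0" by (simp add: poly_combinations_0)
      then have "\<theta> * x + \<eta> * 0 \<in> poly_combinations (\<eta> # \<theta>s) (Suc 0)"
        by (intro poly_combinations_SucI poly_combinations_zero Cons.IH \<theta>)
      then show ?case by simp
    next
      case (Suc d)
      then obtain t s where *: "x = t + \<eta> * s"
        "t \<in> poly_combinations \<theta>s (Suc d)" "s \<in> poly_combinations (\<eta> # \<theta>s) d"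
        by (elim poly_combinations_SucE)
      have "\<theta> * t + \<eta> * (\<theta> * s) \<in> poly_combinations (\<eta> # \<theta>s) (Suc (Suc d))"
        by (intro poly_combinations_SucI Cons.IH \<theta> Suc.IH *)
      then show ?case by (simp add: * algebra_simps)
    qed
  qed
qed simp

text \<open>A \<open>k\<close>-basis property modulo the whole sequence lifts along the sequence.
  Decreasing induction on \<open>i\<close> treats coefficients in the last differences, modulo
  \<open>J\<close> and the first \<open>i\<close> ones; for \<open>i = length \<theta>s\<close> the
  coefficients are constants.\<close>

lemma regular_sequence_independent:
  fixes J :: "('v, 'k::field) mpoly set"
  assumes J: "ideal J (mpoly_ring V)"
    and reg: "regular_sequence (mpoly_ring V) J \<theta>s"
    and B: "finite B" "\<And>b. b \<in> B \<Longrightarrow> y b \<in> polys V"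
    and indep: "\<And>c. (\<Sum>b\<in>B. const (c b) * y b) \<in> J <+>\<^bsub>mpoly_ring V\<^esub> Idl\<^bsub>mpoly_ring V\<^esub> (set \<theta>s) \<Longrightarrow>
      \<forall>b\<in>B. c b = 0"
    and t: "\<And>b. b \<in> B \<Longrightarrow> t b \<in> poly_combinations \<theta>s d" "(\<Sum>b\<in>B. t b * y b) \<in> J"
    and b: "b \<in> B"
  shows "t b = 0"
proof -
  define I where "I i = J <+>\<^bsub>mpoly_ring V\<^esub> Idl\<^bsub>mpoly_ring V\<^esub> (set (take i \<theta>s))" for i
  have \<theta>s: "set \<theta>s \<subseteq> polys V" using reg by (simp add: regular_sequence_def)
  then have \<theta>i: "set (take i \<theta>s) \<subseteq> polys V" for i using set_take_subset[of i \<theta>s] by blast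
  have I: "ideal (I i) (mpoly_ring V)" for i
    unfolding I_def by (intro ideal_sum_ideal J Idl_ideal \<theta>i)
  have nzd: "g \<in> I i" if "i < length \<theta>s" "g \<in> polys V" "g * \<theta>s ! i \<in> I i" for g i
    using reg that unfolding regular_sequence_def I_def by simp
  have I_Suc: "I i \<subseteq> I (Suc i)" for i
  proof -
    have "Idl\<^bsub>mpoly_ring V\<^esub> (set (take i \<theta>s)) \<subseteq> Idl\<^bsub>mpoly_ring V\<^esub> (set (take (Suc i) \<theta>s))"
      by (rule Idl_mono[OF set_take_subset_set_take \<theta>i]) simp
    then show ?thesis unfolding I_def subset_iff mem_ideal_sum by blast
  qed
  have \<theta>_I: "\<theta>s ! i \<in> I (Suc i)" if "i < length \<theta>s" for i
  proof -
    have "\<theta>s ! i \<in> set (take (Suc i) \<theta>s)" using that by (simp add: take_Suc_conv_app_nth)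
    then have "\<theta>s ! i \<in> Idl\<^bsub>mpoly_ring V\<^esub> (set (take (Suc i) \<theta>s))" by (rule Idl_generator[OF \<theta>i])
    then show ?thesis using ideal_zero[OF J] unfolding I_def mem_ideal_sum by force
  qed
  have pc_polys: "poly_combinations (drop i \<theta>s) d \<subseteq> polys V" for i d
  proof -
    have "poly_combinations \<eta>s d \<subseteq> polys V" if "set \<eta>s \<subseteq> polys V"
      for \<eta>s :: "('v, 'k) mpoly list" and d
      using that
    proof (induction \<eta>s d rule: poly_combinations.induct)
      case (3 \<theta> \<eta>s d)
      then show ?case
        by (auto elim!: poly_combinations_SucE simp del: poly_combinations.simps
            intro!: polys_add polys_mult)
    qed auto
    then show ?thesis using \<theta>s set_drop_subset[of i \<theta>s] by blast
  qed
  have main: "\<forall>t d. (\<forall>b\<in>B. t b \<in> poly_combinations (drop i \<theta>s) d) \<longrightarrow> (\<Sum>b\<in>B. t b * y b) \<in> I i \<longrightarrow>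
      (\<forall>b\<in>B. t b = 0)" if "i \<le> length \<theta>s" for i
    using that
  proof (induction rule: inc_induct)
    case base
    show ?case
    proof (intro allI impI)
      fix t d assume t: "\<forall>b\<in>B. t b \<in> poly_combinations (drop (length \<theta>s) \<theta>s) d"
        "(\<Sum>b\<in>B. t b * y b) \<in> I (length \<theta>s)"
      then have "\<forall>b\<in>B. \<exists>c. t b = const c" by auto
      then obtain c where c: "\<forall>b\<in>B. t b = const (c b)" by metis
      then have "(\<Sum>b\<in>B. t b * y b) = (\<Sum>b\<in>B. const (c b) * y b)" by (intro sum.cong) auto
      then have "\<forall>b\<in>B. c b = 0" using t(2) by (intro indep) (simp add: I_def)
      then show "\<forall>b\<in>B. t b = 0" using c by simp
    qed
  next
    case (step i)
    have drop: "drop i \<theta>s = \<theta>s ! i # drop (Suc i) \<theta>s" using step.hyps by (simp add: Cons_nth_drop_Suc)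
    have "\<forall>t. (\<forall>b\<in>B. t b \<in> poly_combinations (drop i \<theta>s) d) \<longrightarrow> (\<Sum>b\<in>B. t b * y b) \<in> I i \<longrightarrow>
      (\<forall>b\<in>B. t b = 0)" for d
    proof (induction d)
      case 0
      show ?case
      proof (intro allI impI)
        fix t assume t: "\<forall>b\<in>B. t b \<in> poly_combinations (drop i \<theta>s) 0" "(\<Sum>b\<in>B. t b * y b) \<in> I i"
        then have "\<forall>b\<in>B. t b \<in> poly_combinations (drop (Suc i) \<theta>s) 0"
          by (simp add: poly_combinations_0)
        moreover have "(\<Sum>b\<in>B. t b * y b) \<in> I (Suc i)" using t(2) I_Suc by blast
        ultimately show "\<forall>b\<in>B. t b = 0" using step.IH by blast
      qed
    next
      case (Suc d)
      show ?case
      proof (intro allI impI)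
        fix t assume t: "\<forall>b\<in>B. t b \<in> poly_combinations (drop i \<theta>s) (Suc d)" "(\<Sum>b\<in>B. t b * y b) \<in> I i"
        have "\<forall>b\<in>B. \<exists>r s. t b = r + \<theta>s ! i * s \<and> r \<in> poly_combinations (drop (Suc i) \<theta>s) (Suc d) \<and>
            s \<in> poly_combinations (drop i \<theta>s) d"
          using t(1) unfolding drop by (blast elim: poly_combinations_SucE)
        then obtain r s where rs: "\<forall>b\<in>B. t b = r b + \<theta>s ! i * s b"
          "\<forall>b\<in>B. r b \<in> poly_combinations (drop (Suc i) \<theta>s) (Suc d)"
          "\<forall>b\<in>B. s b \<in> poly_combinations (drop i \<theta>s) d" by metis
        let ?s = "\<Sum>b\<in>B. s b * y b"
        have s_polys: "?s \<in> polys V" using rs(3) pc_polys B by (intro polys_sum polys_mult) blast+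
        have eq: "(\<Sum>b\<in>B. t b * y b) = (\<Sum>b\<in>B. r b * y b) + ?s * \<theta>s ! i"
          unfolding sum_distrib_right sum.distrib[symmetric]
          using rs(1) by (intro sum.cong) (auto simp: algebra_simps)
        \<comment> \<open>Modulo \<open>\<theta>s ! i\<close> only the coefficients \<open>r\<close>
          remain, and they vanish by the outer hypothesis. Regularity then cancels
          \<open>\<theta>s ! i\<close> from the rest, whose coefficients \<open>s\<close> have
          smaller depth.\<close>
        have "?s * \<theta>s ! i \<in> I (Suc i)"
          by (rule ideal_mult[OF I s_polys \<theta>_I[OF step.hyps(2)]])
        moreover have "(\<Sum>b\<in>B. t b * y b) \<in> I (Suc i)" using t(2) I_Suc by blast
        ultimately have "(\<Sum>b\<in>B. t b * y b) - ?s * \<theta>s ! i \<in> I (Suc i)" by (intro ideal_diff[OF I])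
        then have "(\<Sum>b\<in>B. r b * y b) \<in> I (Suc i)" by (simp add: eq)
        then have r: "\<forall>b\<in>B. r b = 0" using step.IH rs(2) by blast
        then have "(\<Sum>b\<in>B. r b * y b) = 0" by simp
        then have "?s * \<theta>s ! i \<in> I i" using t(2) eq by simp
        then have "?s \<in> I i" by (rule nzd[OF step.hyps(2) s_polys])
        then have "\<forall>b\<in>B. s b = 0" using Suc.IH rs(3) by blast
        then show "\<forall>b\<in>B. t b = 0" using r rs(1) by simp
      qed
    qed
    then show ?case by blast
  qed
  have "(\<Sum>b\<in>B. t b * y b) \<in> I 0"
    using t(2) ideal_zero[OF Idl_ideal[of "{}" V]] unfolding I_def mem_ideal_sum by force
  moreover have "\<forall>b\<in>B. t b \<in> poly_combinations (drop 0 \<theta>s) d" using t(1) by simp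
  ultimately have "\<forall>b\<in>B. t b = 0" using main[of 0] by blast
  then show ?thesis using b by blast
qed

lemma push_exponent_push_exponent: "push_exponent f (push_exponent g m) = push_exponent (\<lambda>v. f (g v)) m"
  by (rule exponent_induct[of m UNIV]) (simp_all add: push_exponent_add)

lemma total_degree_push_exponent: "total_degree (push_exponent f m) = total_degree m"
  by (rule exponent_induct[of m UNIV]) (simp_all add: push_exponent_add total_degree_add)

lemma push_exponent_keys: "keys m \<subseteq> V \<Longrightarrow> keys (push_exponent f m) \<subseteq> f ` V"
  by (induction m rule: exponent_induct) (auto simp: push_exponent_add keys_add_nat)

lemma keys_rename_vars:
  "keys (rename_vars f p) \<subseteq> push_exponent f ` keys p"
proof
  fix k assume "k \<in> keys (rename_vars f p)"
  then obtain m where "m \<in> keys p" "k \<in> keys (single (push_exponent f m) (lookup p m))"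
    unfolding rename_vars_def using keys_sum by fastforce
  then show "k \<in> push_exponent f ` keys p" by (auto split: if_splits)
qed

section \<open>Regularity of the differences on S/C, and \<open>T\<close> as the polynomials in the
  differences\<close>

context variable_blocks
begin

definition pairs :: "('v \<times> 'v) list" where
  "pairs = concat (map (\<lambda>i. zip (vs i) (tl (vs i))) [1..<Suc n])"

definition \<theta>s :: "('v, 'k) mpoly list" where
  "\<theta>s = map pair_diff pairs"

lemma \<theta>s_eq: "\<theta>s = concat (map (\<lambda>i. successive_differences (vs i)) [1..<Suc n])"
proof -
  have "(\<lambda>e :: 'v \<times> 'v. pair_diff e :: ('v, 'k) mpoly) = (\<lambda>(v, w). var v - var w)" by auto
  then show ?thesis
    by (simp add: \<theta>s_def pairs_def successive_differences_def map_concat comp_def del: upt_Suc)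
qed

lemma pairsD:
  assumes "e \<in> set pairs"
  shows "fst e \<in> V" "snd e \<in> V" "\<pi> (fst e) = \<pi> (snd e)"
proof -
  obtain i where i: "i \<in> {1..n}" "e \<in> set (zip (vs i) (tl (vs i)))"
    using assms by (auto simp: pairs_def atLeastLessThanSuc_atLeastAtMost simp del: upt_Suc)
  then have "fst e \<in> set (vs i)" "snd e \<in> set (tl (vs i))"
    using set_zip_leftD[of "fst e" "snd e"] set_zip_rightD[of "fst e" "snd e"] by auto
  moreover from this(2) have "snd e \<in> set (vs i)"
    by (cases "vs i") auto
  ultimately show "fst e \<in> V" "snd e \<in> V" "\<pi> (fst e) = \<pi> (snd e)"
    using set_vs[OF i(1)] by auto
qed

lemma pairs_subset: "set pairs \<subseteq> V \<times> V"
  using pairsD by fastforce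

lemma fresh_pairs: "fresh_pairs pairs"
  unfolding pairs_def
proof (rule fresh_pairs_concat)
  fix i assume "i \<in> set [1..<Suc n]"
  then show "distinct (vs i)" by (intro distinct_vs) auto
next
  fix i j assume "i \<in> set [1..<Suc n]" "j \<in> set [1..<Suc n]" "i \<noteq> j"
  then show "set (vs i) \<inter> set (vs j) = {}" by (intro block_disjoint) auto
qed simp

lemma pair_diff_T: "e \<in> set pairs \<Longrightarrow> pair_diff e \<in> T"
  using pairsD by (intro var_diff_T)

lemma set_\<theta>s: "set \<theta>s = pair_diff ` set pairs"
  by (simp add: \<theta>s_def)

definition \<Theta> :: "nat \<Rightarrow> ('v, 'k) mpoly set" where
  "\<Theta> k = Idl\<^bsub>mpoly_ring V\<^esub> (set (take k \<theta>s))"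

lemma take_\<theta>s: "set (take k \<theta>s) = pair_diff ` set (take k pairs)"
  by (simp add: \<theta>s_def take_map)

lemma take_\<theta>s_polys: "set (take k \<theta>s) \<subseteq> polys V"
  unfolding take_\<theta>s using pairs_subset set_take_subset[of k pairs] by (intro pair_diffs_polys) blast

lemma \<Theta>_ideal: "ideal (\<Theta> k) (mpoly_ring V)"
  unfolding \<Theta>_def by (rule Idl_ideal[OF take_\<theta>s_polys])

lemma \<Theta>_regular:
  assumes "k < length \<theta>s" "g \<in> polys V" "g * \<theta>s ! k \<in> \<Theta> k"
  shows "g \<in> \<Theta> k"
proof -
  have k: "k < length pairs" using assms(1) by (simp add: \<theta>s_def)
  have take: "take k pairs @ [pairs ! k] = take (Suc k) pairs" using k by (simp add: take_Suc_conv_app_nth)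
  have "fresh_pairs (take k pairs @ [pairs ! k] @ drop (Suc k) pairs)"
    using fresh_pairs k by (simp add: id_take_nth_drop[symmetric])
  then have fr: "fresh_pairs (take k pairs @ [pairs ! k])"
    unfolding append_assoc[symmetric] by (simp only: fresh_pairs_append)
  have sub: "set (take k pairs @ [pairs ! k]) \<subseteq> V \<times> V"
    unfolding take using pairs_subset set_take_subset[of "Suc k" pairs] by blast
  have mem: "g * pair_diff (pairs ! k) \<in> Idl\<^bsub>mpoly_ring V\<^esub> (pair_diff ` set (take k pairs))"
    using assms(3) k unfolding \<Theta>_def take_\<theta>s by (simp add: \<theta>s_def)
  show ?thesis
    unfolding \<Theta>_def take_\<theta>s by (rule var_diff_regular_mod_pair_diffs[OF fr sub assms(2) mem])
qed

text \<open>\<open>\<Theta> k\<close> is generated by elements of \<open>T\<close>, which can be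
  pulled out of the residue; the factor \<open>s\<close> makes the test set an ideal.\<close>

lemma residue_\<Theta>: 
  assumes x: "x \<in> \<Theta> k" and s: "s \<in> polys V"
  shows "residue (x * s) \<in> \<Theta> k"
proof -
  define S where "S = {f \<in> polys V. \<forall>g\<in>polys V. residue (f * g) \<in> \<Theta> k}"
  have S: "ideal S (mpoly_ring V)"
  proof (rule ideal_mpoly_ringI)
    fix r x :: "('v, 'k) mpoly"
    assume "r \<in> polys V" "x \<in> S"
    then show "r * x \<in> S"
      by (auto simp: S_def mult.assoc mult.left_commute[of r x])
  qed (auto simp: S_def distrib_right residue_add ideal_zero[OF \<Theta>_ideal] ideal_add[OF \<Theta>_ideal])
  have "set (take k \<theta>s) \<subseteq> S"
  proof
    fix t assume t: "t \<in> set (take k \<theta>s)"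
    then obtain e where "e \<in> set pairs" "t = pair_diff e"
      unfolding take_\<theta>s using in_set_takeD by fastforce
    then have T: "t \<in> T" using pair_diff_T by simp
    have "residue (t * g) \<in> \<Theta> k" if g: "g \<in> polys V" for g
    proof -
      have "t \<in> \<Theta> k" unfolding \<Theta>_def by (rule Idl_generator[OF take_\<theta>s_polys t])
      then have "t * residue g \<in> \<Theta> k" by (rule ideal_mult_right[OF \<Theta>_ideal T_polys[OF residue_T[OF g]]])
      then show ?thesis by (simp add: residue_mult[OF T])
    qed
    then show "t \<in> S" using T_polys[OF T] by (simp add: S_def)
  qed
  then have "\<Theta> k \<subseteq> S" unfolding \<Theta>_def by (rule Idl_minimal[OF S])
  then have "x \<in> S" using x by blast
  then show ?thesis using s by (simp add: S_def)
qed

lemma mem_C_\<Theta>: "x \<in> C <+>\<^bsub>mpoly_ring V\<^esub> \<Theta> k \<Longrightarrow> s \<in> polys V \<Longrightarrow> residue (x * s) \<in> \<Theta> k"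
proof -
  assume "x \<in> C <+>\<^bsub>mpoly_ring V\<^esub> \<Theta> k" and s: "s \<in> polys V"
  then obtain c t where "c \<in> C" "t \<in> \<Theta> k" "x = c + t" unfolding mem_ideal_sum by blast
  then show ?thesis
    using s residue_\<Theta>[of t k s] residue_C[OF ideal_mult_right[OF C_ideal s, of c]]
    by (simp add: distrib_right residue_add)
qed

lemma mem_C_\<Theta>I:
  assumes "f - (\<Sum>e\<in>E. r e * Q e) \<in> C" "\<And>e. e \<in> E \<Longrightarrow> r e \<in> \<Theta> k" "\<And>e. Q e \<in> polys V"
  shows "f \<in> C <+>\<^bsub>mpoly_ring V\<^esub> \<Theta> k"
proof -
  have "(\<Sum>e\<in>E. r e * Q e) \<in> \<Theta> k"
    using assms(2,3) by (intro ideal_sum[OF \<Theta>_ideal] ideal_mult_right[OF \<Theta>_ideal])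
  moreover have "f = (f - (\<Sum>e\<in>E. r e * Q e)) + (\<Sum>e\<in>E. r e * Q e)" by simp
  ultimately show ?thesis unfolding mem_ideal_sum using assms(1) by blast
qed

text \<open>The residues against \<open>H\<close> are the coordinates of \<open>g\<close> modulo
  \<open>C\<close>. Multiplication by a difference multiplies each of them by it, and the
  differences are regular in S itself by \<open>\<Theta>_regular\<close>.\<close>

lemma C_regular:
  assumes k: "k < length \<theta>s" and g: "g \<in> polys V" "g * \<theta>s ! k \<in> C <+>\<^bsub>mpoly_ring V\<^esub> \<Theta> k"
  shows "g \<in> C <+>\<^bsub>mpoly_ring V\<^esub> \<Theta> k"
proof (rule mem_C_\<Theta>I[OF N_expansion[OF g(1)] _ N_polys])
  fix e
  have "\<theta>s ! k \<in> T" using k pair_diff_T by (simp add: \<theta>s_def)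
  then have "residue (g * \<theta>s ! k * H e) = residue (g * H e) * \<theta>s ! k"
    using residue_mult[of "\<theta>s ! k" "g * H e"] by (simp only: mult_ac)
  moreover have "residue (g * \<theta>s ! k * H e) \<in> \<Theta> k" by (rule mem_C_\<Theta>[OF g(2) H_polys])
  ultimately have "residue (g * H e) * \<theta>s ! k \<in> \<Theta> k" by simp
  then show "residue (g * H e) \<in> \<Theta> k"
    by (rule \<Theta>_regular[OF k T_polys[OF residue_T[OF polys_mult[OF g(1) H_polys]]]])
qed

text \<open>It contains the successive differences and is closed under subtraction, so telescoping
  brings in every value of \<open>collapse\<close> on a variable of \<open>V\<close>.\<close>

definition linear_multipliers :: "('v, 'k) mpoly set" where
  "linear_multipliers = {x. \<forall>d. \<forall>y\<in>poly_combinations \<theta>s d. x * y \<in> poly_combinations \<theta>s (Suc d)}"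

lemma linear_multipliers_diff:
  assumes "x \<in> linear_multipliers" "y \<in> linear_multipliers"
  shows "x - y \<in> linear_multipliers"
  unfolding linear_multipliers_def
proof (intro CollectI allI ballI)
  fix d z assume z: "z \<in> poly_combinations \<theta>s d"
  have "x * z + const (- 1) * (y * z) \<in> poly_combinations \<theta>s (Suc d)"
    using assms z by (intro poly_combinations_add poly_combinations_scale) (auto simp: linear_multipliers_def)
  then show "(x - y) * z \<in> poly_combinations \<theta>s (Suc d)"
    by (simp add: const_uminus algebra_simps)
qed

text \<open>Telescoping along the enumeration of a block. \<open>L\<close> is kept abstract to serve
  both for \<open>linear_multipliers\<close> and for the ideal of all differences.\<close>

lemma base_diff_mem:
  assumes zero: "0 \<in> L" and diff: "\<And>x y. x \<in> L \<Longrightarrow> y \<in> L \<Longrightarrow> x - y \<in> L"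
    and \<theta>s: "set \<theta>s \<subseteq> L" and v: "v \<in> V"
  shows "var v - var (base (\<pi> v)) \<in> L"
proof -
  let ?vs = "vs (\<pi> v)"
  have i: "\<pi> v \<in> {1..n}" by (rule \<pi>_range[OF v])
  have *: "var (base (\<pi> v)) - var (?vs ! j) \<in> L" if "j < length ?vs" for j
    using that
  proof (induction j)
    case 0
    then have "?vs ! 0 = base (\<pi> v)" by (simp add: base_def hd_conv_nth)
    then show ?case by (simp add: zero)
  next
    case (Suc j)
    have "(?vs ! j, ?vs ! Suc j) \<in> set (zip ?vs (tl ?vs))"
      using Suc.prems by (auto simp: set_zip nth_tl intro!: exI[of _ j])
    then have "(?vs ! j, ?vs ! Suc j) \<in> set pairs"
      using i by (auto simp: pairs_def atLeastLessThanSuc_atLeastAtMost simp del: upt_Suc)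
    then have "var (?vs ! j) - var (?vs ! Suc j) \<in> set \<theta>s"
      unfolding set_\<theta>s by (rule rev_image_eqI) simp
    then have 1: "var (?vs ! j) - var (?vs ! Suc j) \<in> L" using \<theta>s by blast
    have 2: "var (base (\<pi> v)) - var (?vs ! j) \<in> L" using Suc by simp
    from diff[OF 2 diff[OF zero 1]] show ?case by simp
  qed
  have "v \<in> set ?vs" using set_vs[OF i] v by blast
  then obtain j where "j < length ?vs" "v = ?vs ! j" by (auto simp: in_set_conv_nth)
  then have "var (base (\<pi> v)) - var v \<in> L" using *[of j] by simp
  from diff[OF zero this] show ?thesis by simp
qed

text \<open>An element of \<open>T\<close> is its own image under \<open>collapse\<close>, hence a
  polynomial in the differences with the first variables. This makes
  \<open>regular_sequence_independent\<close> available for coefficients in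
  \<open>T\<close>.\<close>

lemma T_poly_combinations: "t \<in> T \<Longrightarrow> \<exists>d. t \<in> poly_combinations \<theta>s d"
proof -
  have "\<exists>d. collapse f \<in> poly_combinations \<theta>s d" if "f \<in> polys V" for f
    using that
  proof (induction f rule: polys_induct)
    case (const c)
    show ?case using poly_combinations_const[of c \<theta>s 0] by (auto simp: collapse_hom)
  next
    case (add p q)
    then obtain d d' where "collapse p \<in> poly_combinations \<theta>s d" "collapse q \<in> poly_combinations \<theta>s d'"
      by blast
    then have "collapse p \<in> poly_combinations \<theta>s (max d d')" "collapse q \<in> poly_combinations \<theta>s (max d d')"
      using poly_combinations_mono[OF max.cobounded1] poly_combinations_mono[OF max.cobounded2] by blast+
    then show ?case by (auto simp: collapse_hom intro: poly_combinations_add)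
  next
    case (var v p)
    then obtain d where d: "collapse p \<in> poly_combinations \<theta>s d" by blast
    have "var v - var (base (\<pi> v)) \<in> linear_multipliers"
      using var(1) poly_combinations_generator_mult
      by (intro base_diff_mem linear_multipliers_diff)
         (auto simp: linear_multipliers_def poly_combinations_zero)
    then have "(var v - var (base (\<pi> v))) * collapse p \<in> poly_combinations \<theta>s (Suc d)"
      using d by (simp add: linear_multipliers_def)
    moreover have "collapse (var v * p) = (var v - var (base (\<pi> v))) * collapse p"
      using var(1) by (simp add: collapse_def)
    ultimately show ?case by auto
  qed
  moreover assume "t \<in> T"
  ultimately show ?thesis unfolding T_def by force
qed

end

section \<open>Linkage of polarizations\<close>

locale polarized_ideal = variable_blocks V n \<pi> vs C
  for V :: "'v set" and n \<pi> vs and C :: "('v, 'k::field) mpoly set" +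
  fixes J :: "('v, 'k) mpoly set" and \<jj> :: "(nat, 'k) mpoly set"
  assumes J_ideal: "ideal J (mpoly_ring V)" and C_subset_J: "C \<subseteq> J"
    and J_monomial: "monomial_ideal V J" and \<jj>_monomial: "monomial_ideal {1..n} \<jj>"
    and J_image: "rename_vars \<pi> ` J = \<jj>"
    and J_regular: "regular_sequence (mpoly_ring V) J \<theta>s"
begin

definition project :: "('v, 'k) mpoly \<Rightarrow> (nat, 'k) mpoly" where
  "project = subst (\<lambda>v. var (\<pi> v))"

definition lift :: "(nat, 'k) mpoly \<Rightarrow> ('v, 'k) mpoly" where
  "lift = subst (\<lambda>i. var (base i))"

lemma rename_vars_project: "rename_vars \<pi> = project"
  by (rule ext) (simp add: rename_vars_eq_subst project_def)

lemma project_polys: "f \<in> polys V \<Longrightarrow> project f \<in> polys {1..n}"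
  unfolding project_def by (rule subst_polys, assumption) (use \<pi>_range in \<open>simp only: polys_var\<close>)

lemma lift_polys: "f \<in> polys {1..n} \<Longrightarrow> lift f \<in> polys V"
  unfolding lift_def by (rule subst_polys, assumption) (use base_V in \<open>simp only: polys_var\<close>)

lemma project_lift: "f \<in> polys {1..n} \<Longrightarrow> project (lift f) = f"
proof -
  assume f: "f \<in> polys {1..n}"
  have "project (lift f) = subst var f"
    unfolding project_def lift_def subst_subst
    by (rule subst_cong[OF f]) (simp add: \<pi>_base del: atLeastAtMost_iff)
  then show ?thesis by simp
qed

lemma project_var_prod: "i \<in> {1..n} \<Longrightarrow> project (var_prod (vs i)) = var i ^ \<alpha> i"
proof -
  assume i: "i \<in> {1..n}"
  have "project (var_prod L) = var i ^ length L" if "set L \<subseteq> set (vs i)" for L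
    using that set_vs[OF i] by (induction L) (auto simp: project_def)
  then show ?thesis by (simp add: \<alpha>_def)
qed

lemma \<jj>_power: "i \<in> {1..n} \<Longrightarrow> var i ^ \<alpha> i \<in> \<jj>"
proof -
  assume i: "i \<in> {1..n}"
  have "var_prod (vs i) \<in> J" using C_generator[OF i polys_1] C_subset_J by auto
  then have "project (var_prod (vs i)) \<in> \<jj>" using J_image by (auto simp: rename_vars_project)
  then show ?thesis using project_var_prod[OF i] by simp
qed

definition B :: "(nat \<Rightarrow>\<^sub>0 nat) set" where
  "B = {b. keys b \<subseteq> {1..n} \<and> monomial b \<notin> \<jj>}"

lemma B_bound:
  assumes b: "b \<in> B" and i: "i \<in> {1..n}"
  shows "lookup b i < \<alpha> i"
proof (rule ccontr)
  assume "\<not> lookup b i < \<alpha> i"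
  then have "b = (b - single i (\<alpha> i)) + single i (\<alpha> i)"
    by (intro poly_mapping_eqI) (auto simp: lookup_add lookup_minus lookup_single when_def)
  moreover have "keys (b - single i (\<alpha> i)) \<subseteq> {1..n}"
  proof -
    have "keys (b - single i (\<alpha> i)) \<subseteq> keys b" by (auto simp: in_keys_iff lookup_minus)
    then show ?thesis using b by (auto simp: B_def)
  qed
  moreover have "monomial (single i (\<alpha> i)) \<in> \<jj>" using \<jj>_power[OF i] by (simp add: var_power)
  ultimately have "monomial b \<in> \<jj>"
    using ideal_mult[OF monomial_ideal_ideal[OF \<jj>_monomial], of "monomial (b - single i (\<alpha> i))"]
    by (metis monomial_add polys_monomial)
  then show False using b by (simp add: B_def)
qed

lemma finite_B: "finite B"
proof -
  let ?m = "Max (insert 0 (\<alpha> ` {1..n}))"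
  have "lookup ` B \<subseteq> {f. \<forall>i. (i \<in> {1..n} \<longrightarrow> f i \<in> {..?m}) \<and> (i \<notin> {1..n} \<longrightarrow> f i = 0)}"
  proof
    fix f assume "f \<in> lookup ` B"
    then obtain b where b: "b \<in> B" "f = lookup b" by blast
    have "f i \<in> {..?m}" if "i \<in> {1..n}" for i
    proof -
      have "\<alpha> i \<le> ?m" using that by (intro Max_ge) auto
      then show ?thesis using B_bound[OF b(1) that] b(2) by simp
    qed
    moreover have "f i = 0" if "i \<notin> {1..n}" for i
    proof -
      have "i \<notin> keys b" using b that by (auto simp: B_def)
      then show ?thesis by (simp add: b(2) in_keys_iff)
    qed
    ultimately show "f \<in> {f. \<forall>i. (i \<in> {1..n} \<longrightarrow> f i \<in> {..?m}) \<and> (i \<notin> {1..n} \<longrightarrow> f i = 0)}" by blast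
  qed
  then have "finite (lookup ` B)"
    by (rule finite_subset) (intro finite_set_of_finite_funs; simp)
  then show ?thesis by (rule finite_imageD) (rule inj_onI, rule poly_mapping_eqI, simp)
qed

definition Y :: "(nat \<Rightarrow>\<^sub>0 nat) \<Rightarrow> ('v, 'k) mpoly" where
  "Y b = lift (monomial b)"

lemma Y_polys: "b \<in> B \<Longrightarrow> Y b \<in> polys V"
  unfolding Y_def by (rule lift_polys) (simp add: B_def)

lemma Y_eq: "Y b = monomial (push_exponent base b)"
  by (simp add: Y_def lift_def subst_var_monomial)

text \<open>Replacing a variable by the first one of its block changes a monomial by an element of
  \<open>T\<close> times a monomial of smaller degree. So, by induction on the degree, membership of
  a monomial in the span depends only on its image under \<open>\<pi>\<close>.\<close>

lemma B_spans:
  assumes "f \<in> polys V"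
  shows "f \<in> submodule_span T (Y ` B \<union> J)" (is "_ \<in> ?M")
proof -
  let ?\<rho> = "\<lambda>v. base (\<pi> v)"
  have \<rho>V: "?\<rho> v \<in> V" "\<pi> (?\<rho> v) = \<pi> v" if "v \<in> V" for v
    using base_V[OF \<pi>_range[OF that]] \<pi>_base[OF \<pi>_range[OF that]] by auto
  have uminus: "- x \<in> ?M" if "x \<in> ?M" for x
    using submodule_span.scale[OF T_uminus[OF T_closed(3)] that] by simp
  have mon: "monomial w \<in> ?M" if "keys w \<subseteq> V" for w
    using that
  proof (induction "total_degree w" arbitrary: w rule: less_induct)
    case less
    note IH = less.hyps
    have swap: "monomial (single v 1 + u) \<in> ?M \<longleftrightarrow> monomial (single (?\<rho> v) 1 + u) \<in> ?M"
      if v: "v \<in> V" and u: "keys u \<subseteq> V" "total_degree u < total_degree w" for v u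
    proof -
      have T: "var v - var (?\<rho> v) \<in> T" using \<rho>V[OF v] v by (intro var_diff_T) auto
      have d: "(var v - var (?\<rho> v)) * monomial u \<in> ?M"
        by (rule submodule_span.scale[OF T IH[OF u(2,1)]])
      have eq: "monomial (single v 1 + u) = (var v - var (?\<rho> v)) * monomial u + monomial (single (?\<rho> v) 1 + u)"
        "monomial (single (?\<rho> v) 1 + u) = - ((var v - var (?\<rho> v)) * monomial u) + monomial (single v 1 + u)"
        by (simp_all add: monomial_add var_def algebra_simps)
      show ?thesis
      proof
        assume "monomial (single v 1 + u) \<in> ?M"
        then show "monomial (single (?\<rho> v) 1 + u) \<in> ?M"
          by (subst eq(2)) (rule submodule_span.add[OF uminus[OF d]])
      next
        assume "monomial (single (?\<rho> v) 1 + u) \<in> ?M"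
        then show "monomial (single v 1 + u) \<in> ?M"
          by (subst eq(1)) (rule submodule_span.add[OF d])
      qed
    qed
    have norm: "monomial (u + u') \<in> ?M \<longleftrightarrow> monomial (push_exponent ?\<rho> u + u') \<in> ?M"
      if u: "keys u \<subseteq> V" "keys u' \<subseteq> V" "total_degree (u + u') = total_degree w" for u u'
      using u
    proof (induction u arbitrary: u' rule: exponent_induct)
      case (add v u)
      have 1: "keys (u + u') \<subseteq> V" "total_degree (u + u') < total_degree w"
        using add by (auto simp: keys_add_nat total_degree_add)
      have 2: "keys (single (?\<rho> v) 1 + u') \<subseteq> V" "total_degree (u + (single (?\<rho> v) 1 + u')) = total_degree w"
        using add \<rho>V[OF add.hyps(1)] by (auto simp: keys_add_nat total_degree_add)
      have "monomial (single v 1 + u + u') \<in> ?M \<longleftrightarrow> monomial (u + (single (?\<rho> v) 1 + u')) \<in> ?M"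
        using swap[OF add.hyps(1) 1] by (simp only: ac_simps)
      also have "\<dots> \<longleftrightarrow> monomial (push_exponent ?\<rho> u + (single (?\<rho> v) 1 + u')) \<in> ?M"
        by (rule add.IH[OF 2])
      finally show ?case by (simp add: push_exponent_add ac_simps)
    qed simp
    define b where "b = push_exponent \<pi> w"
    have b: "keys b \<subseteq> {1..n}" using push_exponent_keys[OF less.prems, of \<pi>] \<pi>_range by (auto simp: b_def)
    have nw: "monomial w \<in> ?M \<longleftrightarrow> monomial (push_exponent base b) \<in> ?M"
      using norm[of w 0] less.prems by (simp add: b_def push_exponent_push_exponent)
    show ?case
    proof (cases "monomial b \<in> \<jj>")
      case False
      then have "b \<in> B" using b by (simp add: B_def)
      then have "Y b \<in> ?M" by (intro submodule_span.gen) simp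
      then show ?thesis unfolding nw Y_eq[symmetric] .
    next
      case True
      \<comment> \<open>Because \<open>J\<close> is monomial and maps onto \<open>\<jj>\<close>,
        some monomial of \<open>J\<close> lies over \<open>b\<close>. It has the same degree as
        \<open>w\<close>, so \<open>w\<close> can be compared with it.\<close>
      then obtain x where x: "x \<in> J" "rename_vars \<pi> x = monomial b" using J_image by (metis imageE)
      have "b \<in> push_exponent \<pi> ` keys x" using keys_rename_vars[of \<pi> x] by (simp add: x(2))
      then obtain m where m: "m \<in> keys x" "b = push_exponent \<pi> m" by blast
      have mV: "keys m \<subseteq> V" using ideal_subset_polys[OF J_ideal x(1)] m(1) by (auto simp: polys_def)
      have "monomial m \<in> J" using monomial_ideal_mem_iff[OF J_monomial, of x] x(1) m(1) by blast
      then have "monomial m \<in> ?M" by (intro submodule_span.gen) simp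
      moreover have "total_degree m = total_degree w"
        using m(2) total_degree_push_exponent[of \<pi>] by (metis b_def)
      ultimately show ?thesis
        using norm[of m 0] mV by (simp add: nw m(2) push_exponent_push_exponent)
    qed
  qed
  show ?thesis
    using assms
  proof (induction f rule: polys_induct_monomial)
    case (monomial c m)
    then show ?case by (intro submodule_span.scale T_closed mon)
  qed (rule submodule_span.add)
qed

lemma B_expansion:
  assumes "f \<in> polys V"
  shows "\<exists>t. (\<forall>b. t b \<in> T) \<and> f - (\<Sum>b\<in>B. t b * Y b) \<in> J"
  using B_spans[OF assms]
proof (induction rule: submodule_span.induct)
  case zero
  show ?case using ideal_zero[OF J_ideal] by (intro exI[of _ "\<lambda>_. 0"]) (simp add: T_closed)
next
  case (gen g)
  then show ?case
  proof
    assume "g \<in> Y ` B"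
    then obtain b where b: "b \<in> B" "g = Y b" by blast
    have "(\<Sum>b'\<in>B. (if b' = b then 1 else 0) * Y b') = (\<Sum>b'\<in>B. if b' = b then Y b' else 0)"
      by (rule sum.cong) auto
    then have "(\<Sum>b'\<in>B. (if b' = b then 1 else 0) * Y b') = g" using b finite_B by simp
    then show ?thesis
      using ideal_zero[OF J_ideal]
      by (intro exI[of _ "\<lambda>b'. if b' = b then 1 else 0"]) (simp add: T_closed)
  next
    assume "g \<in> J"
    then show ?thesis by (intro exI[of _ "\<lambda>_. 0"]) (simp add: T_closed)
  qed
next
  case (add x y)
  then obtain s t where st: "\<forall>b. s b \<in> T" "\<forall>b. t b \<in> T"
    "x - (\<Sum>b\<in>B. s b * Y b) \<in> J" "y - (\<Sum>b\<in>B. t b * Y b) \<in> J" by blast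
  have eq: "x + y - (\<Sum>b\<in>B. (s b + t b) * Y b) = (x - (\<Sum>b\<in>B. s b * Y b)) + (y - (\<Sum>b\<in>B. t b * Y b))"
    by (simp add: distrib_right sum.distrib)
  have "x + y - (\<Sum>b\<in>B. (s b + t b) * Y b) \<in> J"
    unfolding eq by (rule ideal_add[OF J_ideal st(3,4)])
  moreover have "\<forall>b. s b + t b \<in> T" using st(1,2) by (simp add: T_closed)
  ultimately show ?case by (intro exI[of _ "\<lambda>b. s b + t b"] conjI)
next
  case (scale r x)
  then obtain t where t: "\<forall>b. t b \<in> T" "x - (\<Sum>b\<in>B. t b * Y b) \<in> J" by blast
  have eq: "r * x - (\<Sum>b\<in>B. (r * t b) * Y b) = r * (x - (\<Sum>b\<in>B. t b * Y b))"
    by (simp add: sum_distrib_left right_diff_distrib mult.assoc)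
  have "r * x - (\<Sum>b\<in>B. (r * t b) * Y b) \<in> J"
    unfolding eq by (rule ideal_mult[OF J_ideal T_polys[OF scale.hyps(1)] t(2)])
  moreover have "\<forall>b. r * t b \<in> T" using t(1) scale.hyps(1) by (simp add: T_closed)
  ultimately show ?case by (intro exI[of _ "\<lambda>b. r * t b"] conjI)
qed

lemma project_\<Theta>: "x \<in> \<Theta> k \<Longrightarrow> project x = 0"
proof -
  have "\<Theta> k \<subseteq> {p \<in> polys V. subst (\<lambda>v. var (\<pi> v) :: (nat, 'k) mpoly) p = 0}"
    unfolding \<Theta>_def
  proof (rule Idl_minimal[OF subst_kernel_ideal], rule subsetI)
    fix t assume t: "t \<in> set (take k \<theta>s)"
    then obtain e where e: "e \<in> set pairs" "t = pair_diff e"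
      unfolding take_\<theta>s using in_set_takeD by fastforce
    then show "t \<in> {p \<in> polys V. subst (\<lambda>v. var (\<pi> v) :: (nat, 'k) mpoly) p = 0}"
      using pairsD[OF e(1)] by simp
  qed
  then show "x \<in> \<Theta> k \<Longrightarrow> project x = 0" by (auto simp: project_def)
qed

text \<open>Modulo all differences the elements \<open>Y b\<close> become the standard monomials,
  which are independent modulo the monomial ideal \<open>\<jj>\<close>. Regularity lifts this from
  constants to coefficients in \<open>T\<close>.\<close>

lemma B_independent:
  assumes t: "\<And>b. t b \<in> T" "(\<Sum>b\<in>B. t b * Y b) \<in> J" and b: "b \<in> B"
  shows "t b = 0"
proof -
  have "\<forall>b. \<exists>d. t b \<in> poly_combinations \<theta>s d" using T_poly_combinations t(1) by blast
  then obtain d where d: "\<And>b. t b \<in> poly_combinations \<theta>s (d b)" by metis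
  \<comment> \<open>One depth must serve all coefficients; inserting \<open>0\<close> covers the
    case that \<open>B\<close> is empty.\<close>
  have bound: "t b \<in> poly_combinations \<theta>s (Max (insert 0 (d ` B)))" if "b \<in> B" for b
  proof -
    have "d b \<le> Max (insert 0 (d ` B))" using that finite_B by (intro Max_ge) auto
    then show ?thesis using d poly_combinations_mono by blast
  qed
  show ?thesis
  proof (rule regular_sequence_independent[OF J_ideal J_regular finite_B Y_polys _ bound t(2) b])
    fix c :: "(nat \<Rightarrow>\<^sub>0 nat) \<Rightarrow> 'k"
    assume "(\<Sum>b\<in>B. const (c b) * Y b) \<in> J <+>\<^bsub>mpoly_ring V\<^esub> Idl\<^bsub>mpoly_ring V\<^esub> (set \<theta>s)"
    then obtain x y where xy: "x \<in> J" "y \<in> \<Theta> (length \<theta>s)" "(\<Sum>b\<in>B. const (c b) * Y b) = x + y"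
      unfolding mem_ideal_sum by (auto simp: \<Theta>_def)
    have "project (\<Sum>b\<in>B. const (c b) * Y b) = (\<Sum>b\<in>B. const (c b) * monomial b)"
      unfolding project_def subst_sum
    proof (rule sum.cong[OF refl])
      fix b assume "b \<in> B"
      then show "subst (\<lambda>v. var (\<pi> v)) (const (c b) * Y b) = const (c b) * monomial b"
        using project_lift[of "monomial b"] by (simp add: Y_def project_def[symmetric] B_def)
          (simp add: project_def)
    qed
    moreover have "project (x + y) = project x" using project_\<Theta>[OF xy(2)] by (simp add: project_def)
    moreover have "project x \<in> \<jj>" using xy(1) J_image by (auto simp: rename_vars_project)
    ultimately have mem: "(\<Sum>b\<in>B. const (c b) * monomial b) \<in> \<jj>" using xy(3) by metis
    show "\<forall>b\<in>B. c b = 0"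
    proof (rule ccontr)
      assume "\<not> (\<forall>b\<in>B. c b = 0)"
      then obtain b where b: "b \<in> B" "c b \<noteq> 0" by blast
      have "lookup (\<Sum>b\<in>B. const (c b) * monomial b) b = (\<Sum>b'\<in>B. if b' = b then c b else 0)"
        unfolding lookup_sum
        by (rule sum.cong) (auto simp: single_conv_const_monomial[symmetric] lookup_single when_def)
      also have "\<dots> = c b" using b finite_B by simp
      finally have "b \<in> keys (\<Sum>b\<in>B. const (c b) * monomial b)" using b(2) by (simp add: in_keys_iff)
      then have "monomial b \<in> \<jj>" using mem monomial_ideal_mem_iff[OF \<jj>_monomial] by blast
      then show False using b(1) by (simp add: B_def)
    qed
  qed
qed

end

section \<open>Lifting multipliers of \<open>J\<close> from \<open>C\<close> modulo differences to
  \<open>C\<close>\<close>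

context polarized_ideal
begin

text \<open>A \<open>T\<close>-linear functional on \<open>S/J\<close> lifting the functional \<open>f \<mapsto> residue (g * f)\<close>, which is only
  defined modulo \<open>\<Theta> k\<close> there.\<close>

definition coefficients :: "('v, 'k) mpoly \<Rightarrow> (nat \<Rightarrow>\<^sub>0 nat) \<Rightarrow> ('v, 'k) mpoly" where
  "coefficients f = (SOME t. (\<forall>b. t b \<in> T) \<and> f - (\<Sum>b\<in>B. t b * Y b) \<in> J)"

definition functional :: "('v, 'k) mpoly \<Rightarrow> ('v, 'k) mpoly \<Rightarrow> ('v, 'k) mpoly" where
  "functional g f = (\<Sum>b\<in>B. coefficients f b * residue (g * Y b))"

lemma coefficients:
  assumes "f \<in> polys V"
  shows "coefficients f b \<in> T" "f - (\<Sum>b\<in>B. coefficients f b * Y b) \<in> J"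
  using someI_ex[OF B_expansion[OF assms]] unfolding coefficients_def by blast+

text \<open>Independence makes the choice in \<open>coefficients\<close> unique on \<open>B\<close>;
  the linearity of \<open>functional\<close> rests on this.\<close>

lemma coefficients_eqI:
  assumes f: "f \<in> polys V" and t: "\<And>b. t b \<in> T" "f - (\<Sum>b\<in>B. t b * Y b) \<in> J" and b: "b \<in> B"
  shows "coefficients f b = t b"
proof -
  have "(f - (\<Sum>b\<in>B. t b * Y b)) - (f - (\<Sum>b\<in>B. coefficients f b * Y b)) \<in> J"
    by (rule ideal_diff[OF J_ideal t(2) coefficients(2)[OF f]])
  then have "(\<Sum>b\<in>B. (coefficients f b - t b) * Y b) \<in> J"
    by (simp add: left_diff_distrib sum_subtractf)
  then have "coefficients f b - t b = 0"
    by (rule B_independent[rotated]) (intro T_closed coefficients(1)[OF f] t(1) b)+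
  then show ?thesis by simp
qed

lemma functional_eqI:
  assumes "f \<in> polys V" "\<And>b. t b \<in> T" "f - (\<Sum>b\<in>B. t b * Y b) \<in> J"
  shows "functional g f = (\<Sum>b\<in>B. t b * residue (g * Y b))"
  unfolding functional_def using coefficients_eqI[OF assms] by (intro sum.cong) auto

lemma functional_J: "u \<in> J \<Longrightarrow> functional g u = 0"
  using functional_eqI[of u "\<lambda>_. 0" g] ideal_subset_polys[OF J_ideal, of u] by (simp add: T_closed)

lemma functional_add:
  assumes "x \<in> polys V" "y \<in> polys V"
  shows "functional g (x + y) = functional g x + functional g y"
proof -
  have eq: "x + y - (\<Sum>b\<in>B. (coefficients x b + coefficients y b) * Y b) =
      (x - (\<Sum>b\<in>B. coefficients x b * Y b)) + (y - (\<Sum>b\<in>B. coefficients y b * Y b))"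
    by (simp add: distrib_right sum.distrib)
  have "x + y - (\<Sum>b\<in>B. (coefficients x b + coefficients y b) * Y b) \<in> J"
    unfolding eq by (intro ideal_add[OF J_ideal] coefficients assms)
  then have "functional g (x + y) = (\<Sum>b\<in>B. (coefficients x b + coefficients y b) * residue (g * Y b))"
    using assms by (intro functional_eqI) (auto simp: T_closed coefficients)
  then show ?thesis by (simp add: functional_def distrib_right sum.distrib)
qed

lemma functional_mult:
  assumes "t \<in> T" "x \<in> polys V"
  shows "functional g (t * x) = t * functional g x"
proof -
  have eq: "t * x - (\<Sum>b\<in>B. (t * coefficients x b) * Y b) = t * (x - (\<Sum>b\<in>B. coefficients x b * Y b))"
    by (simp add: sum_distrib_left right_diff_distrib mult.assoc)
  have "t * x - (\<Sum>b\<in>B. (t * coefficients x b) * Y b) \<in> J"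
    unfolding eq by (intro ideal_mult[OF J_ideal] coefficients assms T_polys)
  then have "functional g (t * x) = (\<Sum>b\<in>B. (t * coefficients x b) * residue (g * Y b))"
    using assms by (intro functional_eqI) (auto simp: T_closed coefficients T_polys)
  then show ?thesis by (simp add: functional_def sum_distrib_left mult.assoc)
qed

lemma functional_sum:
  "(\<And>x. x \<in> X \<Longrightarrow> f x \<in> polys V) \<Longrightarrow> functional g (\<Sum>x\<in>X. f x) = (\<Sum>x\<in>X. functional g (f x))"
  by (induction X rule: infinite_finite_induct)
     (simp_all add: functional_add functional_J ideal_zero[OF J_ideal])

lemma functional_T: "g \<in> polys V \<Longrightarrow> f \<in> polys V \<Longrightarrow> functional g f \<in> T"
  unfolding functional_def
  by (intro T_sum T_closed(6) coefficients residue_T polys_mult Y_polys)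

text \<open>The functional is represented through the residue by the element \<open>h\<close> whose
  coordinates in the basis \<open>H\<close> are the values on the dual basis
  \<open>N\<close>.\<close>

lemma linkage_lift:
  assumes g: "g \<in> polys V" and gJ: "\<And>u. u \<in> J \<Longrightarrow> g * u \<in> C <+>\<^bsub>mpoly_ring V\<^esub> \<Theta> k"
  shows "\<exists>h\<in>polys V. (\<forall>u\<in>J. h * u \<in> C) \<and> g - h \<in> C <+>\<^bsub>mpoly_ring V\<^esub> \<Theta> k"
proof -
  let ?l = "functional g"
  define h where "h = (\<Sum>e\<in>E. ?l (N e) * H e)"
  have l_T: "?l f \<in> T" if "f \<in> polys V" for f by (rule functional_T[OF g that])
  have h: "h \<in> polys V"
    unfolding h_def by (intro polys_sum polys_mult T_polys l_T N_polys H_polys)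
  \<comment> \<open>Expand \<open>f\<close> in the basis \<open>N\<close>. The error lies in
    \<open>C\<close>, hence in \<open>J\<close>, where the functional vanishes.\<close>
  have h_residue: "residue (h * f) = ?l f" if f: "f \<in> polys V" for f
  proof -
    have "residue (h * f) = (\<Sum>e\<in>E. residue (?l (N e) * (H e * f)))"
      by (simp add: h_def sum_distrib_right residue_sum mult.assoc)
    also have "\<dots> = (\<Sum>e\<in>E. residue (f * H e) * ?l (N e))"
      by (intro sum.cong refl) (simp only: residue_mult[OF l_T[OF N_polys]], simp only: mult.commute)
    also have "\<dots> = (\<Sum>e\<in>E. ?l (residue (f * H e) * N e))"
      by (intro sum.cong refl) (simp add: functional_mult residue_T f H_polys N_polys)
    also have "\<dots> = ?l (\<Sum>e\<in>E. residue (f * H e) * N e)"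
      by (rule functional_sum[symmetric]) (intro polys_mult T_polys residue_T f H_polys N_polys)
    also have "\<dots> = ?l ((f - (\<Sum>e\<in>E. residue (f * H e) * N e)) + (\<Sum>e\<in>E. residue (f * H e) * N e))"
    proof -
      have c: "f - (\<Sum>e\<in>E. residue (f * H e) * N e) \<in> C" by (rule N_expansion[OF f])
      have p: "(\<Sum>e\<in>E. residue (f * H e) * N e) \<in> polys V"
        by (intro polys_sum polys_mult T_polys residue_T f H_polys N_polys)
      show ?thesis
        using functional_add[OF ideal_subset_polys[OF C_ideal c] p] functional_J[of _ g] c C_subset_J
        by auto
    qed
    finally show ?thesis by simp
  qed
  \<comment> \<open>All coordinates \<open>residue (h * u * N e)\<close> vanish, since
    \<open>u * N e\<close> lies in \<open>J\<close>; the expansion in \<open>H\<close> then leaves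
    only an element of \<open>C\<close>.\<close>
  have "h * u \<in> C" if u: "u \<in> J" for u
  proof -
    have uV: "u \<in> polys V" by (rule ideal_subset_polys[OF J_ideal u])
    have "residue (h * u * N e) = 0" for e
      using h_residue[of "u * N e"] functional_J[OF ideal_mult_right[OF J_ideal N_polys u]] uV N_polys
      by (simp add: mult.assoc)
    then show ?thesis using H_expansion[OF polys_mult[OF h uV]] by simp
  qed
  moreover have "g - h \<in> C <+>\<^bsub>mpoly_ring V\<^esub> \<Theta> k"
  proof (rule mem_C_\<Theta>I[OF H_expansion[OF polys_diff[OF g h]] _ H_polys])
    fix e
    let ?t = "coefficients (N e)"
    \<comment> \<open>On the lifts \<open>Y b\<close> the two functionals agree exactly. They differ
      only through the part \<open>u\<close> of \<open>N e\<close> in \<open>J\<close>, on which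
      \<open>g\<close> gives values in \<open>\<Theta> k\<close>.\<close>
    define u where "u = N e - (\<Sum>b\<in>B. ?t b * Y b)"
    have u: "u \<in> J" unfolding u_def by (rule coefficients(2)[OF N_polys])
    have "residue (g * N e) = residue (g * u + (\<Sum>b\<in>B. ?t b * (g * Y b)))"
      by (rule arg_cong[where f = residue])
         (simp add: u_def right_diff_distrib sum_distrib_left mult.left_commute)
    also have "\<dots> = residue (g * u) + ?l (N e)"
      unfolding residue_add residue_sum functional_def
      by (simp add: residue_mult coefficients(1)[OF N_polys])
    finally have "residue ((g - h) * N e) = residue (g * u)"
      by (simp add: left_diff_distrib residue_diff h_residue N_polys)
    then show "residue ((g - h) * N e) \<in> \<Theta> k"
      using mem_C_\<Theta>[OF gJ[OF u] polys_1] by simp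
  qed
  ultimately show ?thesis using h by blast
qed

section \<open>The linked ideal: regularity of the differences and image in k[x_1, ..., x_n]\<close>

definition K :: "('v, 'k) mpoly set" where
  "K = colon_ideal (mpoly_ring V) C J"

lemma mem_K: "x \<in> K \<longleftrightarrow> x \<in> polys V \<and> (\<forall>u\<in>J. x * u \<in> C)"
  by (auto simp: K_def colon_ideal_def)

lemma K_ideal: "ideal K (mpoly_ring V)"
  by (rule ideal_mpoly_ringI)
     (auto simp: mem_K ideal_zero[OF C_ideal] distrib_right ideal_add[OF C_ideal]
       mult.assoc ideal_mult[OF C_ideal])

lemma C_subset_K: "C \<subseteq> K"
  using ideal_subset_polys[OF C_ideal] ideal_subset_polys[OF J_ideal] ideal_mult_right[OF C_ideal]
  by (auto simp: mem_K)

text \<open>The nontrivial half of commuting the colon with reduction modulo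
  \<open>\<Theta> k\<close>: the lift lies in \<open>K\<close>, and its error in \<open>C\<close> is
  absorbed by \<open>K\<close>.\<close>

lemma mem_K_\<Theta>:
  assumes "g \<in> polys V" "\<And>u. u \<in> J \<Longrightarrow> g * u \<in> C <+>\<^bsub>mpoly_ring V\<^esub> \<Theta> k"
  shows "g \<in> K <+>\<^bsub>mpoly_ring V\<^esub> \<Theta> k"
proof -
  obtain h where h: "h \<in> polys V" "\<forall>u\<in>J. h * u \<in> C" "g - h \<in> C <+>\<^bsub>mpoly_ring V\<^esub> \<Theta> k"
    using linkage_lift[OF assms] by blast
  then obtain c t where ct: "c \<in> C" "t \<in> \<Theta> k" "g - h = c + t" unfolding mem_ideal_sum by blast
  have "g = (h + c) + t" using ct(3) by (simp add: algebra_simps)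
  moreover have "h + c \<in> K"
    using h(1,2) ct(1) C_subset_K by (intro ideal_add[OF K_ideal]) (auto simp: mem_K)
  ultimately show ?thesis unfolding mem_ideal_sum using ct(2) by blast
qed

text \<open>Multiplying by \<open>u\<close> in \<open>J\<close> moves the question from
  \<open>K\<close> to \<open>C\<close>, where the difference cancels by \<open>C_regular\<close>;
  \<open>mem_K_\<Theta>\<close> leads back.\<close>

lemma K_regular:
  assumes k: "k < length \<theta>s" and g: "g \<in> polys V" and mem: "g * \<theta>s ! k \<in> K <+>\<^bsub>mpoly_ring V\<^esub> \<Theta> k"
  shows "g \<in> K <+>\<^bsub>mpoly_ring V\<^esub> \<Theta> k"
proof (rule mem_K_\<Theta>[OF g])
  fix u assume u: "u \<in> J"
  then have uV: "u \<in> polys V" by (rule ideal_subset_polys[OF J_ideal])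
  obtain x t where xt: "x \<in> K" "t \<in> \<Theta> k" "g * \<theta>s ! k = x + t"
    using mem unfolding mem_ideal_sum by blast
  have "g * u * \<theta>s ! k = (g * \<theta>s ! k) * u" by (simp only: mult_ac)
  also have "\<dots> = x * u + t * u" by (simp only: xt(3) distrib_right)
  finally have "g * u * \<theta>s ! k \<in> C <+>\<^bsub>mpoly_ring V\<^esub> \<Theta> k"
    unfolding mem_ideal_sum using xt(1) u ideal_mult_right[OF \<Theta>_ideal uV xt(2)] by (auto simp: mem_K)
  then show "g * u \<in> C <+>\<^bsub>mpoly_ring V\<^esub> \<Theta> k"
    by (rule C_regular[OF k polys_mult[OF g uV]])
qed

definition \<cc> :: "(nat, 'k) mpoly set" where
  "\<cc> = Idl\<^bsub>mpoly_ring {1..n}\<^esub> ((\<lambda>i. var i ^ \<alpha> i) ` {1..n})"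

lemma \<cc>_generators_polys: "(\<lambda>i. var i ^ \<alpha> i) ` {1..n} \<subseteq> (polys {1..n} :: (nat, 'k) mpoly set)"
  by (auto simp: var_power in_keys_iff lookup_single when_def split: if_splits)

lemma \<cc>_ideal: "ideal \<cc> (mpoly_ring {1..n})"
  unfolding \<cc>_def by (rule Idl_ideal[OF \<cc>_generators_polys])

lemma project_C: "x \<in> C \<Longrightarrow> project x \<in> \<cc>"
proof -
  have "C \<subseteq> {p \<in> polys V. subst (\<lambda>v. var (\<pi> v)) p \<in> \<cc>}"
    unfolding C_eq
  proof (rule Idl_minimal[OF subst_preimage_ideal[OF \<cc>_ideal]], use \<pi>_range in \<open>simp only: polys_var\<close>,
      rule image_subsetI)
    fix i assume i: "i \<in> {1..n}"
    have "var i ^ \<alpha> i \<in> \<cc>" unfolding \<cc>_def by (rule Idl_generator[OF \<cc>_generators_polys imageI[OF i]])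
    then show "var_prod (vs i) \<in> {p \<in> polys V. subst (\<lambda>v. var (\<pi> v)) p \<in> \<cc>}"
      using project_var_prod[OF i] var_prod_polys[OF vs_subset[OF i]] by (simp add: project_def)
  qed
  then show "x \<in> C \<Longrightarrow> project x \<in> \<cc>" by (auto simp: project_def)
qed

abbreviation \<Theta>_all :: "('v, 'k) mpoly set" where
  "\<Theta>_all \<equiv> \<Theta> (length \<theta>s)"

text \<open>Every variable is congruent to the first one of its block. Together with
  \<open>project_\<Theta>\<close> this identifies \<open>\<Theta>_all\<close> with the kernel of
  \<open>project\<close> on S.\<close>

lemma diff_lift_project: "f \<in> polys V \<Longrightarrow> f - lift (project f) \<in> \<Theta>_all"
proof -
  assume f: "f \<in> polys V"
  have \<theta>: "set \<theta>s \<subseteq> \<Theta>_all"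
    using Idl_generator[OF take_\<theta>s_polys[of "length \<theta>s"]] by (auto simp: \<Theta>_def)
  have "var v - var (base (\<pi> v)) \<in> \<Theta>_all" if "v \<in> V" for v
    using base_diff_mem[OF ideal_zero[OF \<Theta>_ideal] ideal_diff[OF \<Theta>_ideal] \<theta> that] .
  then have "f - subst (\<lambda>v. var (base (\<pi> v))) f \<in> \<Theta>_all"
    using base_V[OF \<pi>_range] by (intro diff_subst_mem_ideal[OF \<Theta>_ideal f]) auto
  then show ?thesis by (simp add: lift_def project_def subst_subst)
qed

text \<open>Lifting carries the power of a variable generating \<open>\<cc>\<close> to the
  corresponding block product up to \<open>\<Theta>_all\<close>, and \<open>f\<close> differs from
  the lift of its image by \<open>\<Theta>_all\<close>.\<close>

lemma mem_C_\<Theta>_all: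
  assumes f: "f \<in> polys V" "project f \<in> \<cc>"
  shows "f \<in> C <+>\<^bsub>mpoly_ring V\<^esub> \<Theta>_all"
proof -
  have I: "ideal (C <+>\<^bsub>mpoly_ring V\<^esub> \<Theta>_all) (mpoly_ring V)"
    by (rule ideal_sum_ideal[OF C_ideal \<Theta>_ideal])
  have \<Theta>: "x \<in> C <+>\<^bsub>mpoly_ring V\<^esub> \<Theta>_all" if "x \<in> \<Theta>_all" for x
    unfolding mem_ideal_sum using that ideal_zero[OF C_ideal] by force
  have C: "x \<in> C <+>\<^bsub>mpoly_ring V\<^esub> \<Theta>_all" if "x \<in> C" for x
    unfolding mem_ideal_sum using that ideal_zero[OF \<Theta>_ideal] by force
  have "\<cc> \<subseteq> {q \<in> polys {1..n}. subst (\<lambda>i. var (base i)) q \<in> C <+>\<^bsub>mpoly_ring V\<^esub> \<Theta>_all}"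
    unfolding \<cc>_def
  proof (rule Idl_minimal[OF subst_preimage_ideal[OF I]], use base_V in \<open>simp only: polys_var\<close>,
      rule image_subsetI)
    fix i assume i: "i \<in> {1..n}"
    have p: "var_prod (vs i) \<in> polys V" by (rule var_prod_polys[OF vs_subset[OF i]])
    have "var_prod (vs i) - (var_prod (vs i) - lift (project (var_prod (vs i)))) \<in> C <+>\<^bsub>mpoly_ring V\<^esub> \<Theta>_all"
      using C_generator[OF i polys_1] by (intro ideal_diff[OF I C \<Theta>[OF diff_lift_project[OF p]]]) simp
    then have "lift (var i ^ \<alpha> i) \<in> C <+>\<^bsub>mpoly_ring V\<^esub> \<Theta>_all" using project_var_prod[OF i] by simp
    moreover have "var i ^ \<alpha> i \<in> (polys {1..n} :: (nat, 'k) mpoly set)" using \<cc>_generators_polys i by blast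
    ultimately show "var i ^ \<alpha> i \<in> {q \<in> polys {1..n}. subst (\<lambda>i. var (base i)) q \<in> C <+>\<^bsub>mpoly_ring V\<^esub> \<Theta>_all}"
      unfolding lift_def by blast
  qed
  then have "lift (project f) \<in> C <+>\<^bsub>mpoly_ring V\<^esub> \<Theta>_all" using f(2) unfolding lift_def by blast
  from ideal_add[OF I \<Theta>[OF diff_lift_project[OF f(1)]] this] show ?thesis by simp
qed

text \<open>One inclusion applies \<open>project\<close> to products. For the other, the lift of
  \<open>p\<close> multiplies \<open>J\<close> into \<open>C\<close> plus all differences, so by
  \<open>mem_K_\<Theta>\<close> it lies in \<open>K\<close> up to elements that
  \<open>project\<close> kills.\<close>

lemma K_image: "rename_vars \<pi> ` K = colon_ideal (mpoly_ring {1..n}) \<cc> \<jj>"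
proof
  show "rename_vars \<pi> ` K \<subseteq> colon_ideal (mpoly_ring {1..n}) \<cc> \<jj>"
  proof (rule image_subsetI)
    fix x assume x: "x \<in> K"
    have "project x * q \<in> \<cc>" if q: "q \<in> \<jj>" for q
    proof -
      obtain u where u: "u \<in> J" "q = project u"
        using q unfolding J_image[symmetric] rename_vars_project by blast
      then have "x * u \<in> C" using x by (simp add: mem_K)
      from project_C[OF this] show ?thesis by (simp add: u(2) project_def)
    qed
    then show "rename_vars \<pi> x \<in> colon_ideal (mpoly_ring {1..n}) \<cc> \<jj>"
      using x project_polys by (simp add: colon_ideal_def mem_K rename_vars_project)
  qed
next
  show "colon_ideal (mpoly_ring {1..n}) \<cc> \<jj> \<subseteq> rename_vars \<pi> ` K"
  proof
    fix p assume "p \<in> colon_ideal (mpoly_ring {1..n}) \<cc> \<jj>"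
    then have p: "p \<in> polys {1..n}" "\<And>q. q \<in> \<jj> \<Longrightarrow> p * q \<in> \<cc>" by (auto simp: colon_ideal_def)
    have "lift p * u \<in> C <+>\<^bsub>mpoly_ring V\<^esub> \<Theta>_all" if u: "u \<in> J" for u
    proof (rule mem_C_\<Theta>_all)
      show "lift p * u \<in> polys V" by (rule polys_mult[OF lift_polys[OF p(1)] ideal_subset_polys[OF J_ideal u]])
      have "project u \<in> \<jj>" using u J_image by (auto simp: rename_vars_project)
      moreover have "project (lift p * u) = p * project u"
        using project_lift[OF p(1)] by (simp add: project_def)
      ultimately show "project (lift p * u) \<in> \<cc>" using p(2) by simp
    qed
    then have "lift p \<in> K <+>\<^bsub>mpoly_ring V\<^esub> \<Theta>_all" by (rule mem_K_\<Theta>[OF lift_polys[OF p(1)]])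
    then obtain x t where xt: "x \<in> K" "t \<in> \<Theta>_all" "lift p = x + t" unfolding mem_ideal_sum by blast
    have "p = project (x + t)" using project_lift[OF p(1)] xt(3) by simp
    also have "\<dots> = project x" using project_\<Theta>[OF xt(2)] by (simp add: project_def)
    finally show "p \<in> rename_vars \<pi> ` K" using xt(1) by (auto simp: rename_vars_project)
  qed
qed

end

section \<open>Squarefreeness of \<open>K\<close> and properness modulo the differences\<close>

context polarized_ideal
begin

lemma var_prod_vs: "i \<in> {1..n} \<Longrightarrow> var_prod (vs i) = monomial (\<Sum>v\<in>set (vs i). single v 1)"
  using distinct_vs by (simp add: prod.distinct_set_conv_list[symmetric] var_def monomial_sum del: One_nat_def)

lemma lookup_sum_single: "finite X \<Longrightarrow> lookup (\<Sum>v\<in>X. single v (Suc 0)) w = (if w \<in> X then 1 else 0)"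
  by (simp add: lookup_sum lookup_single when_def)

lemma C_conv_monomials:
  "C = Idl\<^bsub>mpoly_ring V\<^esub> (monomial ` (\<lambda>i. \<Sum>v\<in>set (vs i). single v 1) ` {1..n})"
  unfolding C_eq image_image using var_prod_vs by (intro arg_cong[where f = "genideal _"] image_cong) auto

lemma C_monomials_keys: "\<forall>m\<in>(\<lambda>i. \<Sum>v\<in>set (vs i). single v (1 :: nat)) ` {1..n}. keys m \<subseteq> V"
proof (intro ballI, elim imageE)
  fix m i assume i: "i \<in> {1..n}" and m: "m = (\<Sum>v\<in>set (vs i). single v (1 :: nat))"
  have "keys m \<subseteq> set (vs i)" by (auto simp: m in_keys_iff lookup_sum_single split: if_splits)
  then show "keys m \<subseteq> V" using vs_subset[OF i] by blast
qed

lemma C_monomial: "monomial_ideal V C"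
  unfolding monomial_ideal_def using C_conv_monomials C_monomials_keys by blast

text \<open>The generators are squarefree, so only the support of the exponent matters;
  \<open>monomial_mem_K\<close> transfers this to \<open>K\<close>.\<close>

lemma monomial_mem_C: "monomial k \<in> C \<longleftrightarrow> keys k \<subseteq> V \<and> (\<exists>i\<in>{1..n}. set (vs i) \<subseteq> keys k)"
proof -
  have "(\<exists>m'. k = (\<Sum>v\<in>set (vs i). single v 1) + m') \<longleftrightarrow> set (vs i) \<subseteq> keys k" for i
  proof
    assume "\<exists>m'. k = (\<Sum>v\<in>set (vs i). single v 1) + m'"
    then show "set (vs i) \<subseteq> keys k" by (auto simp: in_keys_iff lookup_add lookup_sum_single)
  next
    assume "set (vs i) \<subseteq> keys k"
    then have "k = (\<Sum>v\<in>set (vs i). single v 1) + (k - (\<Sum>v\<in>set (vs i). single v 1))"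
      by (intro poly_mapping_eqI) (auto simp: lookup_add lookup_minus lookup_sum_single in_keys_iff)
    then show "\<exists>m'. k = (\<Sum>v\<in>set (vs i). single v 1) + m'" ..
  qed
  then show ?thesis
    unfolding C_conv_monomials mem_Idl_monomials[OF C_monomials_keys] by simp
qed

lemma monomial_mem_K:
  "monomial k \<in> K \<longleftrightarrow> keys k \<subseteq> V \<and> (\<forall>u. monomial u \<in> J \<longrightarrow> monomial (k + u) \<in> C)"
proof
  assume "monomial k \<in> K"
  then show "keys k \<subseteq> V \<and> (\<forall>u. monomial u \<in> J \<longrightarrow> monomial (k + u) \<in> C)"
    by (auto simp: mem_K monomial_add)
next
  assume k: "keys k \<subseteq> V \<and> (\<forall>u. monomial u \<in> J \<longrightarrow> monomial (k + u) \<in> C)"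
  have "monomial k * x \<in> C" if x: "x \<in> J" for x
  proof -
    have "monomial k * x = (\<Sum>u\<in>keys x. const (lookup x u) * monomial (k + u))"
      by (subst mpoly_eq_sum_monomials[of x]) (simp add: sum_distrib_left monomial_add mult.left_commute)
    moreover have "monomial (k + u) \<in> C" if "u \<in> keys x" for u
      using k that x monomial_ideal_mem_iff[OF J_monomial, of x] by blast
    ultimately show ?thesis by (simp add: ideal_sum[OF C_ideal] ideal_mult[OF C_ideal])
  qed
  then show "monomial k \<in> K" using k by (simp add: mem_K)
qed

text \<open>Multiplication by a monomial keeps the terms of \<open>p\<close> apart, so if the
  product lies in the monomial ideal \<open>C\<close>, each of its terms does.\<close>

lemma K_monomials:
  assumes p: "p \<in> K" and k: "k \<in> keys p"
  shows "monomial k \<in> K"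
  unfolding monomial_mem_K
proof (intro conjI allI impI)
  show "keys k \<subseteq> V" using p k by (auto simp: mem_K polys_def)
  fix u assume "monomial u \<in> J"
  then have "p * monomial u \<in> C" using p by (simp add: mem_K)
  moreover have "k + u \<in> keys (p * monomial u)"
    using k by (simp add: mult.commute[of p] keys_monomial_mult add.commute[of k])
  ultimately show "monomial (k + u) \<in> C" using monomial_ideal_mem_iff[OF C_monomial] by blast
qed

text \<open>A monomial of \<open>K\<close> is a multiple of the product \<open>?rad\<close> of the
  variables in its support, which is again in \<open>K\<close> because membership depends on the
  support alone.\<close>

lemma K_squarefree: "squarefree_monomial_ideal V K"
proof -
  let ?M = "{m. keys m \<subseteq> V \<and> (\<forall>v. lookup m v \<le> 1) \<and> monomial m \<in> K}"
  let ?rad = "\<lambda>k. \<Sum>v\<in>keys k. single v (Suc 0)"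
  have M: "\<forall>m\<in>?M. keys m \<subseteq> V" by simp
  have "K = Idl\<^bsub>mpoly_ring V\<^esub> (monomial ` ?M)"
  proof
    show "Idl\<^bsub>mpoly_ring V\<^esub> (monomial ` ?M) \<subseteq> K" by (rule Idl_minimal[OF K_ideal]) auto
    show "K \<subseteq> Idl\<^bsub>mpoly_ring V\<^esub> (monomial ` ?M)"
    proof
      fix p assume p: "p \<in> K"
      have "\<exists>m\<in>?M. \<exists>m'. k = m + m'" if k: "k \<in> keys p" for k
      proof (intro bexI exI)
        have keys: "keys (?rad k) = keys k" by (auto simp: in_keys_iff lookup_sum_single split: if_splits)
        have "monomial k \<in> K" by (rule K_monomials[OF p k])
        then have "monomial (?rad k) \<in> K" by (simp add: monomial_mem_K monomial_mem_C keys_add_nat keys)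
        then show "?rad k \<in> ?M" using keys by (simp add: monomial_mem_K lookup_sum_single)
        show "k = ?rad k + (k - ?rad k)"
          by (rule poly_mapping_eqI) (auto simp: lookup_add lookup_minus lookup_sum_single in_keys_iff)
      qed
      then show "p \<in> Idl\<^bsub>mpoly_ring V\<^esub> (monomial ` ?M)"
        unfolding mem_Idl_monomials[OF M] using p by (simp add: mem_K)
    qed
  qed
  then show ?thesis unfolding squarefree_monomial_ideal_def by (intro exI[of _ ?M] conjI) auto
qed

text \<open>Evaluation at the origin kills all differences and, since no term of an element of
  \<open>K\<close> is constant, also \<open>K\<close>; it does not kill 1.\<close>

lemma K_\<Theta>_proper:
  assumes "1 \<notin> K"
  shows "K <+>\<^bsub>mpoly_ring V\<^esub> \<Theta> k \<noteq> polys V"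
proof
  let ?z = "subst (\<lambda>_. 0) :: ('v, 'k) mpoly \<Rightarrow> ('v, 'k) mpoly"
  assume "K <+>\<^bsub>mpoly_ring V\<^esub> \<Theta> k = polys V"
  then have "1 \<in> K <+>\<^bsub>mpoly_ring V\<^esub> \<Theta> k" by simp
  then obtain x t where xt: "x \<in> K" "t \<in> \<Theta> k" "1 = x + t" unfolding mem_ideal_sum by blast
  have "\<Theta> k \<subseteq> {p \<in> polys V. ?z p = 0}"
    unfolding \<Theta>_def take_\<theta>s
    using pair_diffs_polys[OF pairs_subset] set_take_subset[of k pairs]
    by (intro Idl_minimal[OF subst_kernel_ideal]) auto
  then have "?z t = 0" using xt(2) by blast
  moreover have "?z x = 0"
    unfolding subst_def
  proof (rule sum.neutral, rule ballI)
    fix m assume m: "m \<in> keys x"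
    have "m \<noteq> 0" using K_monomials[OF xt(1) m] assms by auto
    then have "\<exists>v. v \<in> keys m" by (metis lookup_zero not_in_keys_iff_lookup_eq_zero poly_mapping_eqI)
    then obtain v where v: "v \<in> keys m" ..
    then have "subst_monomial (\<lambda>_. 0 :: ('v, 'k) mpoly) m = 0"
      unfolding subst_monomial_def by (intro prod_zero) (auto simp: in_keys_iff zero_power intro!: bexI[of _ v])
    then show "const (lookup x m) * subst_monomial (\<lambda>_. 0 :: ('v, 'k) mpoly) m = 0" by simp
  qed
  ultimately have "?z (x + t) = 0" by simp
  then show False using xt(3) by (metis subst_1 zero_neq_one)
qed

end

section \<open>Finiteness of heights\<close>

text \<open>Gaussian elimination: an unknown \<open>j\<close> occurring in equation \<open>x\<close>
  is eliminated from the other equations and recovered at the end as \<open>- s\<close>.\<close>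

lemma homogeneous_system:
  fixes f :: "'i \<Rightarrow> 'x \<Rightarrow> 'k::field"
  assumes "finite X" "finite I" "card X < card I"
  shows "\<exists>c. (\<exists>i\<in>I. c i \<noteq> 0) \<and> (\<forall>x\<in>X. (\<Sum>i\<in>I. c i * f i x) = 0)"
  using assms
proof (induction X arbitrary: I f rule: finite_induct)
  case empty
  then obtain i where "i \<in> I" by fastforce
  then show ?case by (intro exI[of _ "\<lambda>_. 1"]) auto
next
  case (insert x X)
  show ?case
  proof (cases "\<exists>j\<in>I. f j x \<noteq> 0")
    case False
    have "card X < card I" using insert by simp
    then obtain c where c: "\<exists>i\<in>I. c i \<noteq> 0" "\<forall>x\<in>X. (\<Sum>i\<in>I. c i * f i x) = 0"
      using insert.IH[OF insert.prems(1)] by blast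
    moreover have "(\<Sum>i\<in>I. c i * f i x) = 0" using False by (intro sum.neutral) auto
    ultimately show ?thesis by auto
  next
    case True
    then obtain j where j: "j \<in> I" "f j x \<noteq> 0" by blast
    let ?I = "I - {j}"
    have "card X < card ?I" using insert j by simp
    then obtain c where c: "\<exists>i\<in>?I. c i \<noteq> 0"
      "\<forall>y\<in>X. (\<Sum>i\<in>?I. c i * (f i y - f i x / f j x * f j y)) = 0"
      using insert.IH[of ?I "\<lambda>i y. f i y - f i x / f j x * f j y"] insert.prems(1) by auto
    define s where "s = (\<Sum>i\<in>?I. c i * (f i x / f j x))"
    define d where "d = c(j := - s)"
    have split: "(\<Sum>i\<in>I. d i * f i y) = (\<Sum>i\<in>?I. c i * f i y) - s * f j y" for y
    proof -
      have "(\<Sum>i\<in>I. d i * f i y) = d j * f j y + (\<Sum>i\<in>?I. d i * f i y)"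
        by (rule sum.remove[OF insert.prems(1) j(1)])
      also have "(\<Sum>i\<in>?I. d i * f i y) = (\<Sum>i\<in>?I. c i * f i y)"
        by (rule sum.cong) (auto simp: d_def)
      finally show ?thesis by (simp add: d_def)
    qed
    have expand: "(\<Sum>i\<in>?I. c i * (f i y - f i x / f j x * f j y)) = (\<Sum>i\<in>?I. c i * f i y) - s * f j y" for y
      by (simp add: s_def right_diff_distrib sum_subtractf sum_distrib_right mult.assoc)
    have "(\<Sum>i\<in>I. d i * f i y) = 0" if "y \<in> insert x X" for y
    proof (cases "y = x")
      case True
      have "s * f j x = (\<Sum>i\<in>?I. c i * f i x)"
        unfolding s_def sum_distrib_right using j(2) by (intro sum.cong) auto
      then show ?thesis by (simp add: split True)
    next
      case False
      then show ?thesis using c(2) that expand[of y] split[of y] by auto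
    qed
    moreover have "\<exists>i\<in>I. d i \<noteq> 0" using c(1) by (auto simp: d_def)
    ultimately show ?thesis by blast
  qed
qed

lemma lookup_const_mult [simp]: "lookup (const c * p) m = c * lookup (p :: ('v, 'k::field) mpoly) m"
  using polys_UNIV[of p]
proof (induction p rule: polys_induct_monomial)
  case (monomial d k)
  have "const c * (const d * monomial k) = single k (c * d)" "const d * monomial k = single k d"
    by (simp_all add: single_conv_const_monomial const_mult mult.assoc)
  then show ?case by (simp add: lookup_single when_def)
qed (simp add: distrib_left lookup_add)

text \<open>A prime chain yields algebraically independent elements: factoring out the least power of
  \<open>a i\<close> from a relation modulo \<open>Q i\<close> and then setting \<open>a i\<close> to zero gives a relation modulo
  \<open>Q (Suc i)\<close>. Counting monomials then bounds the length of the chain.\<close>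

lemma prime_chain_independent:
  fixes Q :: "nat \<Rightarrow> ('v, 'k::field) mpoly set"
  assumes Q: "\<And>i. i \<le> Suc N \<Longrightarrow> primeideal (Q i) (mpoly_ring V)"
    and sub: "\<And>i. i \<le> N \<Longrightarrow> Q i \<subseteq> Q (Suc i)"
    and a: "\<And>i. i \<le> N \<Longrightarrow> a i \<in> Q (Suc i) - Q i"
    and i: "i \<le> Suc N"
  shows "\<forall>F c. finite F \<longrightarrow> (\<forall>e\<in>F. (\<forall>j<i. e j = 0) \<and> (\<forall>j>N. e j = undefined)) \<longrightarrow>
    (\<Sum>e\<in>F. const (c e) * (\<Prod>j\<le>N. a j ^ e j)) \<in> Q i \<longrightarrow> (\<forall>e\<in>F. c e = 0)"
  using i
proof (induction rule: inc_induct)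
  case base
  show ?case
  proof (intro allI impI ballI)
    fix F :: "(nat \<Rightarrow> nat) set" and c e
    assume F: "finite F" "\<forall>e\<in>F. (\<forall>j<Suc N. e j = 0) \<and> (\<forall>j>N. e j = undefined)"
      and mem: "(\<Sum>e\<in>F. const (c e) * (\<Prod>j\<le>N. a j ^ e j)) \<in> Q (Suc N)" and e: "e \<in> F"
    \<comment> \<open>All entries are forced, to 0 up to \<open>N\<close> and to
      \<open>undefined\<close> beyond, so \<open>F\<close> consists of one exponent, with product
      1.\<close>
    have "e' = e" if "e' \<in> F" for e'
    proof
      fix j show "e' j = e j" using bspec[OF F(2) that] bspec[OF F(2) e] by (cases "j < Suc N") auto
    qed
    then have "F = {e}" using e by blast
    moreover have "(\<Prod>j\<le>N. a j ^ e j) = 1" using bspec[OF F(2) e] by (intro prod.neutral) simp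
    ultimately have c: "const (c e) \<in> Q (Suc N)" using mem by simp
    interpret Q: primeideal "Q (Suc N)" "mpoly_ring V" by (rule Q) simp
    have I: "ideal (Q (Suc N)) (mpoly_ring V)" by (rule Q.is_ideal)
    show "c e = 0"
    proof (rule ccontr)
      assume "c e \<noteq> 0"
      then have "const (inverse (c e)) * const (c e) = (1 :: ('v, 'k) mpoly)"
        by (simp add: const_mult[symmetric])
      then have "1 \<in> Q (Suc N)" using ideal_mult[OF I polys_const c] by metis
      then show False using Q.one_imp_carrier Q.I_notcarr by simp
    qed
  qed
next
  case (step i)
  have iN: "i \<le> N" using step.hyps by simp
  interpret Qi: primeideal "Q i" "mpoly_ring V" by (rule Q) (use iN in simp)
  interpret QS: primeideal "Q (Suc i)" "mpoly_ring V" by (rule Q) (use iN in simp)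
  have I: "ideal (Q i) (mpoly_ring V)" "ideal (Q (Suc i)) (mpoly_ring V)"
    by (rule Qi.is_ideal, rule QS.is_ideal)
  have a_polys: "a j \<in> polys V" if "j \<le> N" for j
  proof -
    have "ideal (Q (Suc j)) (mpoly_ring V)" using Q[of "Suc j"] that by (simp add: primeideal_def)
    then show ?thesis using a[OF that] ideal_subset_polys by blast
  qed
  have power: "x \<in> Q i" if "a i ^ s * x \<in> Q i" "x \<in> polys V" for s x
    using that
  proof (induction s)
    case (Suc s)
    have "a i ^ s * x \<in> polys V"
      using Suc.prems(2) a_polys[OF iN] by simp
    then have "a i \<in> Q i \<or> a i ^ s * x \<in> Q i"
      using Qi.I_prime[of "a i" "a i ^ s * x"] Suc.prems a_polys[OF iN] by (simp add: mult.assoc)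
    then show ?case using a[OF iN] Suc by blast
  qed simp
  let ?P = "\<lambda>e. \<Prod>j\<le>N. a j ^ e j"
  have P_polys: "?P e \<in> polys V" for e
  proof (rule polys_prod)
    fix j assume "j \<in> {..N}"
    then show "a j ^ e j \<in> polys V" using a_polys[of j] by simp
  qed
  have P_upd: "?P (e(i := l + r)) = a i ^ l * ?P (e(i := r))" for e l r
  proof -
    have *: "?P (e(i := q)) = a i ^ q * (\<Prod>j\<in>{..N} - {i}. a j ^ e j)" for q
    proof -
      have "?P (e(i := q)) = a i ^ q * (\<Prod>j\<in>{..N} - {i}. a j ^ (e(i := q)) j)"
        using iN by (subst prod.remove[of _ i]) auto
      then show ?thesis by simp
    qed
    show ?thesis unfolding * by (simp add: power_add mult.assoc)
  qed
  show ?case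
  proof (intro allI impI, rule ccontr)
    fix F :: "(nat \<Rightarrow> nat) set" and c
    assume F: "finite F" "\<forall>e\<in>F. (\<forall>j<i. e j = 0) \<and> (\<forall>j>N. e j = undefined)"
      and mem: "(\<Sum>e\<in>F. const (c e) * ?P e) \<in> Q i" and "\<not> (\<forall>e\<in>F. c e = 0)"
    define G where "G = {e \<in> F. c e \<noteq> 0}"
    have G: "finite G" "G \<noteq> {}" using F(1) \<open>\<not> _\<close> by (auto simp: G_def)
    define s where "s = Min ((\<lambda>e. e i) ` G)"
    have s_le: "s \<le> e i" if "e \<in> G" for e using G that by (auto simp: s_def)
    have "s \<in> (\<lambda>e. e i) ` G" unfolding s_def using G by (intro Min_in) auto
    then obtain e0 where e0: "e0 \<in> G" "e0 i = s" by auto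
    \<comment> \<open>The terms outside \<open>G0\<close> keep a factor \<open>a i\<close> after
      division by \<open>a i ^ s\<close>, and hence lie in \<open>Q (Suc i)\<close>.\<close>
    define G0 where "G0 = {e \<in> G. e i = s}"
    have split: "?P e = a i ^ s * ?P (e(i := e i - s))" if "e \<in> G" for e
      using P_upd[of e s "e i - s"] s_le[OF that] by simp
    have "(\<Sum>e\<in>F. const (c e) * ?P e) = (\<Sum>e\<in>G. const (c e) * ?P e)"
      unfolding G_def using F(1) by (intro sum.mono_neutral_right) auto
    also have "\<dots> = a i ^ s * (\<Sum>e\<in>G. const (c e) * ?P (e(i := e i - s)))"
      unfolding sum_distrib_left
    proof (rule sum.cong[OF refl])
      fix e assume "e \<in> G"
      show "const (c e) * ?P e = a i ^ s * (const (c e) * ?P (e(i := e i - s)))"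
        by (subst split[OF \<open>e \<in> G\<close>]) (rule mult.left_commute)
    qed
    finally have "a i ^ s * (\<Sum>e\<in>G. const (c e) * ?P (e(i := e i - s))) \<in> Q i"
      using mem by (simp only:)
    then have "(\<Sum>e\<in>G. const (c e) * ?P (e(i := e i - s))) \<in> Q i"
      by (rule power) (intro polys_sum polys_mult polys_const P_polys)
    then have 1: "(\<Sum>e\<in>G. const (c e) * ?P (e(i := e i - s))) \<in> Q (Suc i)" using sub[OF iN] by blast
    have "const (c e) * ?P (e(i := e i - s)) \<in> Q (Suc i)" if e: "e \<in> G - G0" for e
    proof -
      have "e i - s = Suc (e i - s - 1)" using e s_le[of e] by (auto simp: G0_def)
      then have "?P (e(i := e i - s)) = ?P (e(i := e i - s - 1)) * a i"
        using P_upd[of e 1 "e i - s - 1"] by (simp add: mult.commute)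
      then have "const (c e) * ?P (e(i := e i - s)) = (const (c e) * ?P (e(i := e i - s - 1))) * a i"
        by (simp only: mult.assoc)
      moreover have "\<dots> \<in> Q (Suc i)"
        by (rule ideal_mult[OF I(2) polys_mult[OF polys_const P_polys]]) (use a[OF iN] in blast)
      ultimately show ?thesis by (simp only:)
    qed
    then have 2: "(\<Sum>e\<in>G - G0. const (c e) * ?P (e(i := e i - s))) \<in> Q (Suc i)"
      by (rule ideal_sum[OF I(2)])
    have "(\<Sum>e\<in>G. const (c e) * ?P (e(i := e i - s))) - (\<Sum>e\<in>G - G0. const (c e) * ?P (e(i := e i - s))) =
        (\<Sum>e\<in>G0. const (c e) * ?P (e(i := e i - s)))"
      using G(1) by (subst sum.subset_diff[of G0 G]) (auto simp: G0_def)
    \<comment> \<open>The induction hypothesis needs entry \<open>i\<close> to be 0; putting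
      \<open>s\<close> back recovers the exponent that indexes the old coefficient.\<close>
    also have "\<dots> = (\<Sum>e\<in>G0. const (c ((e(i := 0))(i := s))) * ?P (e(i := 0)))"
    proof (rule sum.cong[OF refl])
      fix e assume "e \<in> G0"
      then have "e i - s = 0" "(e(i := 0))(i := s) = e" by (auto simp: G0_def)
      then show "const (c e) * ?P (e(i := e i - s)) = const (c ((e(i := 0))(i := s))) * ?P (e(i := 0))"
        by simp
    qed
    also have "\<dots> = (\<Sum>e\<in>(\<lambda>e. e(i := 0)) ` G0. const (c (e(i := s))) * ?P e)"
    proof (rule sum.reindex_cong[symmetric, OF _ refl refl])
      show "inj_on (\<lambda>e. e(i := 0)) G0"
      proof (rule inj_onI)
        fix x y assume xy: "x \<in> G0" "y \<in> G0" "x(i := 0) = y(i := 0)"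
        show "x = y"
        proof
          fix j show "x j = y j" using xy(1,2) fun_cong[OF xy(3), of j] by (cases "j = i") (auto simp: G0_def)
        qed
      qed
    qed
    finally have mem': "(\<Sum>e\<in>(\<lambda>e. e(i := 0)) ` G0. const (c (e(i := s))) * ?P e) \<in> Q (Suc i)"
      using ideal_diff[OF I(2) 1 2] by simp
    have "finite ((\<lambda>e. e(i := 0)) ` G0)" using G(1) by (simp add: G0_def)
    moreover have "\<forall>e\<in>(\<lambda>e. e(i := 0)) ` G0. (\<forall>j<Suc i. e j = 0) \<and> (\<forall>j>N. e j = undefined)"
      using F(2) iN by (auto simp: G0_def G_def less_Suc_eq)
    ultimately have "\<forall>e\<in>(\<lambda>e. e(i := 0)) ` G0. c (e(i := s)) = 0"
      using step.IH mem' by (elim allE[of _ "(\<lambda>e. e(i := 0)) ` G0"] allE[of _ "\<lambda>e. c (e(i := s))"] impE)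
    then have "c ((e0(i := 0))(i := s)) = 0" using e0 by (auto simp: G0_def)
    moreover have "(e0(i := 0))(i := s) = e0" using e0(2) by auto
    ultimately show False using e0(1) by (simp add: G_def)
  qed
qed

definition degree_le :: "nat \<Rightarrow> ('v, 'k::field) mpoly set" where
  "degree_le d = {p. \<forall>m\<in>keys p. total_degree m \<le> d}"

lemma degree_le_mult: "p \<in> degree_le d \<Longrightarrow> q \<in> degree_le d' \<Longrightarrow> p * q \<in> degree_le (d + d')"
  using keys_mult[of p q] by (fastforce simp: degree_le_def total_degree_add intro: add_mono)

lemma degree_le_1: "1 \<in> degree_le d"
  by (simp add: degree_le_def)

lemma degree_le_power: "p \<in> degree_le d \<Longrightarrow> p ^ k \<in> degree_le (k * d)"
  by (induction k) (auto simp: degree_le_1 intro: degree_le_mult)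

lemma degree_le_prod:
  "finite X \<Longrightarrow> (\<And>x. x \<in> X \<Longrightarrow> f x \<in> degree_le (d x)) \<Longrightarrow> (\<Prod>x\<in>X. f x) \<in> degree_le (\<Sum>x\<in>X. d x)"
  by (induction X rule: finite_induct) (auto simp: degree_le_1 intro: degree_le_mult)

lemma degree_le_mono: "p \<in> degree_le d \<Longrightarrow> d \<le> d' \<Longrightarrow> p \<in> degree_le d'"
  by (auto simp: degree_le_def intro: order_trans)

lemma degree_le_ex: "\<exists>d. p \<in> degree_le d"
  unfolding degree_le_def
  by (intro exI[of _ "Max (total_degree ` keys p)"]) simp

lemma card_bounded_exponents:
  assumes "finite V"
  shows "finite {m :: 'v \<Rightarrow>\<^sub>0 nat. keys m \<subseteq> V \<and> total_degree m \<le> d}" (is "finite ?X")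
    and "card {m :: 'v \<Rightarrow>\<^sub>0 nat. keys m \<subseteq> V \<and> total_degree m \<le> d} \<le> Suc d ^ card V"
proof -
  let ?r = "\<lambda>m :: 'v \<Rightarrow>\<^sub>0 nat. restrict (lookup m) V"
  have inj: "inj_on ?r ?X"
  proof (intro inj_onI poly_mapping_eqI)
    fix m m' v assume m: "m \<in> ?X" "m' \<in> ?X" "?r m = ?r m'"
    show "lookup m v = lookup m' v"
    proof (cases "v \<in> V")
      case True
      then show ?thesis using fun_cong[OF m(3), of v] by simp
    next
      case False
      then have "v \<notin> keys m" "v \<notin> keys m'" using m by auto
      then show ?thesis by (simp add: in_keys_iff)
    qed
  qed
  have "lookup m v \<le> d" if "m \<in> ?X" for m v
  proof (cases "v \<in> keys m")
    case True
    then have "lookup m v \<le> total_degree m" unfolding total_degree_def by (intro member_le_sum) auto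
    then show ?thesis using that by simp
  qed (simp add: in_keys_iff)
  then have sub: "?r ` ?X \<subseteq> (\<Pi>\<^sub>E v\<in>V. {..d})" by auto
  have fin: "finite (\<Pi>\<^sub>E v\<in>V. {..d})" using assms by (intro finite_PiE) auto
  show "finite ?X" by (rule inj_on_finite[OF inj sub fin])
  have "card ?X \<le> card (\<Pi>\<^sub>E v\<in>V. {..d})" by (rule card_inj_on_le[OF inj sub fin])
  then show "card ?X \<le> Suc d ^ card V" using assms by (simp add: card_PiE)
qed

text \<open>A longer chain would give \<open>card V + 1\<close> algebraically independent elements,
  but their products eventually outnumber the monomials in \<open>card V\<close> variables of
  comparable degree.\<close>

lemma prime_chain_length:
  fixes Q :: "nat \<Rightarrow> ('v, 'k::field) mpoly set"
  assumes V: "finite V"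
    and Q: "\<forall>i\<le>m. primeideal (Q i) (mpoly_ring V)" "\<forall>i<m. Q i \<subset> Q (Suc i)"
  shows "m \<le> card V"
proof (rule ccontr)
  assume "\<not> m \<le> card V"
  define N where "N = card V"
  have N: "Suc N \<le> m" using \<open>\<not> _\<close> by (simp add: N_def)
  have "\<forall>i. \<exists>x. i \<le> N \<longrightarrow> x \<in> Q (Suc i) - Q i"
  proof
    fix i
    show "\<exists>x. i \<le> N \<longrightarrow> x \<in> Q (Suc i) - Q i"
    proof (cases "i \<le> N")
      case True
      then have "Q i \<subset> Q (Suc i)" using Q(2) N by simp
      then show ?thesis by blast
    qed simp
  qed
  then obtain a where "\<forall>i. i \<le> N \<longrightarrow> a i \<in> Q (Suc i) - Q i" by metis
  then have a: "a i \<in> Q (Suc i) - Q i" if "i \<le> N" for i using that by blast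
  have a_polys: "a i \<in> polys V" if "i \<le> N" for i
  proof -
    have "ideal (Q (Suc i)) (mpoly_ring V)" using Q(1) N that by (simp add: primeideal_def)
    then show ?thesis using a[OF that] ideal_subset_polys by blast
  qed
  have "\<forall>i. \<exists>d. a i \<in> degree_le d" using degree_le_ex by blast
  then obtain d' where d': "\<And>i. a i \<in> degree_le (d' i)" by metis
  define d where "d = (\<Sum>i\<le>N. d' i)"
  have d: "a i \<in> degree_le d" if "i \<le> N" for i
    by (rule degree_le_mono[OF d']) (use that in \<open>auto simp: d_def intro!: member_le_sum\<close>)
  \<comment> \<open>Exponents below \<open>D\<close> give D^(N+1) products of degree at most
    \<open>M\<close>. There are at most (M+1)^N monomials of such degree, and this is at most D^N *
    (Suc N * d + 1)^N; \<open>D\<close> is taken just larger than the last factor.\<close>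
  define D where "D = Suc (Suc (Suc N * d) ^ N)"
  define M where "M = Suc N * D * d"
  define I where "I = (\<Pi>\<^sub>E j\<in>{..N}. {..<D})"
  define X where "X = {m :: 'v \<Rightarrow>\<^sub>0 nat. keys m \<subseteq> V \<and> total_degree m \<le> M}"
  let ?P = "\<lambda>e. \<Prod>j\<le>N. a j ^ e j"
  have I: "finite I" "card I = D ^ Suc N" by (simp_all add: I_def finite_PiE card_PiE)
  have "M = D * (Suc N * d)" "1 \<le> D" by (simp_all only: M_def mult_ac) (simp add: D_def)
  then have "Suc M \<le> D * Suc (Suc N * d)" unfolding mult_Suc_right by linarith
  then have "Suc M ^ N \<le> D ^ N * Suc (Suc N * d) ^ N"
    unfolding power_mult_distrib[symmetric] by (rule power_mono) simp
  also have "\<dots> < D ^ N * D" by (intro mult_strict_left_mono) (simp_all add: D_def)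
  finally have "Suc M ^ N < D ^ Suc N" by (simp add: mult.commute)
  then have "card X < card I"
    using card_bounded_exponents(2)[OF V, of M] by (simp add: I X_def N_def)
  moreover have "finite X" unfolding X_def by (rule card_bounded_exponents(1)[OF V])
  ultimately obtain c where c: "\<exists>e\<in>I. c e \<noteq> 0" "\<forall>x\<in>X. (\<Sum>e\<in>I. c e * lookup (?P e) x) = 0"
    using homogeneous_system[of X I "\<lambda>e. lookup (?P e)"] I(1) by blast
  have P: "?P e \<in> polys V" "?P e \<in> degree_le M" if e: "e \<in> I" for e
  proof -
    show "?P e \<in> polys V" by (intro polys_prod polys_power a_polys) simp
    have "?P e \<in> degree_le (\<Sum>j\<le>N. e j * d)"
      by (intro degree_le_prod degree_le_power d) auto
    moreover have "(\<Sum>j\<le>N. e j * d) \<le> (\<Sum>j\<le>N. D * d)"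
      using e by (intro sum_mono mult_right_mono) (auto simp: I_def PiE_def Pi_def intro: less_imp_le)
    then have "(\<Sum>j\<le>N. e j * d) \<le> M" by (simp add: M_def algebra_simps)
    ultimately show "?P e \<in> degree_le M" by (rule degree_le_mono)
  qed
  have "(\<Sum>e\<in>I. const (c e) * ?P e) = 0"
  proof (rule poly_mapping_eqI)
    fix x
    have "lookup (\<Sum>e\<in>I. const (c e) * ?P e) x = (\<Sum>e\<in>I. c e * lookup (?P e) x)"
      by (simp add: lookup_sum)
    also have "\<dots> = 0"
    proof (cases "x \<in> X")
      case True
      then show ?thesis using c(2) by blast
    next
      case False
      have "lookup (?P e) x = 0" if "e \<in> I" for e
      proof (rule ccontr)
        assume "lookup (?P e) x \<noteq> 0"
        then have "x \<in> keys (?P e)" by (simp add: in_keys_iff)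
        then show False using False P[OF that] by (auto simp: X_def polys_def degree_le_def)
      qed
      then show ?thesis by (intro sum.neutral) simp
    qed
    finally show "lookup (\<Sum>e\<in>I. const (c e) * ?P e) x = lookup 0 x" by simp
  qed
  moreover have "0 \<in> Q 0"
  proof (rule ideal_zero)
    show "ideal (Q 0) (mpoly_ring V)" using Q(1) by (simp add: primeideal_def)
  qed
  ultimately have "(\<Sum>e\<in>I. const (c e) * ?P e) \<in> Q 0" by simp
  moreover have "\<forall>e\<in>I. (\<forall>j<0. e j = 0) \<and> (\<forall>j>N. e j = undefined)"
    by (auto simp: I_def PiE_def extensional_def)
  moreover have "\<forall>F c. finite F \<longrightarrow> (\<forall>e\<in>F. (\<forall>j<0. e j = 0) \<and> (\<forall>j>N. e j = undefined)) \<longrightarrow>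
      (\<Sum>e\<in>F. const (c e) * ?P e) \<in> Q 0 \<longrightarrow> (\<forall>e\<in>F. c e = 0)"
  proof (rule prime_chain_independent[where V = V])
    show "primeideal (Q i) (mpoly_ring V)" if "i \<le> Suc N" for i using Q(1) N that by simp
    show "Q i \<subseteq> Q (Suc i)" if "i \<le> N" for i
    proof -
      have "Q i \<subset> Q (Suc i)" using Q(2) N that by simp
      then show ?thesis by blast
    qed
  qed (use a in simp_all)
  ultimately have "\<forall>e\<in>I. c e = 0" using I(1) by blast
  then show False using c(1) by blast
qed

lemma prime_height_le: "finite V \<Longrightarrow> prime_height (mpoly_ring V :: ('v, 'k::field) mpoly ring) P \<le> enat (card V)"
  unfolding prime_height_def
proof (rule Sup_least, elim CollectE exE conjE)
  fix x m and Q :: "nat \<Rightarrow> ('v, 'k) mpoly set"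
  assume V: "finite V" and x: "x = enat m"
    and Q: "\<forall>i\<le>m. primeideal (Q i) (mpoly_ring V)" "\<forall>i<m. Q i \<subset> Q (Suc i)"
  show "x \<le> enat (card V)" using prime_chain_length[OF V Q] by (simp add: x)
qed

lemma subst_0_const:
  fixes p :: "('v, 'k::field) mpoly"
  shows "\<exists>c. subst (\<lambda>_. 0 :: ('w, 'k) mpoly) p = const c"
  using polys_UNIV[of p]
proof (induction p rule: polys_induct)
  case (add p q)
  then obtain c d where "subst (\<lambda>_. 0 :: ('w, 'k) mpoly) p = const c" "subst (\<lambda>_. 0 :: ('w, 'k) mpoly) q = const d"
    by blast
  then show ?case by (intro exI[of _ "c + d"]) (simp add: const_add)
next
  case (var v p)
  show ?case by (intro exI[of _ 0]) simp
qed auto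

lemma const_eq_0_iff: "const c = (0 :: ('v, 'k::field) mpoly) \<longleftrightarrow> c = 0"
proof
  assume "const c = (0 :: ('v, 'k) mpoly)"
  then have "lookup (const c :: ('v, 'k) mpoly) 0 = lookup (0 :: ('v, 'k) mpoly) 0" by simp
  then show "c = 0" by (simp add: const_def)
qed simp

text \<open>Values at the origin are constants of the field \<open>k\<close>. This prime contains
  \<open>C\<close> and so bounds its height from above.\<close>

lemma origin_primeideal:
  "primeideal {p \<in> polys V. subst (\<lambda>_. 0 :: ('v, 'k::field) mpoly) p = 0} (mpoly_ring V :: ('v, 'k) mpoly ring)"
proof (rule primeidealI[OF subst_kernel_ideal mpoly_ring_cring])
  let ?z = "subst (\<lambda>_. 0) :: ('v, 'k) mpoly \<Rightarrow> ('v, 'k) mpoly"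
  have "?z 1 \<noteq> 0" by simp
  then show "carrier (mpoly_ring V) \<noteq> {p \<in> polys V. ?z p = 0}"
    unfolding mpoly_ring_simps using polys_1 by blast
  fix a b :: "('v, 'k) mpoly"
  assume "a \<in> carrier (mpoly_ring V)" "b \<in> carrier (mpoly_ring V)"
    "a \<otimes>\<^bsub>mpoly_ring V\<^esub> b \<in> {p \<in> polys V. ?z p = 0}"
  then have ab: "a \<in> polys V" "b \<in> polys V" "?z a * ?z b = 0" by auto
  obtain c d where cd: "?z a = const c" "?z b = const d"
    using subst_0_const[of a] subst_0_const[of b] by blast
  then have "const (c * d) = (0 :: ('v, 'k) mpoly)" using ab(3) by (simp add: const_mult)
  then have "c = 0 \<or> d = 0" unfolding const_eq_0_iff by simp
  then show "a \<in> {p \<in> polys V. ?z p = 0} \<or> b \<in> {p \<in> polys V. ?z p = 0}"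
    using ab cd by auto
qed

section \<open>Properness of the linked ideal\<close>

context polarized_ideal
begin

lemma finite_V: "finite V"
proof (rule finite_subset)
  show "V \<subseteq> (\<Union>i\<in>{1..n}. set (vs i))"
  proof
    fix v assume v: "v \<in> V"
    have "v \<in> set (vs (\<pi> v))" using set_vs[OF \<pi>_range[OF v]] v by blast
    then show "v \<in> (\<Union>i\<in>{1..n}. set (vs i))" using \<pi>_range[OF v] by blast
  qed
qed simp

text \<open>The unit ideal has infinite height by convention, whereas the height of \<open>C\<close>
  is at most that of the origin, hence at most \<open>card V\<close>.\<close>

lemma K_proper:
  assumes height: "ideal_height (mpoly_ring V) K = ideal_height (mpoly_ring V) C"
  shows "1 \<notin> K"
proof
  let ?P = "{p \<in> polys V. subst (\<lambda>_. 0 :: ('v, 'k) mpoly) p = 0}"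
  assume "1 \<in> K"
  then have "polys V \<subseteq> K" using ideal_mult_right[OF K_ideal _ \<open>1 \<in> K\<close>] by auto
  have "\<not> (primeideal P (mpoly_ring V) \<and> K \<subseteq> P)" for P
  proof
    assume P: "primeideal P (mpoly_ring V) \<and> K \<subseteq> P"
    then interpret P: primeideal P "mpoly_ring V" by simp
    show False using P.one_imp_carrier P.I_notcarr P \<open>1 \<in> K\<close> by auto
  qed
  then have "{prime_height (mpoly_ring V) P | P. primeideal P (mpoly_ring V) \<and> K \<subseteq> P} = {}" by blast
  then have "ideal_height (mpoly_ring V) K = \<infinity>"
    unfolding ideal_height_def by (simp only: Inf_empty top_enat_def)
  moreover have "C \<subseteq> ?P"
    unfolding C_eq
  proof (rule Idl_minimal[OF subst_kernel_ideal], rule image_subsetI)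
    fix i assume i: "i \<in> {1..n}"
    then have "subst (\<lambda>_. 0 :: ('v, 'k) mpoly) (var_prod (vs i)) = 0"
      using vs_nonempty[OF i] by (cases "vs i") auto
    then show "var_prod (vs i) \<in> ?P" using var_prod_polys[OF vs_subset[OF i]] by simp
  qed
  then have "ideal_height (mpoly_ring V) C \<le> prime_height (mpoly_ring V) ?P"
    unfolding ideal_height_def using origin_primeideal by (intro Inf_lower) blast
  then have "ideal_height (mpoly_ring V) C \<le> enat (card V)"
    using prime_height_le[OF finite_V] by (rule order_trans)
  ultimately show False using height by auto
qed

end

theorem proposition10p4:
  fixes n :: nat
    and A :: "nat \<Rightarrow> 'a set" and V :: "'a set"
    and \<alpha> :: "nat \<Rightarrow> nat" and \<pi> :: "'a \<Rightarrow> nat"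
    and \<cc> \<jj> \<kk> :: "(nat, 'k::field) mpoly set"
    and C J K :: "('a, 'k) mpoly set"
  assumes A_finite: "\<And>i. i \<in> {1..n} \<Longrightarrow> finite (A i)"
    and A_nonempty: "\<And>i. i \<in> {1..n} \<Longrightarrow> A i \<noteq> {}"
    and A_disjoint: "disjoint_family_on A {1..n}"
    and A_card: "\<And>i. i \<in> {1..n} \<Longrightarrow> \<alpha> i = card (A i)"
    and V_eq: "V = (\<Union>i\<in>{1..n}. A i)"
    and \<pi>_A: "\<And>i a. i \<in> {1..n} \<Longrightarrow> a \<in> A i \<Longrightarrow> \<pi> a = i"
    and \<cc>_eq: "\<cc> = Idl\<^bsub>mpoly_ring {1..n}\<^esub> ((\<lambda>i. var i ^ \<alpha> i) ` {1..n})"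
    and C_eq: "C = Idl\<^bsub>mpoly_ring V\<^esub> ((\<lambda>i. \<Prod>a\<in>A i. var a) ` {1..n})"
    and \<jj>_artin: "artin_monomial_ideal {1..n} \<jj>"
    and \<cc>_subset_\<jj>: "\<cc> \<subseteq> \<jj>"
    and J_polarization: "polarization n V \<pi> J \<jj>"
    and J_K_linked: "linked (mpoly_ring V) C J K"
    and \<jj>_\<kk>_linked: "linked (mpoly_ring {1..n}) \<cc> \<jj> \<kk>"
  shows "polarization n V \<pi> K \<kk>"
proof -
  \<comment> \<open>The enumerations witnessing the polarization \<open>J\<close> define the blocks
    and serve again as witnesses for \<open>K\<close>.\<close>
  obtain vs where vs: "\<forall>i\<in>{1..n}. distinct (vs i) \<and> set (vs i) = {v \<in> V. \<pi> v = i}"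
    and reg: "regular_sequence (mpoly_ring V) J
      (concat (map (\<lambda>i. successive_differences (vs i)) [1..<Suc n]))"
    using J_polarization unfolding polarization_def by blast
  have fibre: "{v \<in> V. \<pi> v = i} = A i" if "i \<in> {1..n}" for i
    using that \<pi>_A unfolding V_eq by blast
  have set_vs: "set (vs i) = A i" and distinct_vs: "distinct (vs i)" if "i \<in> {1..n}" for i
    using vs that fibre[OF that] by auto
  have \<pi>_range: "\<pi> v \<in> {1..n}" if "v \<in> V" for v
    using that \<pi>_A unfolding V_eq by blast
  have prod: "(\<Prod>a\<in>A i. var a) = (\<Prod>a\<leftarrow>vs i. var a :: ('a, 'k) mpoly)" if "i \<in> {1..n}" for i
    using prod.distinct_set_conv_list[OF distinct_vs[OF that], of var] set_vs[OF that] by simp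
  have C_vs: "C = Idl\<^bsub>mpoly_ring V\<^esub> ((\<lambda>i. \<Prod>a\<leftarrow>vs i. var a) ` {1..n})"
    unfolding C_eq using prod by (intro arg_cong[where f = "genideal _"] image_cong) auto
  interpret blocks: variable_blocks V n \<pi> vs C
  proof
    show "C = Idl\<^bsub>mpoly_ring V\<^esub> ((\<lambda>i. \<Prod>a\<leftarrow>vs i. var a) ` {1..n})" by (rule C_vs)
    show "set (vs i) = {v \<in> V. \<pi> v = i}" "distinct (vs i)" if "i \<in> {1..n}" for i
      using vs that by blast+
    show "vs i \<noteq> []" if "i \<in> {1..n}" for i using A_nonempty[OF that] set_vs[OF that] by auto
    show "\<pi> v \<in> {1..n}" if "v \<in> V" for v by (rule \<pi>_range[OF that])
  qed
  interpret linked: polarized_ideal V n \<pi> vs C J \<jj>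
  proof (intro polarized_ideal.intro polarized_ideal_axioms.intro blocks.variable_blocks_axioms)
    show "ideal J (mpoly_ring V)" "C \<subseteq> J" using J_K_linked unfolding linked_def by blast+
    show "rename_vars \<pi> ` J = \<jj>" using J_polarization unfolding polarization_def by blast
    have "squarefree_monomial_ideal V J" using J_polarization unfolding polarization_def by blast
    then show "monomial_ideal V J" by (rule squarefree_monomial_idealD)
    show "monomial_ideal {1..n} \<jj>" using \<jj>_artin by (simp add: artin_monomial_ideal_def)
    show "regular_sequence (mpoly_ring V) J blocks.\<theta>s" using reg by (simp only: blocks.\<theta>s_eq)
  qed
  have K: "K = linked.K"
    using J_K_linked unfolding linked_def linked.K_def by blast
  have "\<alpha> i = blocks.\<alpha> i" if "i \<in> {1..n}" for i
    using A_card[OF that] set_vs[OF that] distinct_card[OF distinct_vs[OF that]]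
    by (simp add: blocks.\<alpha>_def)
  then have "\<cc> = linked.\<cc>"
    unfolding \<cc>_eq linked.\<cc>_def by (intro arg_cong[where f = "genideal _"] image_cong) auto
  then have image: "rename_vars \<pi> ` K = \<kk>"
    using \<jj>_\<kk>_linked linked.K_image unfolding K linked_def by argo
  have "1 \<notin> linked.K"
    using J_K_linked unfolding linked_def K by (intro linked.K_proper) blast
  then have "regular_sequence (mpoly_ring V) linked.K blocks.\<theta>s"
    unfolding regular_sequence_def
    using blocks.take_\<theta>s_polys[of "length blocks.\<theta>s"] linked.K_regular linked.K_\<Theta>_proper[of "length blocks.\<theta>s"]
    by (auto simp: blocks.\<Theta>_def)
  then show ?thesis
    unfolding polarization_def K using linked.K_squarefree image vs
    by (intro conjI exI[of _ vs]) (auto simp only: blocks.\<theta>s_eq K)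
qed

end
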